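(* Let $\alpha\in(0,1)$, $\rho,\mu,\lambda>0$ and $0<\beta<\alpha$. Then the generalized fractional negative binomial process $\{\mathcal{G}(t)\}_{t\ge 0}$, $\mathcal{G}(t)=N_\beta(M(t),\lambda)$, exhibits the long-range dependence (LRD) property.
   Context: Fractional Poisson process (FPP): for $0<\beta<1$, let $\{S_\beta(t)\}_{t\ge0}$ be the $\beta$-stable subordinator with $\mathbb{E}[e^{-uS_\beta(t)}]=e^{-tu^\beta}$, and let $E_\beta(t)=\inf\{r\ge 0: S_\beta(r)>t\}$ be its inverse. The FPP with parameter $\lambda>0$ is $N_\beta(t,\lambda)=N(E_\beta(t),\lambda)$, where $\{N(t,\lambda)\}_{t\ge0}$ is a homogeneous Poisson process of rate $\lambda$ independent of $E_\beta$. Mittag-Leffler (ML) Lévy subordinator: for $\alpha\in(0,1)$ and $\rho,\mu>0$, $M(t)=M_{\alpha,\rho,\mu}(t)$ is the non-decreasing Lévy process with $M(0)=0$ and $\mathbb{E}[e^{-uM(t)}]=\left(\frac{\mu}{\mu+u^\alpha}\right)^{\rho t}$, $u\ge 0$. Generalized fractional negative binomial process (GFNBP): $\mathcal{G}(t)=\mathcal{G}_{\alpha,\rho}^{\mu,\beta}(t,\lambda):=N_\beta(M_{\alpha,\rho,\mu}(t),\lambda)$, $t\ge 0$, where $M$ is independent of $N_\beta$. LRD property: suppose that for $0<s<t$, with $s$ fixed, the correlation function of a process $\{X(t)\}_{t\ge0}$ satisfies $c_1(s)t^{-d}\le \operatorname{Corr}[X(s),X(t)]\le c_2(s)t^{-d}$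 for large $t$, with $d>0$, $c_1(s)>0$, $c_2(s)>0$; expressly, $$\lim_{t\to\infty}\frac{\operatorname{Corr}[X(s),X(t)]}{t^{-d}}=c(s)$$ for some $c(s)>0$ and $d>0$. The process is said to have the LRD property if $d\in(0,1)$.
   Formalization: Added assumption: every G(t) has a finite second moment, so that Corr[G(s),G(t)] exists. This forces 2β<α; for α/2≤β<α the variance of G(t) is infinite for t>0 and the correlation in the LRD property is undefined. *)

theory Defs
  imports "HOL-Probability.Probability"
begin

text \<open>
  A real-valued process with time set $[0,\infty)$ is a function \<^typ>\<open>real \<Rightarrow> 'a \<Rightarrow> real\<close>;
  its values at negative times are irrelevant.
\<close>

definition indep_increments :: "'a measure \<Rightarrow> (real \<Rightarrow> 'a \<Rightarrow> real) \<Rightarrow> bool" where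
  "indep_increments P X \<longleftrightarrow>
     (\<forall>(n::nat) \<tau>::nat \<Rightarrow> real. 0 \<le> \<tau> 0 \<and> (\<forall>i<n. \<tau> i \<le> \<tau> (Suc i)) \<longrightarrow>
        prob_space.indep_vars P (\<lambda>_. borel) (\<lambda>i \<omega>. X (\<tau> (Suc i)) \<omega> - X (\<tau> i) \<omega>) {..<n})"

definition stationary_increments :: "'a measure \<Rightarrow> (real \<Rightarrow> 'a \<Rightarrow> real) \<Rightarrow> bool" where
  "stationary_increments P X \<longleftrightarrow>
     (\<forall>s\<ge>0. \<forall>t\<ge>0. distr P borel (\<lambda>\<omega>. X (s + t) \<omega> - X s \<omega>) = distr P borel (\<lambda>\<omega>. X t \<omega> - X 0 \<omega>))"

definition cadlag :: "(real \<Rightarrow> real) \<Rightarrow> bool" where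
  "cadlag x \<longleftrightarrow>
     (\<forall>t\<ge>0. (x \<longlongrightarrow> x t) (at_right t)) \<and> (\<forall>t>0. \<exists>l. (x \<longlongrightarrow> l) (at_left t))"

text \<open>
  Stochastic continuity is not listed: it follows from right-continuity at 0 and stationarity.
\<close>

definition levy_process :: "'a measure \<Rightarrow> (real \<Rightarrow> 'a \<Rightarrow> real) \<Rightarrow> bool" where
  "levy_process P X \<longleftrightarrow>
     (\<forall>t\<ge>0. X t \<in> borel_measurable P) \<and>
     (AE \<omega> in P. X 0 \<omega> = 0) \<and>
     indep_increments P X \<and>
     stationary_increments P X \<and>
     (AE \<omega> in P. cadlag (\<lambda>t. X t \<omega>))"

definition subordinator :: "'a measure \<Rightarrow> (real \<Rightarrow> 'a \<Rightarrow> real) \<Rightarrow> bool" where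
  "subordinator P X \<longleftrightarrow> levy_process P X \<and> (AE \<omega> in P. mono_on {0..} (\<lambda>t. X t \<omega>))"

definition stable_subordinator :: "'a measure \<Rightarrow> real \<Rightarrow> (real \<Rightarrow> 'a \<Rightarrow> real) \<Rightarrow> bool" where
  "stable_subordinator P \<beta> S \<longleftrightarrow> subordinator P S \<and>
     (\<forall>t\<ge>0. \<forall>u\<ge>0. prob_space.expectation P (\<lambda>\<omega>. exp (- u * S t \<omega>)) = exp (- t * u powr \<beta>))"

definition ml_subordinator ::
    "'a measure \<Rightarrow> real \<Rightarrow> real \<Rightarrow> real \<Rightarrow> (real \<Rightarrow> 'a \<Rightarrow> real) \<Rightarrow> bool" where
  "ml_subordinator P \<alpha> \<rho> \<mu> M \<longleftrightarrow> subordinator P M \<and>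
     (\<forall>t\<ge>0. \<forall>u\<ge>0. prob_space.expectation P (\<lambda>\<omega>. exp (- u * M t \<omega>)) =
        (\<mu> / (\<mu> + u powr \<alpha>)) powr (\<rho> * t))"

definition poisson_process :: "'a measure \<Rightarrow> real \<Rightarrow> (real \<Rightarrow> 'a \<Rightarrow> nat) \<Rightarrow> bool" where
  "poisson_process P lam N \<longleftrightarrow>
     levy_process P (\<lambda>t \<omega>. real (N t \<omega>)) \<and>
     (\<forall>t>0. distr P (count_space UNIV) (N t) = measure_pmf (poisson_pmf (lam * t)))"

definition inverse_subordinator :: "(real \<Rightarrow> 'a \<Rightarrow> real) \<Rightarrow> real \<Rightarrow> 'a \<Rightarrow> real" where
  "inverse_subordinator S t \<omega> = Inf {r. 0 \<le> r \<and> t < S r \<omega>}"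

definition fpp :: "(real \<Rightarrow> 'a \<Rightarrow> nat) \<Rightarrow> (real \<Rightarrow> 'a \<Rightarrow> real) \<Rightarrow> real \<Rightarrow> 'a \<Rightarrow> nat" where
  "fpp N S t \<omega> = N (inverse_subordinator S t \<omega>) \<omega>"

definition gfnbp ::
    "(real \<Rightarrow> 'a \<Rightarrow> nat) \<Rightarrow> (real \<Rightarrow> 'a \<Rightarrow> real) \<Rightarrow> (real \<Rightarrow> 'a \<Rightarrow> real) \<Rightarrow> real \<Rightarrow> 'a \<Rightarrow> nat" where
  "gfnbp N S M t \<omega> = fpp N S (M t \<omega>) \<omega>"

text \<open>
  Independence of whole processes, viewed as random elements of the product space
  $\mathbb{R}^{[0,\infty)}$.
\<close>

definition indep_processes ::
    "'a measure \<Rightarrow> (real \<Rightarrow> 'a \<Rightarrow> real) \<Rightarrow> (real \<Rightarrow> 'a \<Rightarrow> real) \<Rightarrow> bool" where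
  "indep_processes P X Y \<longleftrightarrow>
     prob_space.indep_var P
       (PiM {0..} (\<lambda>_. borel)) (\<lambda>\<omega>. \<lambda>t\<in>{0..}. X t \<omega>)
       (PiM {0..} (\<lambda>_. borel)) (\<lambda>\<omega>. \<lambda>t\<in>{0..}. Y t \<omega>)"

definition covariance :: "'a measure \<Rightarrow> ('a \<Rightarrow> real) \<Rightarrow> ('a \<Rightarrow> real) \<Rightarrow> real" where
  "covariance P X Y = prob_space.expectation P
     (\<lambda>\<omega>. (X \<omega> - prob_space.expectation P X) * (Y \<omega> - prob_space.expectation P Y))"

definition correlation :: "'a measure \<Rightarrow> ('a \<Rightarrow> real) \<Rightarrow> ('a \<Rightarrow> real) \<Rightarrow> real" where
  "correlation P X Y =
     covariance P X Y / (sqrt (prob_space.variance P X) * sqrt (prob_space.variance P Y))"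

text \<open>
  The processes for which the correlation function exists.  The Bochner integral is 0 on
  non-integrable functions, so without this condition \<^const>\<open>correlation\<close> is meaningless.
\<close>

definition second_order_process :: "'a measure \<Rightarrow> (real \<Rightarrow> 'a \<Rightarrow> real) \<Rightarrow> bool" where
  "second_order_process P X \<longleftrightarrow>
     (\<forall>t\<ge>0. X t \<in> borel_measurable P \<and> integrable P (\<lambda>\<omega>. (X t \<omega>)\<^sup>2))"

text \<open>
  The exponent \<open>d\<close> does not depend on \<open>s\<close>, the constant \<open>c\<close> may.  To be used for
  second-order processes.
\<close>

definition lrd_property :: "'a measure \<Rightarrow> (real \<Rightarrow> 'a \<Rightarrow> real) \<Rightarrow> bool" where
  "lrd_property P X \<longleftrightarrow>
     (\<exists>d. 0 < d \<and> d < 1 \<and>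
        (\<forall>s>0. \<exists>c>0. ((\<lambda>t. correlation P (X s) (X t) / t powr (- d)) \<longlongrightarrow> c) at_top))"

end

theory Submission
  imports Defs
begin

text \<open>
  Write \<open>E\<close> for the inverse of the stable subordinator \<open>S\<close>, \<open>Y(t) = N(E(t))\<close> for the fractional Poisson
  process, \<open>X\<close> for the Mittag-Leffler subordinator and \<open>G(t) = Y(X(t))\<close>.  The theorem holds with
  \<open>d = \<beta>/\<alpha>\<close>: for fixed \<open>s\<close> the covariance of \<open>G(s)\<close> and \<open>G(t)\<close> tends to a positive constant, whereas
  the standard deviation of \<open>G(t)\<close> grows like a constant times \<open>t powr (\<beta>/\<alpha>)\<close>.

  The moments of \<open>G\<close> come from two successive time changes by independent clocks, and each of them is
  computed by conditioning on the clock (\<open>nn_integral_at_independent_times\<close>).  A Poisson process has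
  \<open>E[N(a) N(b)] = lam a + lam\<^sup>2 a b\<close> for \<open>a \<le> b\<close>, so the moments of \<open>Y\<close> reduce to those of \<open>E\<close>.

  For \<open>E\<close>, the key is that \<open>E(t)\<close> is the length of \<open>{x. S(x) \<le> t}\<close>.  Its mean is therefore
  \<open>U(t) = \<integral> P(S(x) \<le> t) dx\<close>, and for \<open>s \<le> t\<close> the independence and stationarity of the increments
  of \<open>S\<close> give
  \<open>E[E(s)\<^sup>2]/2 + U(s) U(t - s) \<le> E[E(s) E(t)] \<le> E[E(s)\<^sup>2]/2 + U(s) U(t)\<close>
  (\<open>nn_integral_inverse_product\<close>).  The self-similarity of \<open>S\<close>, which is read off its Laplace transform,
  makes \<open>U(t)\<close> and \<open>E[E(t)\<^sup>2]\<close> constant multiples of \<open>t powr \<beta>\<close> and \<open>t powr (2 \<beta>)\<close>; what matters about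
  the constants is that \<open>E(1)\<close> is not deterministic, so that its variance is positive
  (\<open>inverse_not_constant\<close>).  These two-sided bounds replace the exact covariance of \<open>E\<close>.

  Substituting \<open>X\<close> for the time argument, with constants \<open>k > 0\<close> and \<open>l > k\<^sup>2/2\<close>, the expectation of
  \<open>G(s) G(t)\<close> lies between the expectations of
  \<open>k X(s) powr \<beta> + l X(s) powr (2 \<beta>) + k\<^sup>2 X(s) powr \<beta> (X(t) - X(s)) powr \<beta>\<close> and of the same expression
  with \<open>X(t)\<close> in place of \<open>X(t) - X(s)\<close>.  The increment is independent of \<open>X(s)\<close>, and
  \<open>X(t) powr \<beta> - (X(t) - X(s)) powr \<beta>\<close> is bounded by \<open>X(s) powr \<beta>\<close> and vanishes as \<open>X(t)\<close> tends to
  infinity because \<open>\<beta> < 1\<close>.  Hence the covariance converges to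
  \<open>k E[X(s) powr \<beta>] + l E[X(s) powr (2 \<beta>)]\<close> (\<open>G_covariance_limit\<close>).

  The variance of \<open>G(t)\<close> is \<open>k E[X(t) powr \<beta>] + 2 l E[X(t) powr (2 \<beta>)] - k\<^sup>2 E[X(t) powr \<beta>]\<^sup>2\<close>.  The
  fractional moments of \<open>X(t)\<close> are integrals of its Laplace transform; after rescaling by
  \<open>t powr (1/\<alpha>)\<close> they converge by dominated convergence (\<open>ml_moment_asymptotics\<close>).  The moment of order
  \<open>\<alpha>\<close> is infinite, so the square integrability of \<open>G\<close> forces \<open>2 \<beta> < \<alpha>\<close>, and both moments are covered.
\<close>

section \<open>Evaluating a process at an independent random time\<close>

text \<open>
  The right limit of a path along the grids of mesh \<open>1/(n+1)\<close>.  At a point of right-continuity it is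
  the value of the path, but it only looks at countably many coordinates of the path.  This makes it
  jointly measurable in path and time for the product sigma-algebra, for which plain evaluation
  is not jointly measurable.
\<close>

definition right_eval :: "(real \<Rightarrow> real) \<Rightarrow> real \<Rightarrow> real" where
  "right_eval y x = lim (\<lambda>n. y (real (nat \<lfloor>real (Suc n) * x\<rfloor> + 1) / real (Suc n)))"

lemma measurable_right_eval [measurable]:
  assumes [measurable]: "f \<in> measurable A (PiM {0..} (\<lambda>_. borel))" "g \<in> borel_measurable A"
  shows "(\<lambda>w. right_eval (f w) (g w)) \<in> borel_measurable A"
proof -
  have "(\<lambda>w. f w (real (nat \<lfloor>real (Suc n) * g w\<rfloor> + 1) / real (Suc n))) \<in> borel_measurable A" for n
  proof (rule measurable_compose_countable
      [where f = "\<lambda>k w. f w (real (k + 1) / real (Suc n))" and g = "\<lambda>w. nat \<lfloor>real (Suc n) * g w\<rfloor>"])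
    show "(\<lambda>w. f w (real (k + 1) / real (Suc n))) \<in> borel_measurable A" for k :: nat
      by (rule measurable_compose[OF assms(1) measurable_component_singleton]) auto
  qed measurable
  then show ?thesis
    unfolding right_eval_def by (rule borel_measurable_lim_metric)
qed

text \<open>
  The grid points approach \<open>x\<close> strictly from the right, so that right-continuity applies.
\<close>

lemma right_eval_eq:
  assumes "0 \<le> x" and "(y \<longlongrightarrow> y x) (at_right x)"
  shows "right_eval (\<lambda>t\<in>{0..}. y t) x = y x"
proof -
  define a where "a n = real (nat \<lfloor>real (Suc n) * x\<rfloor> + 1) / real (Suc n)" for n
  have a_eq: "a n = (of_int \<lfloor>real (Suc n) * x\<rfloor> + 1) / real (Suc n)" for n
    using assms(1) unfolding a_def by (simp add: zero_le_mult_iff)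
  have gt: "x < a n" for n
    unfolding a_eq by (subst less_divide_eq) (simp add: mult.commute[of x])
  have le: "a n \<le> x + 1 / real (Suc n)" for n
  proof -
    have "of_int \<lfloor>real (Suc n) * x\<rfloor> + 1 \<le> real (Suc n) * x + 1" by linarith
    then have "a n \<le> (real (Suc n) * x + 1) / real (Suc n)"
      unfolding a_eq by (rule divide_right_mono) simp
    also have "\<dots> = x + 1 / real (Suc n)"
      by (simp add: add_divide_distrib)
    finally show ?thesis .
  qed
  have "a \<longlonglongrightarrow> x"
  proof (rule tendsto_sandwich[of "\<lambda>_. x" _ _ "\<lambda>n. x + 1 / real (Suc n)"])
    show "(\<lambda>n. x + 1 / real (Suc n)) \<longlonglongrightarrow> x"
      using tendsto_add[OF tendsto_const LIMSEQ_inverse_real_of_nat, of x]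
      by (simp add: inverse_eq_divide)
  qed (use gt le in \<open>auto intro!: always_eventually intro: less_imp_le simp del: of_nat_Suc\<close>)
  then have "filterlim a (at_right x) sequentially"
    using gt by (auto simp: filterlim_at intro!: always_eventually)
  then have "(\<lambda>n. y (a n)) \<longlonglongrightarrow> y x"
    by (rule filterlim_compose[OF assms(2)])
  moreover have "(\<lambda>t\<in>{0..}. y t) (a n) = y (a n)" for n
    using gt[of n] assms(1) by auto
  ultimately show ?thesis
    unfolding right_eval_def a_def[symmetric] by (simp add: limI)
qed

lemma (in prob_space) indep_processes_sym:
  "indep_processes M X Y \<Longrightarrow> indep_processes M Y X"
  unfolding indep_processes_def indep_var_eq indep_sets2_eq
  by (metis (no_types, lifting) Int_commute mult.commute)

text \<open>
  Conditioning on an independent random clock: the joint law of the two processes is a product measure,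
  and \<^const>\<open>right_eval\<close> makes the integrand a measurable function of the two paths, so Tonelli
  applies.  The two times \<open>X s\<close> and \<open>X t\<close> are frozen together, which is what second moments need.
\<close>

lemma (in prob_space) nn_integral_at_independent_times:
  fixes g :: "real \<Rightarrow> real \<Rightarrow> ennreal"
  assumes indep: "indep_processes M X Y"
    and g [measurable]: "(\<lambda>(a, b). g a b) \<in> borel_measurable (borel \<Otimes>\<^sub>M borel)"
    and Y: "AE \<omega> in M. \<forall>x\<ge>0. ((\<lambda>t. Y t \<omega>) \<longlongrightarrow> Y x \<omega>) (at_right x)"
    and st: "0 \<le> s" "0 \<le> t" and pos: "AE \<omega> in M. 0 \<le> X s \<omega> \<and> 0 \<le> X t \<omega>"
  shows "(\<integral>\<^sup>+\<omega>. g (Y (X s \<omega>) \<omega>) (Y (X t \<omega>) \<omega>) \<partial>M) =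
    (\<integral>\<^sup>+\<omega>. (\<integral>\<^sup>+\<omega>'. g (Y (X s \<omega>) \<omega>') (Y (X t \<omega>) \<omega>') \<partial>M) \<partial>M)"
proof -
  let ?C = "PiM {0::real..} (\<lambda>_. borel :: real measure)"
  let ?X = "\<lambda>\<omega>. \<lambda>t\<in>{0..}. X t \<omega>" and ?Y = "\<lambda>\<omega>. \<lambda>t\<in>{0..}. Y t \<omega>"
  define h where "h x y = g (right_eval y (x s)) (right_eval y (x t))" for x y
  have X [measurable]: "?X \<in> measurable M ?C" and Ym [measurable]: "?Y \<in> measurable M ?C"
    and joint: "distr M ?C ?X \<Otimes>\<^sub>M distr M ?C ?Y = distr M (?C \<Otimes>\<^sub>M ?C) (\<lambda>\<omega>. (?X \<omega>, ?Y \<omega>))"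
    using indep unfolding indep_processes_def indep_var_distribution_eq by auto
  interpret Y: prob_space "distr M ?C ?Y" by (rule prob_space_distr) fact
  have comp [measurable]: "(\<lambda>x. x s) \<in> borel_measurable ?C" "(\<lambda>x. x t) \<in> borel_measurable ?C"
    using st by (auto intro!: measurable_component_singleton)
  have h [measurable]: "(\<lambda>(x, y). h x y) \<in> borel_measurable (?C \<Otimes>\<^sub>M ?C)"
    unfolding h_def by measurable
  have eval: "AE \<omega> in M. \<forall>x\<ge>0. right_eval (?Y \<omega>) x = Y x \<omega>"
    using Y by eventually_elim (auto intro!: right_eval_eq)
  have "(\<integral>\<^sup>+\<omega>. g (Y (X s \<omega>) \<omega>) (Y (X t \<omega>) \<omega>) \<partial>M) = (\<integral>\<^sup>+\<omega>. h (?X \<omega>) (?Y \<omega>) \<partial>M)"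
    using eval pos by (intro nn_integral_cong_AE, eventually_elim) (use st in \<open>simp add: h_def\<close>)
  also have "\<dots> = (\<integral>\<^sup>+z. (\<lambda>(x, y). h x y) z \<partial>(distr M ?C ?X \<Otimes>\<^sub>M distr M ?C ?Y))"
    unfolding joint by (subst nn_integral_distr) auto
  also have "\<dots> = (\<integral>\<^sup>+x. \<integral>\<^sup>+y. h x y \<partial>distr M ?C ?Y \<partial>distr M ?C ?X)"
    by (subst Y.nn_integral_fst[symmetric]) auto
  also have "\<dots> = (\<integral>\<^sup>+\<omega>. \<integral>\<^sup>+y. h (?X \<omega>) y \<partial>distr M ?C ?Y \<partial>M)"
    by (subst nn_integral_distr) (auto intro!: Y.borel_measurable_nn_integral)
  also have "\<dots> = (\<integral>\<^sup>+\<omega>. (\<integral>\<^sup>+\<omega>'. g (Y (X s \<omega>) \<omega>') (Y (X t \<omega>) \<omega>') \<partial>M) \<partial>M)"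
    using pos
  proof (intro nn_integral_cong_AE, eventually_elim)
    case (elim \<omega>)
    have "(\<integral>\<^sup>+y. h (?X \<omega>) y \<partial>distr M ?C ?Y) = (\<integral>\<^sup>+\<omega>'. h (?X \<omega>) (?Y \<omega>') \<partial>M)"
      by (subst nn_integral_distr) (auto simp: h_def)
    also have "\<dots> = (\<integral>\<^sup>+\<omega>'. g (Y (X s \<omega>) \<omega>') (Y (X t \<omega>) \<omega>') \<partial>M)"
      using eval by (intro nn_integral_cong_AE, eventually_elim) (use st elim in \<open>simp add: h_def\<close>)
    finally show ?case .
  qed
  finally show ?thesis .
qed

section \<open>Laplace transforms determine distribution functions\<close>

text \<open>
  The transforms at the natural numbers are the moments of \<open>exp (- X)\<close> and \<open>exp (- Y)\<close>, which take values
  in the unit interval; there polynomials are dense by the Weierstrass theorem.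
\<close>

lemma (in prob_space) expectation_continuous_exp_eq:
  fixes f :: "real \<Rightarrow> real"
  assumes [measurable]: "X \<in> borel_measurable M" "Y \<in> borel_measurable M"
    and pos: "AE \<omega> in M. 0 \<le> X \<omega>" "AE \<omega> in M. 0 \<le> Y \<omega>"
    and eq: "\<And>n::nat. expectation (\<lambda>\<omega>. exp (- real n * X \<omega>)) = expectation (\<lambda>\<omega>. exp (- real n * Y \<omega>))"
    and f: "continuous_on UNIV f"
  shows "expectation (\<lambda>\<omega>. f (exp (- X \<omega>))) = expectation (\<lambda>\<omega>. f (exp (- Y \<omega>)))"
proof -
  have [measurable]: "f \<in> borel_measurable borel"
    using f by (rule borel_measurable_continuous_onI)
  have close: "\<bar>expectation (\<lambda>\<omega>. f (exp (- X \<omega>))) - expectation (\<lambda>\<omega>. f (exp (- Y \<omega>)))\<bar> \<le> 2 * e"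
    if e: "0 < e" for e
  proof -
    obtain p where p: "real_polynomial_function p" and pf: "\<And>z. z \<in> {0..1} \<Longrightarrow> \<bar>f z - p z\<bar> < e"
      using Stone_Weierstrass_real_polynomial_function[OF _ continuous_on_subset[OF f] e, of "{0..1}"]
      by auto
    obtain a n where p_eq: "p = (\<lambda>x. \<Sum>i\<le>n. a i * x ^ i)"
      using p unfolding real_polynomial_function_iff_sum by auto
    have [measurable]: "p \<in> borel_measurable borel" unfolding p_eq by measurable
    have bdf: "bounded (f ` {0..1})"
      by (intro compact_imp_bounded compact_continuous_image continuous_on_subset[OF f]) auto
    then obtain B where B: "\<And>z. z \<in> {0..1} \<Longrightarrow> \<bar>f z\<bar> \<le> B"
      unfolding bounded_iff by (metis imageI real_norm_def)
    have Ep: "expectation (\<lambda>\<omega>. p (exp (- V \<omega>))) = (\<Sum>i\<le>n. a i * expectation (\<lambda>\<omega>. exp (- real i * V \<omega>)))"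
      and near: "\<bar>expectation (\<lambda>\<omega>. f (exp (- V \<omega>))) - expectation (\<lambda>\<omega>. p (exp (- V \<omega>)))\<bar> \<le> e"
      if [measurable]: "V \<in> borel_measurable M" and V: "AE \<omega> in M. 0 \<le> V \<omega>" for V
    proof -
      have int: "integrable M (\<lambda>\<omega>. exp (- real i * V \<omega>))" for i
        by (rule integrable_const_bound[where B = 1])
           (use V in \<open>auto elim!: eventually_mono\<close>)
      have p_exp: "p (exp (- V \<omega>)) = (\<Sum>i\<le>n. a i * exp (- real i * V \<omega>))" for \<omega>
        unfolding p_eq by (simp add: exp_of_nat_mult[symmetric])
      show "expectation (\<lambda>\<omega>. p (exp (- V \<omega>))) = (\<Sum>i\<le>n. a i * expectation (\<lambda>\<omega>. exp (- real i * V \<omega>)))"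
        unfolding p_exp using int by (subst Bochner_Integration.integral_sum) auto
      have intp: "integrable M (\<lambda>\<omega>. p (exp (- V \<omega>)))"
        unfolding p_exp using int by auto
      have intf: "integrable M (\<lambda>\<omega>. f (exp (- V \<omega>)))"
        by (rule integrable_const_bound[where B = B])
           (use V in \<open>auto elim!: eventually_mono intro!: B\<close>)
      have "\<bar>expectation (\<lambda>\<omega>. f (exp (- V \<omega>)) - p (exp (- V \<omega>)))\<bar>
          \<le> expectation (\<lambda>\<omega>. \<bar>f (exp (- V \<omega>)) - p (exp (- V \<omega>))\<bar>)"
        by (rule integral_abs_bound)
      also have "\<dots> \<le> expectation (\<lambda>\<omega>. e)"
        by (rule integral_mono_AE)
           (use intp intf V in \<open>auto elim!: eventually_mono intro!: less_imp_le[OF pf]\<close>)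
      finally show "\<bar>expectation (\<lambda>\<omega>. f (exp (- V \<omega>))) - expectation (\<lambda>\<omega>. p (exp (- V \<omega>)))\<bar> \<le> e"
        using intp intf by (simp add: prob_space)
    qed
    have "expectation (\<lambda>\<omega>. p (exp (- X \<omega>))) = expectation (\<lambda>\<omega>. p (exp (- Y \<omega>)))"
      by (simp only: Ep assms(1,2) pos eq)
    then show ?thesis
      using near[OF assms(1) pos(1)] near[OF assms(2) pos(2)] by linarith
  qed
  show ?thesis
  proof (rule ccontr)
    assume "\<not> ?thesis"
    with close[of "\<bar>expectation (\<lambda>\<omega>. f (exp (- X \<omega>))) - expectation (\<lambda>\<omega>. f (exp (- Y \<omega>)))\<bar> / 4"]
    show False by auto
  qed
qed

text \<open>
  The event \<open>X \<le> a\<close> is \<open>exp (- X) \<ge> exp (- a)\<close>, and the indicator of a closed half line is a pointwise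
  limit of continuous functions with values between 0 and 1.
\<close>

lemma (in prob_space) cdf_eq_if_laplace_eq:
  assumes [measurable]: "X \<in> borel_measurable M" "Y \<in> borel_measurable M"
    and pos: "AE \<omega> in M. 0 \<le> X \<omega>" "AE \<omega> in M. 0 \<le> Y \<omega>"
    and eq: "\<And>n::nat. expectation (\<lambda>\<omega>. exp (- real n * X \<omega>)) = expectation (\<lambda>\<omega>. exp (- real n * Y \<omega>))"
  shows "\<P>(\<omega> in M. X \<omega> \<le> a) = \<P>(\<omega> in M. Y \<omega> \<le> a)"
proof -
  \<comment> \<open>equal to 1 from exp (- a) on, with a linear ramp of slope k just below\<close>
  define f where "f k z = max 0 (1 + real k * min 0 (z - exp (- a)))" for k z
  have f_cont: "continuous_on UNIV (f k)" for k
    unfolding f_def by (intro continuous_intros)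
  have [measurable]: "f k \<in> borel_measurable borel" for k
    using f_cont by (rule borel_measurable_continuous_onI)
  have f_lim: "(\<lambda>k. f k z) \<longlonglongrightarrow> indicator {exp (- a)..} z" for z
  proof (cases "exp (- a) \<le> z")
    case False
    obtain k0 :: nat where k0: "1 < real k0 * (exp (- a) - z)"
      using ex_less_of_nat_mult[of "exp (- a) - z" 1] False by auto
    have "f k z = 0" if "k0 \<le> k" for k
    proof -
      have "real k0 * (exp (- a) - z) \<le> real k * (exp (- a) - z)"
        using that False by (intro mult_right_mono) auto
      then show ?thesis using False k0 unfolding f_def by (simp add: algebra_simps)
    qed
    then have "eventually (\<lambda>k. f k z = indicator {exp (- a)..} z) sequentially"
      using False by (auto simp: eventually_sequentially intro!: exI[of _ k0])
    then show ?thesis by (rule tendsto_eventually)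
  qed (simp add: f_def)
  have lim: "(\<lambda>k. expectation (\<lambda>\<omega>. f k (exp (- V \<omega>)))) \<longlonglongrightarrow> \<P>(\<omega> in M. V \<omega> \<le> a)"
    if [measurable]: "V \<in> borel_measurable M" for V
  proof -
    have "(\<lambda>k. expectation (\<lambda>\<omega>. f k (exp (- V \<omega>)))) \<longlonglongrightarrow>
        expectation (\<lambda>\<omega>. indicator {exp (- a)..} (exp (- V \<omega>)))"
    proof (rule integral_dominated_convergence[where w = "\<lambda>_. 1"])
      show "AE \<omega> in M. norm (f k (exp (- V \<omega>))) \<le> 1" for k
        by (auto simp: f_def mult_le_0_iff intro!: always_eventually)
    qed (use f_lim in auto)
    also have "(\<lambda>\<omega>. indicator {exp (- a)..} (exp (- V \<omega>))) = (indicator {\<omega>. V \<omega> \<le> a} :: _ \<Rightarrow> real)"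
      by (auto simp: indicator_def)
    also have "expectation (indicator {\<omega>. V \<omega> \<le> a}) = \<P>(\<omega> in M. V \<omega> \<le> a)"
      by (simp add: Int_def conj_commute)
    finally show ?thesis .
  qed
  have "expectation (\<lambda>\<omega>. f k (exp (- X \<omega>))) = expectation (\<lambda>\<omega>. f k (exp (- Y \<omega>)))" for k
    by (rule expectation_continuous_exp_eq) (use assms f_cont in auto)
  then show ?thesis
    using lim[OF assms(1)] lim[OF assms(2)] by (simp add: LIMSEQ_unique)
qed

section \<open>Independent increments and the moments of a Poisson process\<close>

text \<open>
  Apply independence of increments to the time points \<open>0, a, b\<close>; the first increment is \<open>X a\<close> almost surely.
\<close>

lemma (in prob_space) levy_process_indep_increment:
  assumes levy: "levy_process M X" and ab: "0 \<le> a" "a \<le> b"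
  shows "indep_var borel (X a) borel (\<lambda>\<omega>. X b \<omega> - X a \<omega>)"
proof -
  define \<tau> where "\<tau> i = (if i = 0 then 0 else if i = 1 then a else b)" for i :: nat
  have [measurable]: "X a \<in> borel_measurable M" "X b \<in> borel_measurable M" "X 0 \<in> borel_measurable M"
    and X0: "AE \<omega> in M. X 0 \<omega> = 0"
    using levy ab unfolding levy_process_def by auto
  have "indep_vars (\<lambda>_. borel) (\<lambda>i \<omega>. X (\<tau> (Suc i)) \<omega> - X (\<tau> i) \<omega>) {..<2}"
  proof -
    have "0 \<le> \<tau> 0 \<and> (\<forall>i<2. \<tau> i \<le> \<tau> (Suc i))" using ab by (auto simp: \<tau>_def)
    then show ?thesis using levy unfolding levy_process_def indep_increments_def by blast
  qed
  then have "indep_var (PiM {0} (\<lambda>_. borel)) (\<lambda>\<omega>. \<lambda>i\<in>{0}. X (\<tau> (Suc i)) \<omega> - X (\<tau> i) \<omega>)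
      (PiM {1} (\<lambda>_. borel)) (\<lambda>\<omega>. \<lambda>i\<in>{1}. X (\<tau> (Suc i)) \<omega> - X (\<tau> i) \<omega>)"
    by (rule indep_var_restrict) auto
  then have "indep_var borel ((\<lambda>x. x 0) \<circ> (\<lambda>\<omega>. \<lambda>i\<in>{0}. X (\<tau> (Suc i)) \<omega> - X (\<tau> i) \<omega>))
      borel ((\<lambda>x. x 1) \<circ> (\<lambda>\<omega>. \<lambda>i\<in>{1}. X (\<tau> (Suc i)) \<omega> - X (\<tau> i) \<omega>))"
    by (rule indep_var_compose) (auto intro!: measurable_component_singleton)
  then have ind: "indep_var borel (\<lambda>\<omega>. X a \<omega> - X 0 \<omega>) borel (\<lambda>\<omega>. X b \<omega> - X a \<omega>)"
    by (simp add: comp_def \<tau>_def)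
  have "distr M borel (X a) = distr M borel (\<lambda>\<omega>. X a \<omega> - X 0 \<omega>)"
    by (rule distr_cong_AE) (use X0 in auto)
  moreover have "distr M (borel \<Otimes>\<^sub>M borel) (\<lambda>\<omega>. (X a \<omega>, X b \<omega> - X a \<omega>)) =
      distr M (borel \<Otimes>\<^sub>M borel) (\<lambda>\<omega>. (X a \<omega> - X 0 \<omega>, X b \<omega> - X a \<omega>))"
    by (rule distr_cong_AE) (use X0 in auto)
  ultimately show ?thesis
    using ind unfolding indep_var_distribution_eq by simp
qed

text \<open>
  An index shift in the exponential series; the second sum follows from the first one by writing
  \<open>(k + 1)\<^sup>2 / fact (k + 1) = k / fact k + 1 / fact k\<close>.
\<close>

lemma poisson_sums:
  fixes r :: real
  shows "(\<lambda>k. r ^ k / fact k * exp (- r) * real k) sums r"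
    and "(\<lambda>k. r ^ k / fact k * exp (- r) * (real k)\<^sup>2) sums (r + r\<^sup>2)"
proof -
  have e: "(\<lambda>k. r ^ k / fact k) sums exp r"
    using exp_converges[of r] by (simp add: divide_inverse mult.commute)
  have "(\<lambda>k. r ^ k / fact k * (r * exp (- r))) sums (exp r * (r * exp (- r)))"
    using e by (rule sums_mult2)
  also have "exp r * (r * exp (- r)) = r" by (simp add: exp_minus)
  also have "(\<lambda>k. r ^ k / fact k * (r * exp (- r))) = (\<lambda>k. r ^ Suc k / fact (Suc k) * exp (- r) * real (Suc k))"
    by (simp add: fun_eq_iff del: of_nat_Suc)
  finally show one: "(\<lambda>k. r ^ k / fact k * exp (- r) * real k) sums r"
    by (subst (asm) sums_Suc_iff) simp
  have "(\<lambda>k. r * (r ^ k / fact k * exp (- r) * real k) + r ^ k / fact k * (r * exp (- r))) sums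
      (r * r + exp r * (r * exp (- r)))"
    using sums_add[OF sums_mult[OF one] sums_mult2[OF e]] .
  also have "r * r + exp r * (r * exp (- r)) = r + r\<^sup>2" by (simp add: exp_minus power2_eq_square)
  also have "(\<lambda>k. r * (r ^ k / fact k * exp (- r) * real k) + r ^ k / fact k * (r * exp (- r))) =
      (\<lambda>k. r ^ Suc k / fact (Suc k) * exp (- r) * (real (Suc k))\<^sup>2)"
  proof (rule ext)
    fix k
    have "(real (Suc k))\<^sup>2 / fact (Suc k) = real (Suc k) / fact k"
      by (simp add: power2_eq_square del: of_nat_Suc)
    then have "r ^ Suc k / fact (Suc k) * exp (- r) * (real (Suc k))\<^sup>2 =
        r ^ Suc k * exp (- r) * (real (Suc k) / fact k)"
      by (metis (no_types, opaque_lifting) mult.assoc mult.commute times_divide_eq_right)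
    then show "r * (r ^ k / fact k * exp (- r) * real k) + r ^ k / fact k * (r * exp (- r)) =
        r ^ Suc k / fact (Suc k) * exp (- r) * (real (Suc k))\<^sup>2"
      by (simp add: field_simps)
  qed
  finally show "(\<lambda>k. r ^ k / fact k * exp (- r) * (real k)\<^sup>2) sums (r + r\<^sup>2)"
    by (subst (asm) sums_Suc_iff) simp
qed

lemma poisson_pmf_moments:
  fixes r :: real
  assumes r: "0 < r"
  shows "(\<integral>\<^sup>+k. ennreal (real k) \<partial>measure_pmf (poisson_pmf r)) = ennreal r"
    and "(\<integral>\<^sup>+k. ennreal ((real k)\<^sup>2) \<partial>measure_pmf (poisson_pmf r)) = ennreal (r + r\<^sup>2)"
proof -
  have gen: "(\<integral>\<^sup>+k. ennreal (f k) \<partial>measure_pmf (poisson_pmf r)) = ennreal c"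
    if "(\<lambda>k. r ^ k / fact k * exp (- r) * f k) sums c" "\<And>k. 0 \<le> f k" for f :: "nat \<Rightarrow> real" and c
  proof -
    have nonneg: "0 \<le> r ^ k / fact k * exp (- r) * f k" for k using r that(2) by simp
    have "(\<integral>\<^sup>+k. ennreal (f k) \<partial>measure_pmf (poisson_pmf r)) =
        (\<Sum>k. ennreal (r ^ k / fact k * exp (- r) * f k))"
      using r that(2)
      by (simp add: nn_integral_measure_pmf nn_integral_count_space_nat ennreal_mult' flip: ennreal_mult)
    also have "\<dots> = ennreal c"
      by (rule suminf_ennreal_eq[OF nonneg that(1)])
    finally show ?thesis .
  qed
  show "(\<integral>\<^sup>+k. ennreal (real k) \<partial>measure_pmf (poisson_pmf r)) = ennreal r"
    by (rule gen[OF poisson_sums(1)]) simp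
  show "(\<integral>\<^sup>+k. ennreal ((real k)\<^sup>2) \<partial>measure_pmf (poisson_pmf r)) = ennreal (r + r\<^sup>2)"
    by (rule gen[OF poisson_sums(2)]) simp
qed

text \<open>
  Decompose \<open>N(a) N(b) = N(a)\<^sup>2 + N(a) (N(b) - N(a))\<close> into a second moment of a Poisson law and a product
  of independent factors.
\<close>

lemma (in prob_space) poisson_process_moments:
  assumes pois: "poisson_process M lam N" and lam: "0 < lam" and ab: "0 \<le> a" "a \<le> b"
  shows "(\<integral>\<^sup>+\<omega>. ennreal (real (N a \<omega>)) \<partial>M) = ennreal (lam * a)"
    and "(\<integral>\<^sup>+\<omega>. ennreal (real (N a \<omega>) * real (N b \<omega>)) \<partial>M) = ennreal (lam * a + lam\<^sup>2 * a * b)"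
proof -
  have levy: "levy_process M (\<lambda>t \<omega>. real (N t \<omega>))"
    and law: "\<And>t. 0 < t \<Longrightarrow> distr M (count_space UNIV) (N t) = measure_pmf (poisson_pmf (lam * t))"
    using pois unfolding poisson_process_def by auto
  have rm [measurable]: "(\<lambda>\<omega>. real (N t \<omega>)) \<in> borel_measurable M" if "0 \<le> t" for t
    using levy that unfolding levy_process_def by auto
  have N0: "AE \<omega> in M. N 0 \<omega> = 0"
    using levy unfolding levy_process_def by auto
  have Nm [measurable]: "N t \<in> measurable M (count_space UNIV)" if "0 \<le> t" for t
  proof -
    have "(\<lambda>\<omega>. nat \<lfloor>real (N t \<omega>)\<rfloor>) \<in> measurable M (count_space UNIV)"
      using rm[OF that] by measurable
    then show ?thesis by simp
  qed
  have nn: "(\<integral>\<^sup>+\<omega>. ennreal (real (N t \<omega>)) \<partial>M) = ennreal (lam * t)"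
    "(\<integral>\<^sup>+\<omega>. ennreal ((real (N t \<omega>))\<^sup>2) \<partial>M) = ennreal (lam * t + (lam * t)\<^sup>2)" if t: "0 \<le> t" for t
  proof -
    have "(\<integral>\<^sup>+\<omega>. ennreal (real (N t \<omega>)) \<partial>M) = ennreal (lam * t) \<and>
        (\<integral>\<^sup>+\<omega>. ennreal ((real (N t \<omega>))\<^sup>2) \<partial>M) = ennreal (lam * t + (lam * t)\<^sup>2)"
    proof (cases "t = 0")
      case True
      have "(\<integral>\<^sup>+\<omega>. ennreal (real (N 0 \<omega>)) \<partial>M) = (\<integral>\<^sup>+\<omega>. 0 \<partial>M)"
        "(\<integral>\<^sup>+\<omega>. ennreal ((real (N 0 \<omega>))\<^sup>2) \<partial>M) = (\<integral>\<^sup>+\<omega>. 0 \<partial>M)"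
        by (intro nn_integral_cong_AE; use N0 in \<open>auto elim!: eventually_mono\<close>)+
      then show ?thesis using True by simp
    next
      case False
      with t lam have pos: "0 < lam * t" and t': "0 < t" by auto
      have push: "(\<integral>\<^sup>+\<omega>. h (N t \<omega>) \<partial>M) = (\<integral>\<^sup>+k. h k \<partial>measure_pmf (poisson_pmf (lam * t)))" for h :: "nat \<Rightarrow> ennreal"
        unfolding law[OF t', symmetric] using Nm[OF t] by (subst nn_integral_distr) auto
      show ?thesis
        using push[of "\<lambda>k. ennreal (real k)"] push[of "\<lambda>k. ennreal ((real k)\<^sup>2)"] poisson_pmf_moments[OF pos]
        by simp
    qed
    then show "(\<integral>\<^sup>+\<omega>. ennreal (real (N t \<omega>)) \<partial>M) = ennreal (lam * t)"
      "(\<integral>\<^sup>+\<omega>. ennreal ((real (N t \<omega>))\<^sup>2) \<partial>M) = ennreal (lam * t + (lam * t)\<^sup>2)" by auto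
  qed
  show "(\<integral>\<^sup>+\<omega>. ennreal (real (N a \<omega>)) \<partial>M) = ennreal (lam * a)"
    using nn ab by auto
  have int: "has_bochner_integral M (\<lambda>\<omega>. real (N t \<omega>)) (lam * t)"
    "has_bochner_integral M (\<lambda>\<omega>. (real (N t \<omega>))\<^sup>2) (lam * t + (lam * t)\<^sup>2)" if "0 \<le> t" for t
    using nn[OF that] rm[OF that] that lam by (auto intro!: has_bochner_integral_nn_integral)
  have b: "0 \<le> b" using ab by simp
  have diff: "has_bochner_integral M (\<lambda>\<omega>. real (N b \<omega>) - real (N a \<omega>)) (lam * b - lam * a)"
    using int(1)[OF ab(1)] int(1)[OF b] by (rule has_bochner_integral_diff[rotated])
  have ind: "indep_var borel (\<lambda>\<omega>. real (N a \<omega>)) borel (\<lambda>\<omega>. real (N b \<omega>) - real (N a \<omega>))"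
    using levy_process_indep_increment[OF levy ab] .
  have "has_bochner_integral M (\<lambda>\<omega>. real (N a \<omega>) * (real (N b \<omega>) - real (N a \<omega>)))
      (lam * a * (lam * b - lam * a))"
    using indep_var_lebesgue_integral[OF ind] indep_var_integrable[OF ind] int(1)[OF ab(1)] diff
    by (auto simp: has_bochner_integral_iff)
  from has_bochner_integral_add[OF this int(2)[OF ab(1)]]
  have "has_bochner_integral M (\<lambda>\<omega>. real (N a \<omega>) * real (N b \<omega>)) (lam * a + lam\<^sup>2 * a * b)"
    by (simp add: algebra_simps power2_eq_square)
  then show "(\<integral>\<^sup>+\<omega>. ennreal (real (N a \<omega>) * real (N b \<omega>)) \<partial>M) = ennreal (lam * a + lam\<^sup>2 * a * b)"
    by (subst nn_integral_eq_integral) (auto simp: has_bochner_integral_iff)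
qed

section \<open>The inverse of a path and its occupation times\<close>

text \<open>
  Along the integers \<open>exp (- X)\<close> has an infimum whose expectation is zero, so this infimum vanishes
  almost surely; monotonicity carries the divergence over to real times.
\<close>

lemma (in prob_space) AE_tends_to_infinity:
  fixes X :: "real \<Rightarrow> 'a \<Rightarrow> real"
  assumes mono: "AE \<omega> in M. mono_on {0..} (\<lambda>t. X t \<omega>)"
    and rv [measurable]: "\<And>n::nat. X (real n) \<in> borel_measurable M"
    and int: "\<And>n::nat. integrable M (\<lambda>\<omega>. exp (- X (real n) \<omega>))"
    and lim: "(\<lambda>n::nat. expectation (\<lambda>\<omega>. exp (- X (real n) \<omega>))) \<longlonglongrightarrow> 0"
  shows "AE \<omega> in M. filterlim (\<lambda>t. X t \<omega>) at_top at_top"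
proof -
  have "(\<integral>\<^sup>+\<omega>. (INF n::nat. ennreal (exp (- X (real n) \<omega>))) \<partial>M) \<le> ennreal (expectation (\<lambda>\<omega>. exp (- X (real n) \<omega>)))"
    for n :: nat
    unfolding nn_integral_eq_integral[OF int, symmetric, simplified]
    by (intro nn_integral_mono INF_lower) simp
  moreover have "(\<lambda>n::nat. ennreal (expectation (\<lambda>\<omega>. exp (- X (real n) \<omega>)))) \<longlonglongrightarrow> ennreal 0"
    using lim by (intro tendsto_ennrealI)
  ultimately have "(\<integral>\<^sup>+\<omega>. (INF n::nat. ennreal (exp (- X (real n) \<omega>))) \<partial>M) \<le> ennreal 0"
    by (intro LIMSEQ_le_const) auto
  then have "AE \<omega> in M. (INF n::nat. ennreal (exp (- X (real n) \<omega>))) = 0"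
    by (subst (asm) ennreal_0, subst (asm) le_zero_eq, subst (asm) nn_integral_0_iff_AE) auto
  with mono show ?thesis
  proof eventually_elim
    case (elim \<omega>)
    show ?case unfolding filterlim_at_top
    proof
      fix Z :: real
      have "(INF n::nat. ennreal (exp (- X (real n) \<omega>))) < ennreal (exp (- Z))"
        using elim by simp
      then obtain n :: nat where "ennreal (exp (- X (real n) \<omega>)) < ennreal (exp (- Z))"
        by (auto simp: INF_less_iff)
      then have "Z \<le> X (real n) \<omega>" by (simp add: ennreal_less_iff)
      then have "Z \<le> X t \<omega>" if "real n \<le> t" for t
        using mono_onD[OF elim(1), of "real n" t] that by auto
      then show "\<forall>\<^sub>F t in at_top. Z \<le> X t \<omega>"
        by (auto simp: eventually_at_top_linorder)
    qed
  qed
qed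

text \<open>
  The integrals of \<open>1\<close>, \<open>x\<close> and \<open>f - x\<close> over an interval \<open>{0..e}\<close>, from which the occupation formulas
  below are assembled.
\<close>

lemma nn_integral_affine_Icc:
  fixes c :: real
  assumes "0 \<le> e" and "\<And>x. 0 \<le> x \<Longrightarrow> x \<le> e \<Longrightarrow> 0 \<le> c + d * x"
  shows "(\<integral>\<^sup>+x. ennreal (c + d * x) * indicator {0..e} x \<partial>lborel) = ennreal (c * e + d * e\<^sup>2 / 2)"
proof -
  have "(\<integral>\<^sup>+x. ennreal (c + d * x) * indicator {0..e} x \<partial>lborel) =
      ennreal ((c * e + d * e\<^sup>2 / 2) - (c * 0 + d * 0\<^sup>2 / 2))"
    by (rule nn_integral_FTC_Icc) (use assms in \<open>auto intro!: derivative_eq_intros\<close>)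
  then show ?thesis by simp
qed

context
  fixes S :: "real \<Rightarrow> 'a \<Rightarrow> real" and \<omega> :: 'a
  assumes mono: "mono_on {0..} (\<lambda>t. S t \<omega>)" and top: "filterlim (\<lambda>t. S t \<omega>) at_top at_top"
begin

lemma first_passage_bdd: "bdd_below {r. 0 \<le> r \<and> t < S r \<omega>}"
  by (rule bdd_belowI[of _ 0]) auto

lemma first_passage_nonempty: "{r. 0 \<le> r \<and> t < S r \<omega>} \<noteq> {}"
proof -
  have "\<forall>\<^sub>F r in at_top. 0 \<le> r \<and> t + 1 \<le> S r \<omega>"
    using top eventually_ge_at_top[of 0] unfolding filterlim_at_top
    by (auto intro: eventually_conj)
  then obtain r where "0 \<le> r \<and> t + 1 \<le> S r \<omega>"
    using eventually_happens by fastforce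
  then show ?thesis by force
qed

lemma inverse_nonneg: "0 \<le> inverse_subordinator S t \<omega>"
  unfolding inverse_subordinator_def by (rule cInf_greatest[OF first_passage_nonempty]) auto

text \<open>
  Together with the converse below this pins down \<open>{r. 0 \<le> r \<and> S r \<omega> \<le> t}\<close> as an interval from \<open>0\<close> to
  the inverse at \<open>t\<close>, up to its right end point, at which the path may or may not have passed \<open>t\<close>.
\<close>

lemma inverse_gtD: "0 \<le> r \<Longrightarrow> r < inverse_subordinator S t \<omega> \<Longrightarrow> S r \<omega> \<le> t"
  using cInf_lower[OF _ first_passage_bdd, of r t] unfolding inverse_subordinator_def by force

lemma inverse_lessD:
  assumes "inverse_subordinator S t \<omega> < r"
  shows "t < S r \<omega>"
proof -
  obtain r' where "0 \<le> r'" "t < S r' \<omega>" "r' < r"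
    using cInf_lessD[OF first_passage_nonempty assms[unfolded inverse_subordinator_def]] by auto
  then show ?thesis using mono_onD[OF mono, of r' r] by auto
qed

lemma inverse_mono: "t \<le> t' \<Longrightarrow> inverse_subordinator S t \<omega> \<le> inverse_subordinator S t' \<omega>"
  by (rule leI, rule notI) (meson dense inverse_gtD inverse_lessD inverse_nonneg le_less_trans not_le order_trans less_imp_le)

lemma inverse_right_continuous:
  "((\<lambda>t. inverse_subordinator S t \<omega>) \<longlongrightarrow> inverse_subordinator S t \<omega>) (at_right t)"
proof (rule order_tendstoI)
  fix a assume a: "a < inverse_subordinator S t \<omega>"
  then show "\<forall>\<^sub>F x in at_right t. a < inverse_subordinator S x \<omega>"
    unfolding eventually_at_right_field
    by (intro exI[of _ "t + 1"]) (auto intro: less_le_trans[OF a inverse_mono])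
next
  fix a assume a: "inverse_subordinator S t \<omega> < a"
  then obtain r where r: "inverse_subordinator S t \<omega> < r" "r < a" using dense by blast
  have "inverse_subordinator S x \<omega> < a" if "t < x" "x < S r \<omega>" for x
  proof -
    have "inverse_subordinator S x \<omega> \<le> r"
      unfolding inverse_subordinator_def using that r(1) inverse_nonneg[of t]
      by (intro cInf_lower first_passage_bdd) auto
    then show ?thesis using r(2) by simp
  qed
  then show "\<forall>\<^sub>F x in at_right t. inverse_subordinator S x \<omega> < a"
    unfolding eventually_at_right_field
    using inverse_lessD[OF r(1)] by (intro exI[of _ "S r \<omega>"]) auto
qed

text \<open>
  The inverse approaches its limit from above, possibly being constant, so one-sided continuity of \<open>Y\<close>
  is enough.
\<close>

lemma time_change_right_continuous:
  fixes Y :: "real \<Rightarrow> real"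
  assumes "\<And>x. 0 \<le> x \<Longrightarrow> (Y \<longlongrightarrow> Y x) (at_right x)"
  shows "((\<lambda>t. Y (inverse_subordinator S t \<omega>)) \<longlongrightarrow> Y (inverse_subordinator S t \<omega>)) (at_right t)"
proof -
  let ?e = "inverse_subordinator S t \<omega>"
  have "(Y \<longlongrightarrow> Y ?e) (at ?e within {?e..})"
    using assms[OF inverse_nonneg] 
    by (metis at_within_Ici_at_right)
  then have "continuous (at ?e within {?e..}) Y"
    by (simp add: continuous_within)
  then show ?thesis
    by (rule continuous_within_tendsto_compose)
       (auto intro!: inverse_right_continuous inverse_mono simp: eventually_at_right_field intro: exI[of _ "t + 1"])
qed

lemma AE_occupation_indicator:
  assumes "0 \<le> x"
  shows "AE h in lborel. indicator {h. 0 \<le> h \<and> S (x + h) \<omega> \<le> t} h =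
    (indicator {0..inverse_subordinator S t \<omega> - x} h :: ennreal)"
  using AE_lborel_singleton[of "inverse_subordinator S t \<omega> - x"]
proof eventually_elim
  case (elim h)
  then show ?case
    using inverse_gtD[of "x + h" t] inverse_lessD[of t "x + h"] assms
    by (cases h "inverse_subordinator S t \<omega> - x" rule: linorder_cases) (auto simp: indicator_def)
qed

text \<open>
  The inverse at \<open>t\<close> is the time that the path spends below \<open>t\<close>.  In this form expectations can be
  computed by Tonelli's theorem.
\<close>

lemma occupation_time:
  "(\<integral>\<^sup>+x. indicator {x. 0 \<le> x \<and> S x \<omega> \<le> t} x \<partial>lborel) = ennreal (inverse_subordinator S t \<omega>)"
proof -
  have "(\<integral>\<^sup>+x. indicator {x. 0 \<le> x \<and> S x \<omega> \<le> t} x \<partial>lborel) =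
      (\<integral>\<^sup>+x. indicator {0..inverse_subordinator S t \<omega>} x \<partial>lborel)"
    using AE_occupation_indicator[of 0 t] by (intro nn_integral_cong_AE) simp
  then show ?thesis using inverse_nonneg[of t] by simp
qed

lemma occupation_time_moment:
  "(\<integral>\<^sup>+x. ennreal x * indicator {x. 0 \<le> x \<and> S x \<omega> \<le> t} x \<partial>lborel) =
    ennreal ((inverse_subordinator S t \<omega>)\<^sup>2 / 2)"
proof -
  have "(\<integral>\<^sup>+x. ennreal x * indicator {x. 0 \<le> x \<and> S x \<omega> \<le> t} x \<partial>lborel) =
      (\<integral>\<^sup>+x. ennreal (0 + 1 * x) * indicator {0..inverse_subordinator S t \<omega>} x \<partial>lborel)"
    using AE_occupation_indicator[of 0 t] by (intro nn_integral_cong_AE) (auto elim!: eventually_mono)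
  then show ?thesis using inverse_nonneg[of t] by (subst (asm) nn_integral_affine_Icc) auto
qed

text \<open>
  For \<open>s \<le> t\<close> write \<open>e \<le> f\<close> for the two values of the inverse.  Splitting the rectangle \<open>{0..e} \<times> {0..f}\<close> along
  the diagonal, \<open>e f = e\<^sup>2 / 2 + \<integral> (f - x) dx\<close> over \<open>{0..e}\<close>, and \<open>f - x\<close> is the time spent below
  \<open>t\<close> after time \<open>x\<close>.  Only \<open>S x\<close> and \<open>S (x + h)\<close> occur in the double integral, the form suited to
  independent increments.
\<close>

lemma occupation_time_product:
  assumes "s \<le> t"
  shows "ennreal ((inverse_subordinator S s \<omega>)\<^sup>2 / 2) +
      (\<integral>\<^sup>+x. indicator {x. 0 \<le> x \<and> S x \<omega> \<le> s} x *
        (\<integral>\<^sup>+h. indicator {h. 0 \<le> h \<and> S (x + h) \<omega> \<le> t} h \<partial>lborel) \<partial>lborel) =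
    ennreal (inverse_subordinator S s \<omega> * inverse_subordinator S t \<omega>)"
proof -
  let ?e = "inverse_subordinator S s \<omega>" and ?f = "inverse_subordinator S t \<omega>"
  have ef: "0 \<le> ?e" "?e \<le> ?f" using inverse_nonneg inverse_mono[OF assms] by auto
  have "(\<integral>\<^sup>+x. indicator {x. 0 \<le> x \<and> S x \<omega> \<le> s} x *
        (\<integral>\<^sup>+h. indicator {h. 0 \<le> h \<and> S (x + h) \<omega> \<le> t} h \<partial>lborel) \<partial>lborel) =
      (\<integral>\<^sup>+x. ennreal (?f + (-1) * x) * indicator {0..?e} x \<partial>lborel)"
    using AE_occupation_indicator[of 0 s, simplified]
  proof (intro nn_integral_cong_AE, eventually_elim)
    case (elim x)
    show ?case
    proof (cases "x \<in> {0..?e}")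
      case True
      then have "(\<integral>\<^sup>+h. indicator {h. 0 \<le> h \<and> S (x + h) \<omega> \<le> t} h \<partial>lborel) =
          (\<integral>\<^sup>+h. indicator {0..?f - x} h \<partial>lborel)"
        using AE_occupation_indicator[of x t] by (intro nn_integral_cong_AE) simp
      also have "\<dots> = ennreal (?f - x)" using True ef by simp
      finally show ?thesis using elim True by simp
    qed (use elim in simp)
  qed
  also have "\<dots> = ennreal (?f * ?e - ?e\<^sup>2 / 2)"
    using ef by (subst nn_integral_affine_Icc) auto
  finally have *: "(\<integral>\<^sup>+x. indicator {x. 0 \<le> x \<and> S x \<omega> \<le> s} x *
        (\<integral>\<^sup>+h. indicator {h. 0 \<le> h \<and> S (x + h) \<omega> \<le> t} h \<partial>lborel) \<partial>lborel) =
      ennreal (?f * ?e - ?e\<^sup>2 / 2)" .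
  have "?e * ?e \<le> ?f * ?e" using ef by (intro mult_right_mono) auto
  moreover have "?e\<^sup>2 / 2 \<le> ?e * ?e" by (simp add: power2_eq_square)
  ultimately have "?e\<^sup>2 / 2 \<le> ?f * ?e" by linarith
  then show ?thesis unfolding * by (subst ennreal_plus[symmetric]) (auto simp: mult.commute)
qed

end

section \<open>Second moments of the inverse of a subordinator\<close>

context prob_space
begin

text \<open>
  The distribution function of the potential measure of \<open>S\<close>, and the first moment of the same integrand.
\<close>

definition potential :: "(real \<Rightarrow> 'a \<Rightarrow> real) \<Rightarrow> real \<Rightarrow> ennreal" where
  "potential S t = (\<integral>\<^sup>+x. indicator {0..} x * emeasure M {\<omega> \<in> space M. S x \<omega> \<le> t} \<partial>lborel)"

definition potential_moment :: "(real \<Rightarrow> 'a \<Rightarrow> real) \<Rightarrow> real \<Rightarrow> ennreal" where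
  "potential_moment S t = (\<integral>\<^sup>+x. ennreal x * (indicator {0..} x * emeasure M {\<omega> \<in> space M. S x \<omega> \<le> t}) \<partial>lborel)"

lemma sub_measurable: "subordinator M S \<Longrightarrow> 0 \<le> t \<Longrightarrow> S t \<in> borel_measurable M"
  unfolding subordinator_def levy_process_def by auto

lemma sub_mono: "subordinator M S \<Longrightarrow> AE \<omega> in M. mono_on {0..} (\<lambda>t. S t \<omega>)"
  unfolding subordinator_def by auto

lemma sub_levy: "subordinator M S \<Longrightarrow> levy_process M S"
  unfolding subordinator_def by auto

context
  fixes S :: "real \<Rightarrow> 'a \<Rightarrow> real"
  assumes sub: "subordinator M S"
    and top: "AE \<omega> in M. filterlim (\<lambda>t. S t \<omega>) at_top at_top"
begin

lemma sub_path_measurable [measurable]: "(\<lambda>\<omega>. \<lambda>t\<in>{0..}. S t \<omega>) \<in> measurable M (PiM {0..} (\<lambda>_. borel))"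
  by (rule measurable_restrict) (auto intro: sub_measurable[OF sub])

text \<open>
  A jointly measurable version of \<open>S\<close>, equal to \<open>S\<close> for all times outside of a null set.  It
  makes Tonelli's theorem applicable.
\<close>

lemma version_measurable [measurable]:
  assumes [measurable]: "f \<in> measurable A M" "g \<in> borel_measurable A"
  shows "(\<lambda>w. right_eval (\<lambda>t\<in>{0..}. S t (f w)) (g w)) \<in> borel_measurable A"
  using measurable_right_eval[OF measurable_compose[OF assms(1) sub_path_measurable] assms(2)] .

abbreviation "S' x \<omega> \<equiv> right_eval (\<lambda>t\<in>{0..}. S t \<omega>) x"

lemma sub_version: "AE \<omega> in M. \<forall>x\<ge>0. S' x \<omega> = S x \<omega>"
proof -
  have "AE \<omega> in M. cadlag (\<lambda>t. S t \<omega>)"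
    using sub unfolding subordinator_def levy_process_def by auto
  then show ?thesis
    by eventually_elim (auto simp: cadlag_def intro!: right_eval_eq)
qed

lemma emeasure_version:
  "0 \<le> x \<Longrightarrow> emeasure M {\<omega> \<in> space M. S' x \<omega> \<le> t} = emeasure M {\<omega> \<in> space M. S x \<omega> \<le> t}"
proof (rule emeasure_eq_AE)
  assume x: "0 \<le> x"
  show "AE \<omega> in M. (\<omega> \<in> {\<omega> \<in> space M. S' x \<omega> \<le> t}) = (\<omega> \<in> {\<omega> \<in> space M. S x \<omega> \<le> t})"
    using sub_version x by (auto elim!: eventually_mono)
  show "{\<omega> \<in> space M. S x \<omega> \<le> t} \<in> sets M"
    using sub_measurable[OF sub x] by measurable
qed measurable

lemma emeasure_version2:
  assumes "0 \<le> x" "0 \<le> y"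
  shows "emeasure M {\<omega> \<in> space M. S' x \<omega> \<le> s \<and> S' y \<omega> \<le> t} =
    emeasure M {\<omega> \<in> space M. S x \<omega> \<le> s \<and> S y \<omega> \<le> t}"
proof (rule emeasure_eq_AE)
  show "AE \<omega> in M. (\<omega> \<in> {\<omega> \<in> space M. S' x \<omega> \<le> s \<and> S' y \<omega> \<le> t}) =
      (\<omega> \<in> {\<omega> \<in> space M. S x \<omega> \<le> s \<and> S y \<omega> \<le> t})"
    using sub_version assms by (auto elim!: eventually_mono)
  show "{\<omega> \<in> space M. S x \<omega> \<le> s \<and> S y \<omega> \<le> t} \<in> sets M"
    using sub_measurable[OF sub assms(1)] sub_measurable[OF sub assms(2)] by measurable
qed measurable

lemma potential_measurable [measurable]:
  "(\<lambda>x. indicator {0..} x * emeasure M {\<omega> \<in> space M. S x \<omega> \<le> t}) \<in> borel_measurable borel"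
proof -
  have "(\<lambda>x. indicator {0..} x * emeasure M {\<omega> \<in> space M. S' x \<omega> \<le> t}) \<in> borel_measurable borel"
    by measurable
  also have "(\<lambda>x. indicator {0..} x * emeasure M {\<omega> \<in> space M. S' x \<omega> \<le> t} :: ennreal) =
      (\<lambda>x. indicator {0..} x * emeasure M {\<omega> \<in> space M. S x \<omega> \<le> t})"
    by (auto simp: fun_eq_iff indicator_def emeasure_version)
  finally show ?thesis .
qed

lemma nn_integral_weighted_occupation:
  assumes [measurable]: "w \<in> borel_measurable borel"
  shows "(\<integral>\<^sup>+\<omega>. (\<integral>\<^sup>+x. w x * indicator {x. 0 \<le> x \<and> S x \<omega> \<le> t} x \<partial>lborel) \<partial>M) =
    (\<integral>\<^sup>+x. w x * (indicator {0..} x * emeasure M {\<omega> \<in> space M. S x \<omega> \<le> t}) \<partial>lborel)"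
proof -
  interpret pair_sigma_finite lborel M
    by (simp add: pair_sigma_finite_def sigma_finite_lborel sigma_finite_measure_axioms)
  have "(\<integral>\<^sup>+\<omega>. (\<integral>\<^sup>+x. w x * indicator {x. 0 \<le> x \<and> S x \<omega> \<le> t} x \<partial>lborel) \<partial>M) =
      (\<integral>\<^sup>+\<omega>. (\<integral>\<^sup>+x. w x * (indicator {0..} x * (if S' x \<omega> \<le> t then 1 else 0)) \<partial>lborel) \<partial>M)"
    using sub_version
    by (intro nn_integral_cong_AE, eventually_elim, intro nn_integral_cong) (auto simp: indicator_def)
  also have "\<dots> = (\<integral>\<^sup>+x. (\<integral>\<^sup>+\<omega>. w x * (indicator {0..} x * (if S' x \<omega> \<le> t then 1 else 0)) \<partial>M) \<partial>lborel)"
    by (rule Fubini') measurable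
  also have "\<dots> = (\<integral>\<^sup>+x. w x * (indicator {0..} x * emeasure M {\<omega> \<in> space M. S x \<omega> \<le> t}) \<partial>lborel)"
  proof (intro nn_integral_cong)
    fix x :: real
    have "(\<integral>\<^sup>+\<omega>. (if S' x \<omega> \<le> t then 1 else 0) \<partial>M) = (\<integral>\<^sup>+\<omega>. indicator {\<omega> \<in> space M. S' x \<omega> \<le> t} \<omega> \<partial>M)"
      by (intro nn_integral_cong) (auto simp: indicator_def)
    also have "\<dots> = emeasure M {\<omega> \<in> space M. S' x \<omega> \<le> t}" by simp
    finally have "(\<integral>\<^sup>+\<omega>. (if S' x \<omega> \<le> t then 1 else 0) \<partial>M) = emeasure M {\<omega> \<in> space M. S' x \<omega> \<le> t}" .
    then show "(\<integral>\<^sup>+\<omega>. w x * (indicator {0..} x * (if S' x \<omega> \<le> t then 1 else 0)) \<partial>M) =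
        w x * (indicator {0..} x * emeasure M {\<omega> \<in> space M. S x \<omega> \<le> t})"
      by (simp add: nn_integral_cmult emeasure_version indicator_def)
  qed
  finally show ?thesis .
qed

lemma AE_path: "AE \<omega> in M. mono_on {0..} (\<lambda>t. S t \<omega>) \<and> filterlim (\<lambda>t. S t \<omega>) at_top at_top"
  using sub_mono[OF sub] top by eventually_elim auto

lemma nn_integral_inverse: "(\<integral>\<^sup>+\<omega>. ennreal (inverse_subordinator S t \<omega>) \<partial>M) = potential S t"
proof -
  have "(\<integral>\<^sup>+\<omega>. ennreal (inverse_subordinator S t \<omega>) \<partial>M) =
      (\<integral>\<^sup>+\<omega>. (\<integral>\<^sup>+x. 1 * indicator {x. 0 \<le> x \<and> S x \<omega> \<le> t} x \<partial>lborel) \<partial>M)"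
    using AE_path by (intro nn_integral_cong_AE, eventually_elim) (simp add: occupation_time)
  also have "\<dots> = potential S t"
    unfolding potential_def by (subst nn_integral_weighted_occupation) auto
  finally show ?thesis .
qed

lemma nn_integral_inverse_square:
  "(\<integral>\<^sup>+\<omega>. ennreal ((inverse_subordinator S t \<omega>)\<^sup>2 / 2) \<partial>M) = potential_moment S t"
proof -
  have "(\<integral>\<^sup>+\<omega>. ennreal ((inverse_subordinator S t \<omega>)\<^sup>2 / 2) \<partial>M) =
      (\<integral>\<^sup>+\<omega>. (\<integral>\<^sup>+x. ennreal x * indicator {x. 0 \<le> x \<and> S x \<omega> \<le> t} x \<partial>lborel) \<partial>M)"
    using AE_path by (intro nn_integral_cong_AE, eventually_elim) (simp add: occupation_time_moment)
  also have "\<dots> = potential_moment S t"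
    unfolding potential_moment_def by (subst nn_integral_weighted_occupation) auto
  finally show ?thesis .
qed

text \<open>
  Since \<open>S x \<ge> 0\<close> almost surely, \<open>S (x + h) \<le> t\<close> implies that the increment over \<open>h\<close> is at most \<open>t\<close>;
  conversely \<open>S x \<le> s\<close> and an increment of at most \<open>t - s\<close> give \<open>S (x + h) \<le> t\<close>.  Independence and
  stationarity turn both comparison events into products.
\<close>

lemma increment_bounds:
  assumes "0 \<le> x" "0 \<le> h"
  shows "emeasure M {\<omega> \<in> space M. S x \<omega> \<le> s \<and> S (x + h) \<omega> \<le> t} \<le>
      emeasure M {\<omega> \<in> space M. S x \<omega> \<le> s} * emeasure M {\<omega> \<in> space M. S h \<omega> \<le> t}"
    and "emeasure M {\<omega> \<in> space M. S x \<omega> \<le> s} * emeasure M {\<omega> \<in> space M. S h \<omega> \<le> t - s} \<le>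
      emeasure M {\<omega> \<in> space M. S x \<omega> \<le> s \<and> S (x + h) \<omega> \<le> t}"
proof -
  have [measurable]: "S x \<in> borel_measurable M" "S (x + h) \<in> borel_measurable M"
    "S h \<in> borel_measurable M" "S 0 \<in> borel_measurable M"
    using assms by (auto intro: sub_measurable[OF sub])
  have zero: "AE \<omega> in M. S 0 \<omega> = 0" and
    stat: "distr M borel (\<lambda>\<omega>. S (x + h) \<omega> - S x \<omega>) = distr M borel (\<lambda>\<omega>. S h \<omega> - S 0 \<omega>)"
    using sub_levy[OF sub] assms unfolding levy_process_def stationary_increments_def by auto
  have ind: "indep_var borel (S x) borel (\<lambda>\<omega>. S (x + h) \<omega> - S x \<omega>)"
    by (rule levy_process_indep_increment[OF sub_levy[OF sub]]) (use assms in auto)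
  have law: "prob {\<omega> \<in> space M. S (x + h) \<omega> - S x \<omega> \<le> v} = prob {\<omega> \<in> space M. S h \<omega> \<le> v}" for v
  proof -
    have "distr M borel (\<lambda>\<omega>. S h \<omega> - S 0 \<omega>) = distr M borel (S h)"
      by (rule distr_cong_AE) (use zero in auto)
    then have "measure (distr M borel (\<lambda>\<omega>. S (x + h) \<omega> - S x \<omega>)) {..v} = measure (distr M borel (S h)) {..v}"
      using stat by simp
    then show ?thesis
      by (simp add: measure_distr vimage_def Int_def conj_commute)
  qed
  have prod: "emeasure M {\<omega> \<in> space M. S x \<omega> \<le> s \<and> S (x + h) \<omega> - S x \<omega> \<le> v} =
      emeasure M {\<omega> \<in> space M. S x \<omega> \<le> s} * emeasure M {\<omega> \<in> space M. S h \<omega> \<le> v}" for v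
  proof -
    have "prob ((\<lambda>\<omega>. (S x \<omega>, S (x + h) \<omega> - S x \<omega>)) -` ({..s} \<times> {..v}) \<inter> space M) =
        prob (S x -` {..s} \<inter> space M) * prob ((\<lambda>\<omega>. S (x + h) \<omega> - S x \<omega>) -` {..v} \<inter> space M)"
      by (rule indep_varD[OF ind]) auto
    also have "(\<lambda>\<omega>. (S x \<omega>, S (x + h) \<omega> - S x \<omega>)) -` ({..s} \<times> {..v}) \<inter> space M =
        {\<omega> \<in> space M. S x \<omega> \<le> s \<and> S (x + h) \<omega> - S x \<omega> \<le> v}" by auto
    also have "S x -` {..s} \<inter> space M = {\<omega> \<in> space M. S x \<omega> \<le> s}" by auto
    also have "(\<lambda>\<omega>. S (x + h) \<omega> - S x \<omega>) -` {..v} \<inter> space M = {\<omega> \<in> space M. S (x + h) \<omega> - S x \<omega> \<le> v}" by auto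
    finally show ?thesis by (simp add: law emeasure_eq_measure ennreal_mult)
  qed
  have pos: "AE \<omega> in M. 0 \<le> S x \<omega>"
    using sub_mono[OF sub] zero by eventually_elim (use assms in \<open>auto dest: mono_onD[of _ _ 0 x]\<close>)
  show "emeasure M {\<omega> \<in> space M. S x \<omega> \<le> s \<and> S (x + h) \<omega> \<le> t} \<le>
      emeasure M {\<omega> \<in> space M. S x \<omega> \<le> s} * emeasure M {\<omega> \<in> space M. S h \<omega> \<le> t}"
    unfolding prod[symmetric] by (rule emeasure_mono_AE) (use pos in \<open>auto elim!: eventually_mono\<close>)
  show "emeasure M {\<omega> \<in> space M. S x \<omega> \<le> s} * emeasure M {\<omega> \<in> space M. S h \<omega> \<le> t - s} \<le>
      emeasure M {\<omega> \<in> space M. S x \<omega> \<le> s \<and> S (x + h) \<omega> \<le> t}"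
    unfolding prod[symmetric] by (rule emeasure_mono) auto
qed

text \<open>
  Take expectations in \<open>occupation_time_product\<close> and integrate the previous bounds over \<open>x\<close> and \<open>h\<close>.
\<close>

lemma nn_integral_inverse_product:
  assumes "s \<le> t"
  shows "(\<integral>\<^sup>+\<omega>. ennreal (inverse_subordinator S s \<omega> * inverse_subordinator S t \<omega>) \<partial>M) \<le>
      potential_moment S s + potential S s * potential S t"
    and "potential_moment S s + potential S s * potential S (t - s) \<le>
      (\<integral>\<^sup>+\<omega>. ennreal (inverse_subordinator S s \<omega> * inverse_subordinator S t \<omega>) \<partial>M)"
proof -
  interpret LM: pair_sigma_finite lborel M
    by (simp add: pair_sigma_finite_def sigma_finite_lborel sigma_finite_measure_axioms)
  let ?p = "\<lambda>x h. emeasure M {\<omega> \<in> space M. S x \<omega> \<le> s \<and> S (x + h) \<omega> \<le> t}"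
  let ?p' = "\<lambda>x h. emeasure M {\<omega> \<in> space M. S' x \<omega> \<le> s \<and> S' (x + h) \<omega> \<le> t}"
  define R where "R = (\<integral>\<^sup>+x. (\<integral>\<^sup>+h. indicator {0..} x * (indicator {0..} h * ?p x h) \<partial>lborel) \<partial>lborel)"
  define q where "q x h \<omega> = indicator {0..} x * (indicator {0..} h *
      (if S' x \<omega> \<le> s \<and> S' (x + h) \<omega> \<le> t then 1 else 0 :: ennreal))" for x h \<omega>
  have "(\<integral>\<^sup>+\<omega>. ennreal (inverse_subordinator S s \<omega> * inverse_subordinator S t \<omega>) \<partial>M) =
      (\<integral>\<^sup>+\<omega>. (\<integral>\<^sup>+x. ennreal x * (indicator {0..} x * (if S' x \<omega> \<le> s then 1 else 0)) \<partial>lborel) +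
        (\<integral>\<^sup>+x. (\<integral>\<^sup>+h. q x h \<omega> \<partial>lborel) \<partial>lborel) \<partial>M)"
    using AE_path sub_version
  proof (intro nn_integral_cong_AE, eventually_elim)
    case (elim \<omega>)
    have "(\<integral>\<^sup>+x. ennreal x * (indicator {0..} x * (if S' x \<omega> \<le> s then 1 else 0)) \<partial>lborel) =
        (\<integral>\<^sup>+x. ennreal x * indicator {x. 0 \<le> x \<and> S x \<omega> \<le> s} x \<partial>lborel)"
      using elim by (intro nn_integral_cong) (auto simp: indicator_def)
    moreover have "(\<integral>\<^sup>+h. q x h \<omega> \<partial>lborel) = indicator {x. 0 \<le> x \<and> S x \<omega> \<le> s} x *
        (\<integral>\<^sup>+h. indicator {h. 0 \<le> h \<and> S (x + h) \<omega> \<le> t} h \<partial>lborel)" for x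
    proof (cases "0 \<le> x \<and> S x \<omega> \<le> s")
      case True
      have "(\<integral>\<^sup>+h. q x h \<omega> \<partial>lborel) = (\<integral>\<^sup>+h. indicator {h. 0 \<le> h \<and> S (x + h) \<omega> \<le> t} h \<partial>lborel)"
        using elim True by (intro nn_integral_cong) (auto simp: indicator_def q_def)
      then show ?thesis using True by simp
    next
      case False
      have "(\<integral>\<^sup>+h. q x h \<omega> \<partial>lborel) = (\<integral>\<^sup>+h. 0 \<partial>(lborel::real measure))"
        using elim False by (intro nn_integral_cong) (auto simp: indicator_def q_def)
      then show ?thesis using False by simp
    qed
    ultimately show ?case
      using occupation_time_product[of S \<omega> s t] occupation_time_moment[of S \<omega> s] elim assms by simp
  qed
  also have "\<dots> = (\<integral>\<^sup>+\<omega>. (\<integral>\<^sup>+x. ennreal x * (indicator {0..} x * (if S' x \<omega> \<le> s then 1 else 0)) \<partial>lborel) \<partial>M) +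
        (\<integral>\<^sup>+\<omega>. (\<integral>\<^sup>+x. (\<integral>\<^sup>+h. q x h \<omega> \<partial>lborel) \<partial>lborel) \<partial>M)"
    unfolding q_def by (rule nn_integral_add) measurable
  also have "(\<integral>\<^sup>+\<omega>. (\<integral>\<^sup>+x. ennreal x * (indicator {0..} x * (if S' x \<omega> \<le> s then 1 else 0)) \<partial>lborel) \<partial>M) =
      (\<integral>\<^sup>+\<omega>. (\<integral>\<^sup>+x. ennreal x * indicator {x. 0 \<le> x \<and> S x \<omega> \<le> s} x \<partial>lborel) \<partial>M)"
    using sub_version
    by (intro nn_integral_cong_AE, eventually_elim, intro nn_integral_cong) (auto simp: indicator_def)
  also have "\<dots> = potential_moment S s"
    unfolding potential_moment_def by (subst nn_integral_weighted_occupation) auto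
  also have "(\<integral>\<^sup>+\<omega>. (\<integral>\<^sup>+x. (\<integral>\<^sup>+h. q x h \<omega> \<partial>lborel) \<partial>lborel) \<partial>M) =
      (\<integral>\<^sup>+x. (\<integral>\<^sup>+\<omega>. (\<integral>\<^sup>+h. q x h \<omega> \<partial>lborel) \<partial>M) \<partial>lborel)"
    unfolding q_def by (rule LM.Fubini') measurable
  also have "\<dots> = (\<integral>\<^sup>+x. (\<integral>\<^sup>+h. (\<integral>\<^sup>+\<omega>. q x h \<omega> \<partial>M) \<partial>lborel) \<partial>lborel)"
    unfolding q_def by (intro nn_integral_cong LM.Fubini') measurable
  also have "\<dots> = R" unfolding R_def
  proof (intro nn_integral_cong)
    fix x h :: real
    have "(\<integral>\<^sup>+\<omega>. (if S' x \<omega> \<le> s \<and> S' (x + h) \<omega> \<le> t then 1 else 0) \<partial>M) =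
        (\<integral>\<^sup>+\<omega>. indicator {\<omega> \<in> space M. S' x \<omega> \<le> s \<and> S' (x + h) \<omega> \<le> t} \<omega> \<partial>M)"
      by (intro nn_integral_cong) (auto simp: indicator_def)
    also have "\<dots> = ?p' x h" by simp
    finally show "(\<integral>\<^sup>+\<omega>. q x h \<omega> \<partial>M) = indicator {0..} x * (indicator {0..} h * ?p x h)"
      unfolding q_def by (simp add: nn_integral_cmult emeasure_version2 indicator_def)
  qed
  finally have main: "(\<integral>\<^sup>+\<omega>. ennreal (inverse_subordinator S s \<omega> * inverse_subordinator S t \<omega>) \<partial>M) =
      potential_moment S s + R" .
  have prod: "(\<integral>\<^sup>+x. (\<integral>\<^sup>+h. (indicator {0..} x * emeasure M {\<omega> \<in> space M. S x \<omega> \<le> s}) *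
        (indicator {0..} h * emeasure M {\<omega> \<in> space M. S h \<omega> \<le> v}) \<partial>lborel) \<partial>lborel) = potential S s * potential S v" for v
    unfolding potential_def by (simp add: nn_integral_cmult nn_integral_multc)
  have "R \<le> potential S s * potential S t"
    unfolding R_def prod[symmetric]
    by (intro nn_integral_mono) (auto simp: indicator_def intro!: increment_bounds)
  then show "(\<integral>\<^sup>+\<omega>. ennreal (inverse_subordinator S s \<omega> * inverse_subordinator S t \<omega>) \<partial>M) \<le>
      potential_moment S s + potential S s * potential S t"
    unfolding main by (rule add_left_mono)
  have "potential S s * potential S (t - s) \<le> R"
    unfolding R_def prod[symmetric]
    by (intro nn_integral_mono) (auto simp: indicator_def intro!: increment_bounds)
  then show "potential_moment S s + potential S s * potential S (t - s) \<le>
      (\<integral>\<^sup>+\<omega>. ennreal (inverse_subordinator S s \<omega> * inverse_subordinator S t \<omega>) \<partial>M)"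
    unfolding main by (rule add_left_mono)
qed

end

end

section \<open>The inverse stable subordinator\<close>

lemma (in prob_space) subordinator_nonneg:
  assumes "subordinator M S" "0 \<le> t"
  shows "AE \<omega> in M. 0 \<le> S t \<omega>"
proof -
  have "AE \<omega> in M. S 0 \<omega> = 0" "AE \<omega> in M. mono_on {0..} (\<lambda>t. S t \<omega>)"
    using assms unfolding subordinator_def levy_process_def by auto
  then show ?thesis
    by eventually_elim (use assms(2) in \<open>auto dest: mono_onD[of _ _ 0 t]\<close>)
qed

lemma nn_integral_lborel_scale:
  fixes f :: "real \<Rightarrow> ennreal"
  assumes "f \<in> borel_measurable borel" "0 < c"
  shows "(\<integral>\<^sup>+x. f x \<partial>lborel) = ennreal c * (\<integral>\<^sup>+v. f (c * v) \<partial>lborel)"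
  using nn_integral_real_affine[OF assms(1), of c 0] assms(2) by simp

lemma (in prob_space) integrable_exp_neg:
  fixes X :: "'a \<Rightarrow> real"
  assumes [measurable]: "X \<in> borel_measurable M" and "AE \<omega> in M. 0 \<le> X \<omega>" and "0 \<le> u"
  shows "integrable M (\<lambda>\<omega>. exp (- u * X \<omega>))"
  by (rule integrable_const_bound[where B = 1]) (use assms(2,3) in \<open>auto elim!: eventually_mono\<close>)

context prob_space
begin

context
  fixes S :: "real \<Rightarrow> 'a \<Rightarrow> real" and \<beta> :: real
  assumes stable: "stable_subordinator M \<beta> S" and \<beta>: "0 < \<beta>" "\<beta> < 1"
begin

lemma stable_sub: "subordinator M S"
  using stable unfolding stable_subordinator_def by simp

lemma stable_laplace:
  "0 \<le> t \<Longrightarrow> 0 \<le> u \<Longrightarrow> expectation (\<lambda>\<omega>. exp (- u * S t \<omega>)) = exp (- t * u powr \<beta>)"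
  using stable unfolding stable_subordinator_def by simp

lemma stable_measurable: "0 \<le> t \<Longrightarrow> S t \<in> borel_measurable M"
  using sub_measurable[OF stable_sub] .

lemmas stable_nonneg = subordinator_nonneg[OF stable_sub]

lemma stable_integrable: "0 \<le> t \<Longrightarrow> 0 \<le> u \<Longrightarrow> integrable M (\<lambda>\<omega>. exp (- u * S t \<omega>))"
  by (intro integrable_exp_neg stable_measurable stable_nonneg)

lemma stable_top: "AE \<omega> in M. filterlim (\<lambda>t. S t \<omega>) at_top at_top"
proof (rule AE_tends_to_infinity[OF sub_mono[OF stable_sub]])
  show "(\<lambda>n. expectation (\<lambda>\<omega>. exp (- S (real n) \<omega>))) \<longlonglongrightarrow> 0"
  proof -
    have "(\<lambda>n. exp (- 1) ^ n :: real) \<longlonglongrightarrow> 0"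
      by (rule LIMSEQ_power_zero) simp
    moreover have "expectation (\<lambda>\<omega>. exp (- S (real n) \<omega>)) = exp (- 1) ^ n" for n
      using stable_laplace[of "real n" 1] by (simp add: exp_of_nat_mult[symmetric])
    ultimately show ?thesis by simp
  qed
qed (use stable_measurable stable_integrable[of _ 1] in auto)

text \<open>
  Self-similarity: \<open>S (t powr \<beta> * v) / t\<close> and \<open>S v\<close> have the same Laplace transform.
\<close>

lemma stable_scaling:
  assumes t: "0 < t" and v: "0 \<le> v"
  shows "emeasure M {\<omega> \<in> space M. S (t powr \<beta> * v) \<omega> \<le> t} = emeasure M {\<omega> \<in> space M. S v \<omega> \<le> 1}"
proof -
  have tv: "0 \<le> t powr \<beta> * v" using v by simp
  have "\<P>(\<omega> in M. S (t powr \<beta> * v) \<omega> / t \<le> 1) = \<P>(\<omega> in M. S v \<omega> \<le> 1)"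
  proof (rule cdf_eq_if_laplace_eq)
    show "expectation (\<lambda>\<omega>. exp (- real n * (S (t powr \<beta> * v) \<omega> / t))) =
        expectation (\<lambda>\<omega>. exp (- real n * S v \<omega>))" for n
    proof -
      have "expectation (\<lambda>\<omega>. exp (- (real n / t) * S (t powr \<beta> * v) \<omega>)) =
          exp (- (t powr \<beta> * v) * (real n / t) powr \<beta>)"
        by (rule stable_laplace) (use t tv in auto)
      also have "\<dots> = exp (- v * real n powr \<beta>)"
        using t by (simp add: powr_divide)
      also have "\<dots> = expectation (\<lambda>\<omega>. exp (- real n * S v \<omega>))"
        by (rule stable_laplace[symmetric]) (use v in auto)
      finally show ?thesis by simp
    qed
  qed (use stable_measurable[OF tv] stable_measurable[OF v] stable_nonneg[OF tv] stable_nonneg[OF v] t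
      in \<open>auto elim!: eventually_mono\<close>)
  then show ?thesis using t by (simp add: emeasure_eq_measure)
qed

lemma potential_scaling:
  assumes t: "0 < t"
  shows "potential S t = ennreal (t powr \<beta>) * potential S 1"
proof -
  let ?c = "t powr \<beta>"
  note [measurable] = potential_measurable[OF stable_sub stable_top]
  have c: "0 < ?c" using t by simp
  have "potential S t = ennreal ?c * (\<integral>\<^sup>+v. indicator {0..} (?c * v) *
      emeasure M {\<omega> \<in> space M. S (?c * v) \<omega> \<le> t} \<partial>lborel)"
    unfolding potential_def by (rule nn_integral_lborel_scale[OF _ c]) measurable
  also have "(\<integral>\<^sup>+v. indicator {0..} (?c * v) * emeasure M {\<omega> \<in> space M. S (?c * v) \<omega> \<le> t} \<partial>lborel) = potential S 1"
    unfolding potential_def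
  proof (intro nn_integral_cong)
    fix v :: real
    show "indicator {0..} (?c * v) * emeasure M {\<omega> \<in> space M. S (?c * v) \<omega> \<le> t} =
        indicator {0..} v * emeasure M {\<omega> \<in> space M. S v \<omega> \<le> 1}"
      using c stable_scaling[OF t, of v] by (cases "0 \<le> v") (auto simp: zero_le_mult_iff)
  qed
  finally show ?thesis .
qed

lemma potential_moment_scaling:
  assumes t: "0 < t"
  shows "potential_moment S t = ennreal (t powr (2 * \<beta>)) * potential_moment S 1"
proof -
  let ?c = "t powr \<beta>"
  note [measurable] = potential_measurable[OF stable_sub stable_top]
  have c: "0 < ?c" using t by simp
  have "potential_moment S t = ennreal ?c * (\<integral>\<^sup>+v. ennreal (?c * v) *
      (indicator {0..} (?c * v) * emeasure M {\<omega> \<in> space M. S (?c * v) \<omega> \<le> t}) \<partial>lborel)"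
    unfolding potential_moment_def by (rule nn_integral_lborel_scale[OF _ c]) measurable
  also have "(\<integral>\<^sup>+v. ennreal (?c * v) *
      (indicator {0..} (?c * v) * emeasure M {\<omega> \<in> space M. S (?c * v) \<omega> \<le> t}) \<partial>lborel) =
      (\<integral>\<^sup>+v. ennreal ?c * (ennreal v * (indicator {0..} v * emeasure M {\<omega> \<in> space M. S v \<omega> \<le> 1})) \<partial>lborel)"
  proof (intro nn_integral_cong)
    fix v :: real
    show "ennreal (?c * v) * (indicator {0..} (?c * v) * emeasure M {\<omega> \<in> space M. S (?c * v) \<omega> \<le> t}) =
        ennreal ?c * (ennreal v * (indicator {0..} v * emeasure M {\<omega> \<in> space M. S v \<omega> \<le> 1}))"
      using c stable_scaling[OF t, of v]
      by (cases "0 \<le> v") (auto simp: zero_le_mult_iff ennreal_mult' mult.assoc)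
  qed
  also have "\<dots> = ennreal ?c * potential_moment S 1"
    unfolding potential_moment_def by (rule nn_integral_cmult) measurable
  also have "ennreal ?c * (ennreal ?c * potential_moment S 1) = ennreal (t powr (2 * \<beta>)) * potential_moment S 1"
    using t by (simp add: mult.assoc[symmetric] ennreal_mult[symmetric] powr_add[symmetric])
  finally show ?thesis .
qed

text \<open>
  Markov's inequality for \<open>exp (- S x)\<close>; integrating the bound over \<open>x\<close> shows that the potential is finite.
\<close>

lemma stable_tail: "0 \<le> x \<Longrightarrow> emeasure M {\<omega> \<in> space M. S x \<omega> \<le> 1} \<le> ennreal (exp 1 * exp (- x))"
proof -
  assume x: "0 \<le> x"
  note [measurable] = stable_measurable[OF x]
  have "emeasure M {\<omega> \<in> space M. S x \<omega> \<le> 1} = (\<integral>\<^sup>+\<omega>. indicator {\<omega> \<in> space M. S x \<omega> \<le> 1} \<omega> \<partial>M)" by simp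
  also have "\<dots> \<le> (\<integral>\<^sup>+\<omega>. ennreal (exp 1 * exp (- 1 * S x \<omega>)) \<partial>M)"
    by (intro nn_integral_mono) (auto simp: indicator_def simp flip: exp_add)
  also have "\<dots> = ennreal (expectation (\<lambda>\<omega>. exp 1 * exp (- 1 * S x \<omega>)))"
    by (rule nn_integral_eq_integral) (use stable_integrable[OF x, of 1] in auto)
  also have "\<dots> = ennreal (exp 1 * exp (- x))"
    using stable_laplace[OF x, of 1] by simp
  finally show ?thesis .
qed

lemma potential_finite: "potential S 1 < \<infinity>" "potential_moment S 1 < \<infinity>"
proof -
  have "potential S 1 \<le> (\<integral>\<^sup>+x. ennreal (exp 1) * (ennreal (x ^ 0 * exp (- x)) * indicator {0..} x) \<partial>lborel)"
    unfolding potential_def using stable_tail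
    by (intro nn_integral_mono) (auto simp: indicator_def ennreal_mult)
  also have "\<dots> = ennreal (exp 1) * (\<integral>\<^sup>+x. ennreal (x ^ 0 * exp (- x)) * indicator {0..} x \<partial>lborel)"
    by (rule nn_integral_cmult) measurable
  also have "\<dots> < \<infinity>"
    by (subst nn_intergal_power_times_exp_Ici) (simp add: ennreal_mult_less_top)
  finally show "potential S 1 < \<infinity>" .
  have "potential_moment S 1 \<le> (\<integral>\<^sup>+x. ennreal (exp 1) * (ennreal (x ^ 1 * exp (- x)) * indicator {0..} x) \<partial>lborel)"
    unfolding potential_moment_def
  proof (intro nn_integral_mono)
    fix x :: real
    show "ennreal x * (indicator {0..} x * emeasure M {\<omega> \<in> space M. S x \<omega> \<le> 1}) \<le>
        ennreal (exp 1) * (ennreal (x ^ 1 * exp (- x)) * indicator {0..} x)"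
    proof (cases "0 \<le> x")
      case True
      then have "ennreal x * emeasure M {\<omega> \<in> space M. S x \<omega> \<le> 1} \<le> ennreal x * ennreal (exp 1 * exp (- x))"
        by (intro mult_left_mono stable_tail) auto
      also have "\<dots> = ennreal (exp 1) * ennreal (x * exp (- x))"
        using True by (simp add: ennreal_mult[symmetric] mult_ac)
      finally show ?thesis using True by simp
    qed simp
  qed
  also have "\<dots> = ennreal (exp 1) * (\<integral>\<^sup>+x. ennreal (x ^ 1 * exp (- x)) * indicator {0..} x \<partial>lborel)"
    by (rule nn_integral_cmult) measurable
  also have "\<dots> < \<infinity>"
    by (subst nn_intergal_power_times_exp_Ici) (simp add: ennreal_mult_less_top)
  finally show "potential_moment S 1 < \<infinity>" .
qed

text \<open>
  Scaling only covers positive times, but the potential is monotone and tends to zero at zero.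
\<close>

lemma potential_at_zero: "potential S 0 = 0" "potential_moment S 0 = 0"
proof -
  note [measurable] = potential_measurable[OF stable_sub stable_top]
  define c where "c = enn2real (potential S 1)"
  have c: "0 \<le> c" "potential S 1 = ennreal c" unfolding c_def using potential_finite by auto
  have "potential S 0 \<le> 0"
  proof (rule ennreal_le_epsilon)
    fix e :: real assume e: "0 < e"
    define t where "t = (e / (c + 1)) powr (1 / \<beta>)"
    have t: "0 < t" using e c unfolding t_def by simp
    have "t powr \<beta> = e / (c + 1)" unfolding t_def using \<beta> e c by (simp add: powr_powr)
    have le: "t powr \<beta> * c \<le> e"
      unfolding \<open>t powr \<beta> = e / (c + 1)\<close> using c e by (simp add: divide_le_eq algebra_simps)
    have "potential S 0 \<le> potential S t"
      unfolding potential_def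
    proof (intro nn_integral_mono)
      fix x :: real
      show "indicator {0..} x * emeasure M {\<omega> \<in> space M. S x \<omega> \<le> 0} \<le>
          indicator {0..} x * emeasure M {\<omega> \<in> space M. S x \<omega> \<le> t}"
        using t stable_measurable[of x]
        by (cases "0 \<le> x") (auto intro!: emeasure_mono)
    qed
    also have "\<dots> = ennreal (t powr \<beta> * c)"
      unfolding potential_scaling[OF t] using c by (simp add: ennreal_mult)
    also have "\<dots> \<le> ennreal e" using le by (rule ennreal_leI)
    finally show "potential S 0 \<le> 0 + ennreal e" by simp
  qed
  then show 0: "potential S 0 = 0" by simp
  show "potential_moment S 0 = 0"
    using 0 unfolding potential_def potential_moment_def
    by (subst (asm) nn_integral_0_iff_AE, simp, subst nn_integral_0_iff_AE) (auto elim!: eventually_mono)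
qed

text \<open>
  If the inverse at 1 were almost surely \<open>c\<close>, then \<open>S\<close> would pass the level 1 exactly at time \<open>c\<close>.  For
  \<open>c = 0\<close> this makes \<open>S (1/2)\<close> exceed 1 and the Laplace transform at 1 too small.  For \<open>c > 0\<close> it makes
  \<open>S r\<close> bounded by 1 for some \<open>r > 0\<close>, so \<open>exp (- u) \<le> exp (- r * u powr \<beta>)\<close> for all \<open>u > 0\<close>, which fails for
  small \<open>u\<close> since \<open>\<beta> < 1\<close>.
\<close>

lemma inverse_not_constant: "\<not> (AE \<omega> in M. inverse_subordinator S 1 \<omega> = c)"
proof
  assume const: "AE \<omega> in M. inverse_subordinator S 1 \<omega> = c"
  have path: "AE \<omega> in M. mono_on {0..} (\<lambda>t. S t \<omega>) \<and> filterlim (\<lambda>t. S t \<omega>) at_top at_top"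
    using AE_path[OF stable_sub stable_top] .
  have "AE \<omega> in M. 0 \<le> c"
    using const path by eventually_elim (auto dest: inverse_nonneg)
  then have "0 \<le> c" by simp
  then consider "c = 0" | "0 < c" by linarith
  then show False
  proof cases
    case 1
    have half: "AE \<omega> in M. 1 < S (1 / 2) \<omega>"
      using const path by eventually_elim (use 1 in \<open>auto intro: inverse_lessD\<close>)
    have "expectation (\<lambda>\<omega>. exp (- 1 * S (1 / 2) \<omega>)) \<le> expectation (\<lambda>\<omega>. exp (- 1))"
      by (rule integral_mono_AE) (use half stable_integrable[of "1 / 2" 1] in \<open>auto elim!: eventually_mono\<close>)
    then show False using stable_laplace[of "1 / 2" 1] by (simp add: prob_space)
  next
    case 2
    define r where "r = c / 2"
    \<comment> \<open>chosen such that u = (r / 2) * u powr \<beta>, half of what the bound requires\<close>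
    define u where "u = (r / 2) powr (1 / (1 - \<beta>))"
    have r: "0 < r" "r < c" using 2 unfolding r_def by auto
    have u: "0 < u" using r unfolding u_def by simp
    have le: "AE \<omega> in M. S r \<omega> \<le> 1"
      using const path by eventually_elim (use r in \<open>auto intro: inverse_gtD\<close>)
    have "expectation (\<lambda>\<omega>. exp (- u)) \<le> expectation (\<lambda>\<omega>. exp (- u * S r \<omega>))"
      by (rule integral_mono_AE) (use le u r stable_integrable[of r u] in \<open>auto elim!: eventually_mono\<close>)
    then have "r * u powr \<beta> \<le> u"
      using stable_laplace[of r u] u r by (simp add: prob_space)
    moreover have "u = u powr (1 - \<beta>) * u powr \<beta>"
      using u by (simp add: powr_add[symmetric])
    moreover have "u powr (1 - \<beta>) = r / 2"
      unfolding u_def using \<beta> r by (simp add: powr_powr)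
    ultimately have "r * u powr \<beta> \<le> r / 2 * u powr \<beta>" by simp
    then show False using r u by simp
  qed
qed

text \<open>
  Here \<open>c\<close> is the mean and \<open>2 * b\<close> the second moment of the inverse at time 1; both
  inequalities hold because the inverse is not deterministic.
\<close>

lemma inverse_stable_moments:
  assumes inv [measurable]: "\<And>t. 0 \<le> t \<Longrightarrow> inverse_subordinator S t \<in> borel_measurable M"
  obtains c b where "0 < c" "c\<^sup>2 < 2 * b"
    and "\<And>t. 0 \<le> t \<Longrightarrow> (\<integral>\<^sup>+\<omega>. ennreal (inverse_subordinator S t \<omega>) \<partial>M) = ennreal (c * t powr \<beta>)"
    and "\<And>t. 0 \<le> t \<Longrightarrow> (\<integral>\<^sup>+\<omega>. ennreal ((inverse_subordinator S t \<omega>)\<^sup>2) \<partial>M) = ennreal (2 * b * t powr (2 * \<beta>))"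
    and "\<And>s t. 0 \<le> s \<Longrightarrow> s \<le> t \<Longrightarrow>
      (\<integral>\<^sup>+\<omega>. ennreal (inverse_subordinator S s \<omega> * inverse_subordinator S t \<omega>) \<partial>M) \<le>
        ennreal (b * s powr (2 * \<beta>) + c\<^sup>2 * s powr \<beta> * t powr \<beta>)"
    and "\<And>s t. 0 \<le> s \<Longrightarrow> s \<le> t \<Longrightarrow>
      ennreal (b * s powr (2 * \<beta>) + c\<^sup>2 * s powr \<beta> * (t - s) powr \<beta>) \<le>
        (\<integral>\<^sup>+\<omega>. ennreal (inverse_subordinator S s \<omega> * inverse_subordinator S t \<omega>) \<partial>M)"
proof -
  let ?E = "inverse_subordinator S"
  define c b where "c = enn2real (potential S 1)" and "b = enn2real (potential_moment S 1)"
  have nonneg: "0 \<le> c" "0 \<le> b" unfolding c_def b_def by auto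
  have potential: "potential S t = ennreal (c * t powr \<beta>)" if "0 \<le> t" for t
    using that potential_scaling[of t] potential_finite(1) potential_at_zero(1) nonneg \<beta>
    by (cases "t = 0") (auto simp: c_def ennreal_mult mult.commute)
  have mom: "potential_moment S t = ennreal (b * t powr (2 * \<beta>))" if "0 \<le> t" for t
    using that potential_moment_scaling[of t] potential_finite(2) potential_at_zero(2) nonneg \<beta>
    by (cases "t = 0") (auto simp: b_def ennreal_mult mult.commute)
  have path: "AE \<omega> in M. mono_on {0..} (\<lambda>t. S t \<omega>) \<and> filterlim (\<lambda>t. S t \<omega>) at_top at_top"
    using AE_path[OF stable_sub stable_top] .
  have E_nonneg: "AE \<omega> in M. 0 \<le> ?E t \<omega>" for t
    using path by eventually_elim (auto dest: inverse_nonneg)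
  have first: "(\<integral>\<^sup>+\<omega>. ennreal (?E t \<omega>) \<partial>M) = ennreal (c * t powr \<beta>)" if "0 \<le> t" for t
    using nn_integral_inverse[OF stable_sub stable_top] potential[OF that] by simp
  have second: "(\<integral>\<^sup>+\<omega>. ennreal ((?E t \<omega>)\<^sup>2 / 2) \<partial>M) = ennreal (b * t powr (2 * \<beta>))" if "0 \<le> t" for t
    using nn_integral_inverse_square[OF stable_sub stable_top] mom[OF that] by simp
  have prod: "(\<integral>\<^sup>+\<omega>. ennreal (?E s \<omega> * ?E t \<omega>) \<partial>M) \<le>
        ennreal (b * s powr (2 * \<beta>) + c\<^sup>2 * s powr \<beta> * t powr \<beta>)"
      "ennreal (b * s powr (2 * \<beta>) + c\<^sup>2 * s powr \<beta> * (t - s) powr \<beta>) \<le>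
        (\<integral>\<^sup>+\<omega>. ennreal (?E s \<omega> * ?E t \<omega>) \<partial>M)" if st: "0 \<le> s" "s \<le> t" for s t
  proof -
    have "ennreal (b * s powr (2 * \<beta>) + c\<^sup>2 * s powr \<beta> * v powr \<beta>) = potential_moment S s + potential S s * potential S v"
      if "0 \<le> v" for v
      using st that nonneg
      by (simp add: potential mom ennreal_mult[symmetric] ennreal_plus[symmetric] power2_eq_square mult_ac
          del: ennreal_plus)
    then show "(\<integral>\<^sup>+\<omega>. ennreal (?E s \<omega> * ?E t \<omega>) \<partial>M) \<le>
        ennreal (b * s powr (2 * \<beta>) + c\<^sup>2 * s powr \<beta> * t powr \<beta>)"
      "ennreal (b * s powr (2 * \<beta>) + c\<^sup>2 * s powr \<beta> * (t - s) powr \<beta>) \<le>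
        (\<integral>\<^sup>+\<omega>. ennreal (?E s \<omega> * ?E t \<omega>) \<partial>M)"
      using nn_integral_inverse_product[OF stable_sub stable_top st(2)] st by auto
  qed
  have second': "(\<integral>\<^sup>+\<omega>. ennreal ((?E t \<omega>)\<^sup>2) \<partial>M) = ennreal (2 * b * t powr (2 * \<beta>))" if "0 \<le> t" for t
  proof -
    note [measurable] = inv[OF that]
    have "(\<integral>\<^sup>+\<omega>. ennreal ((?E t \<omega>)\<^sup>2) \<partial>M) = (\<integral>\<^sup>+\<omega>. ennreal 2 * ennreal ((?E t \<omega>)\<^sup>2 / 2) \<partial>M)"
      by (intro nn_integral_cong) (subst ennreal_mult[symmetric], auto)
    also have "\<dots> = ennreal 2 * ennreal (b * t powr (2 * \<beta>))"
      unfolding second[OF that, symmetric] by (rule nn_integral_cmult) measurable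
    also have "\<dots> = ennreal (2 * b * t powr (2 * \<beta>))"
      using nonneg by (subst ennreal_mult[symmetric]) (auto simp: mult.assoc)
    finally show ?thesis .
  qed
  have h1: "has_bochner_integral M (?E 1) c"
    using first[of 1] nonneg E_nonneg by (intro has_bochner_integral_nn_integral) auto
  have h2: "has_bochner_integral M (\<lambda>\<omega>. (?E 1 \<omega>)\<^sup>2) (2 * b)"
    using second'[of 1] nonneg by (intro has_bochner_integral_nn_integral) auto
  have "0 < c"
  proof (rule ccontr)
    assume "\<not> 0 < c"
    then have "(\<integral>\<^sup>+\<omega>. ennreal (?E 1 \<omega>) \<partial>M) = 0" using first[of 1] nonneg by simp
    then have "AE \<omega> in M. ennreal (?E 1 \<omega>) = 0" by (subst (asm) nn_integral_0_iff_AE) auto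
    then have "AE \<omega> in M. ?E 1 \<omega> = 0"
      using E_nonneg[of 1] by eventually_elim (auto simp: ennreal_eq_0_iff)
    then show False using inverse_not_constant by blast
  qed
  moreover have "c\<^sup>2 < 2 * b"
  proof (rule ccontr)
    assume "\<not> c\<^sup>2 < 2 * b"
    \<comment> \<open>otherwise the variance of the inverse at time 1 is not positive\<close>
    have *: "has_bochner_integral M (\<lambda>\<omega>. (?E 1 \<omega>)\<^sup>2 + c\<^sup>2 - 2 * c * ?E 1 \<omega>) (2 * b + c\<^sup>2 - 2 * c * c)"
      by (intro has_bochner_integral_diff has_bochner_integral_add h1 h2 has_bochner_integral_mult_right)
         (auto simp: has_bochner_integral_iff prob_space)
    then have "has_bochner_integral M (\<lambda>\<omega>. (?E 1 \<omega> - c)\<^sup>2) (2 * b - c\<^sup>2)"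
      by (simp add: power2_eq_square algebra_simps)
    then have "integrable M (\<lambda>\<omega>. (?E 1 \<omega> - c)\<^sup>2)" "expectation (\<lambda>\<omega>. (?E 1 \<omega> - c)\<^sup>2) \<le> 0"
      using \<open>\<not> c\<^sup>2 < 2 * b\<close> by (auto simp: has_bochner_integral_iff)
    moreover have "0 \<le> expectation (\<lambda>\<omega>. (?E 1 \<omega> - c)\<^sup>2)" by simp
    ultimately have "AE \<omega> in M. (?E 1 \<omega> - c)\<^sup>2 = 0"
      by (subst integral_nonneg_eq_0_iff_AE[symmetric]) auto
    then show False using inverse_not_constant[of c] by simp
  qed
  ultimately show thesis using that[of c b] first second' prod by blast
qed

end

end

section \<open>Fractional moments of the Mittag-Leffler subordinator\<close>

lemma nn_integral_lborel_if_has_integral: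
  fixes f :: "real \<Rightarrow> real"
  assumes nonneg: "\<And>x. x \<in> A \<Longrightarrow> 0 \<le> f x" and int: "(f has_integral I) A"
  shows "(\<integral>\<^sup>+x. indicator A x * ennreal (f x) \<partial>lborel) = ennreal I"
  using nn_integral_has_integral_lebesgue[OF nonneg int]
  by (subst nn_integral_cong[of _ _ "\<lambda>x. ennreal (indicator A x * f x)"]) (auto simp: indicator_def)

text \<open>
  This integrand dominates all those below: it is integrable at infinity as \<open>q > 0\<close>, and at zero as
  \<open>q < a\<close>.
\<close>

lemma nn_integral_powr_min_finite:
  fixes q a k :: real
  assumes "0 < q" "q < a" "0 \<le> k"
  shows "(\<integral>\<^sup>+u. indicator {0<..} u * ennreal (u powr (- q - 1) * min 1 (k * u powr a)) \<partial>lborel) < \<infinity>"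
proof -
  have "(\<integral>\<^sup>+u. indicator {0<..} u * ennreal (u powr (- q - 1) * min 1 (k * u powr a)) \<partial>lborel) \<le>
      (\<integral>\<^sup>+u. ennreal k * (indicator {0..1} u * ennreal (u powr (a - q - 1))) +
        indicator {1..} u * ennreal (u powr (- q - 1)) \<partial>lborel)"
  proof (intro nn_integral_mono)
    fix u :: real
    consider "u \<le> 0" | "0 < u" "u < 1" | "1 \<le> u" by linarith
    then show "indicator {0<..} u * ennreal (u powr (- q - 1) * min 1 (k * u powr a)) \<le>
        ennreal k * (indicator {0..1} u * ennreal (u powr (a - q - 1))) +
        indicator {1..} u * ennreal (u powr (- q - 1))"
    proof cases
      case 2
      have "u powr (- q - 1) * min 1 (k * u powr a) \<le> u powr (- q - 1) * (k * u powr a)"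
        by (intro mult_left_mono) auto
      also have "\<dots> = k * u powr (a - q - 1)"
        using 2 by (simp add: powr_add[symmetric] algebra_simps)
      finally have "ennreal (u powr (- q - 1) * min 1 (k * u powr a)) \<le> ennreal (k * u powr (a - q - 1))"
        by (rule ennreal_leI)
      then show ?thesis using 2 assms by (simp add: ennreal_mult)
    next
      case 3
      have "u powr (- q - 1) * min 1 (k * u powr a) \<le> u powr (- q - 1) * 1"
        by (intro mult_left_mono) auto
      then have "ennreal (u powr (- q - 1) * min 1 (k * u powr a)) \<le> ennreal (u powr (- q - 1))"
        by (intro ennreal_leI) simp
      then show ?thesis using 3 by (simp add: add_increasing)
    qed auto
  qed
  also have "\<dots> = ennreal k * (\<integral>\<^sup>+u. indicator {0..1} u * ennreal (u powr (a - q - 1)) \<partial>lborel) +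
      (\<integral>\<^sup>+u. indicator {1..} u * ennreal (u powr (- q - 1)) \<partial>lborel)"
    by (simp add: nn_integral_add nn_integral_cmult)
  also have "(\<integral>\<^sup>+u. indicator {0..1} u * ennreal (u powr (a - q - 1)) \<partial>lborel) =
      ennreal (1 powr (a - q - 1 + 1) / (a - q - 1 + 1))"
    by (rule nn_integral_lborel_if_has_integral) (use assms has_integral_powr_from_0[of "a - q - 1" 1] in auto)
  also have "(\<integral>\<^sup>+u. indicator {1..} u * ennreal (u powr (- q - 1)) \<partial>lborel) =
      ennreal (- (1 powr (- q - 1 + 1)) / (- q - 1 + 1))"
    by (rule nn_integral_lborel_if_has_integral) (use assms has_integral_powr_to_inf[of "- q - 1" 1] in auto)
  finally show ?thesis
    by (rule order_le_less_trans) (simp add: ennreal_mult_less_top)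
qed

lemma nn_integral_Ioi_pos:
  fixes f :: "real \<Rightarrow> real"
  assumes [measurable]: "f \<in> borel_measurable borel" and pos: "\<And>x. 0 < x \<Longrightarrow> 0 < f x"
  shows "0 < (\<integral>\<^sup>+x. indicator {0<..} x * ennreal (f x) \<partial>lborel)"
proof (rule ccontr)
  assume "\<not> ?thesis"
  then have "(\<integral>\<^sup>+x. indicator {0<..} x * ennreal (f x) \<partial>lborel) = 0" by simp
  then have "AE x in lborel. indicator {0<..} x * ennreal (f x) = 0"
    by (subst (asm) nn_integral_0_iff_AE) auto
  then have "AE x in lborel. x \<notin> {0::real<..<1}"
    by eventually_elim (use pos in \<open>force simp: indicator_def ennreal_eq_0_iff not_less split: if_splits\<close>)
  then have "{0::real<..<1} \<in> null_sets lborel"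
    by (subst AE_iff_null_sets) auto
  then have "emeasure lborel {0::real<..<1} = 0"
    by (rule null_setsD1)
  then show False by simp
qed

text \<open>
  The value is \<open>Gamma (1 - q) / q\<close> for \<open>0 < q < 1\<close>, and the proof needs that it is positive and finite.
\<close>

definition frac_const :: "real \<Rightarrow> ennreal" where
  "frac_const q = (\<integral>\<^sup>+u. indicator {0<..} u * ennreal (u powr (- q - 1) * (1 - exp (- u))) \<partial>lborel)"

lemma frac_const_bounds:
  assumes "0 < q" "q < 1"
  shows "0 < frac_const q" "frac_const q < \<infinity>"
proof -
  show "0 < frac_const q"
    unfolding frac_const_def by (rule nn_integral_Ioi_pos) auto
  have "frac_const q \<le> (\<integral>\<^sup>+u. indicator {0<..} u * ennreal (u powr (- q - 1) * min 1 (1 * u powr 1)) \<partial>lborel)"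
    unfolding frac_const_def
  proof (intro nn_integral_mono)
    fix u :: real
    show "indicator {0<..} u * ennreal (u powr (- q - 1) * (1 - exp (- u))) \<le>
        indicator {0<..} u * ennreal (u powr (- q - 1) * min 1 (1 * u powr 1))"
    proof (cases "0 < u")
      case True
      then have "1 - exp (- u) \<le> min 1 (1 * u powr 1)"
        using exp_ge_add_one_self[of "- u"] by simp
      then have "u powr (- q - 1) * (1 - exp (- u)) \<le> u powr (- q - 1) * min 1 (1 * u powr 1)"
        by (rule mult_left_mono) simp
      then show ?thesis using True by (simp add: ennreal_leI)
    qed simp
  qed
  also have "\<dots> < \<infinity>"
    by (rule nn_integral_powr_min_finite) (use assms in auto)
  finally show "frac_const q < \<infinity>" .
qed

text \<open>
  Substitute \<open>u = v / x\<close>.  This expresses a fractional power through the functions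
  \<open>1 - exp (- u * x)\<close>, whose expectations are given by the Laplace transform.
\<close>

lemma frac_power_eq_integral:
  assumes "0 < q" "0 \<le> x"
  shows "ennreal (x powr q) * frac_const q =
    (\<integral>\<^sup>+u. indicator {0<..} u * ennreal (u powr (- q - 1) * (1 - exp (- u * x))) \<partial>lborel)"
proof (cases "x = 0")
  case False
  with assms have x: "0 < x" by simp
  have "(\<integral>\<^sup>+u. indicator {0<..} u * ennreal (u powr (- q - 1) * (1 - exp (- u * x))) \<partial>lborel) =
      ennreal (1 / x) * (\<integral>\<^sup>+v. indicator {0<..} (1 / x * v) *
        ennreal ((1 / x * v) powr (- q - 1) * (1 - exp (- (1 / x * v) * x))) \<partial>lborel)"
    by (rule nn_integral_lborel_scale) (use x in auto)
  also have "\<dots> = ennreal (1 / x) * (\<integral>\<^sup>+v. ennreal (x powr (q + 1)) *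
      (indicator {0<..} v * ennreal (v powr (- q - 1) * (1 - exp (- v)))) \<partial>lborel)"
  proof (rule arg_cong[where f = "(*) (ennreal (1 / x))"], rule nn_integral_cong)
    fix v :: real
    show "indicator {0<..} (1 / x * v) * ennreal ((1 / x * v) powr (- q - 1) * (1 - exp (- (1 / x * v) * x))) =
        ennreal (x powr (q + 1)) * (indicator {0<..} v * ennreal (v powr (- q - 1) * (1 - exp (- v))))"
    proof (cases "0 < v")
      case True
      have "(1 / x * v) powr (- q - 1) = (1 / x) powr (- q - 1) * v powr (- q - 1)"
        using x True by (simp only: powr_mult)
      also have "(1 / x) powr (- q - 1) = x powr (q + 1)"
        using x by (simp add: powr_divide powr_minus_divide powr_diff powr_add divide_simps)
      finally show ?thesis using True x by (simp add: ennreal_mult mult.assoc)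
    next
      case False
      then show ?thesis using x by (auto simp: indicator_def zero_less_divide_iff)
    qed
  qed
  also have "\<dots> = ennreal (1 / x) * (ennreal (x powr (q + 1)) * frac_const q)"
    unfolding frac_const_def by (subst nn_integral_cmult) auto
  also have "\<dots> = ennreal (x powr q) * frac_const q"
    using x by (simp add: mult.assoc[symmetric] ennreal_mult[symmetric] powr_add)
  finally show ?thesis by simp
qed (use assms in simp)

lemma (in prob_space) frac_moment_laplace:
  fixes X :: "'a \<Rightarrow> real"
  assumes [measurable]: "X \<in> borel_measurable M" and pos: "AE \<omega> in M. 0 \<le> X \<omega>" and q: "0 < q"
  shows "(\<integral>\<^sup>+\<omega>. ennreal (X \<omega> powr q) \<partial>M) * frac_const q =
    (\<integral>\<^sup>+u. indicator {0<..} u *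
      ennreal (u powr (- q - 1) * (1 - expectation (\<lambda>\<omega>. exp (- u * X \<omega>)))) \<partial>lborel)"
proof -
  interpret pair_sigma_finite lborel M
    by (simp add: pair_sigma_finite_def sigma_finite_lborel sigma_finite_measure_axioms)
  have "(\<integral>\<^sup>+\<omega>. ennreal (X \<omega> powr q) \<partial>M) * frac_const q = (\<integral>\<^sup>+\<omega>. ennreal (X \<omega> powr q) * frac_const q \<partial>M)"
    by (subst nn_integral_multc) auto
  also have "\<dots> = (\<integral>\<^sup>+\<omega>. (\<integral>\<^sup>+u. indicator {0<..} u * ennreal (u powr (- q - 1) * (1 - exp (- u * X \<omega>))) \<partial>lborel) \<partial>M)"
    using pos by (intro nn_integral_cong_AE, eventually_elim) (rule frac_power_eq_integral[OF q])
  also have "\<dots> = (\<integral>\<^sup>+u. (\<integral>\<^sup>+\<omega>. indicator {0<..} u * ennreal (u powr (- q - 1) * (1 - exp (- u * X \<omega>))) \<partial>M) \<partial>lborel)"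
    by (rule Fubini') measurable
  also have "\<dots> = (\<integral>\<^sup>+u. indicator {0<..} u *
      ennreal (u powr (- q - 1) * (1 - expectation (\<lambda>\<omega>. exp (- u * X \<omega>)))) \<partial>lborel)"
  proof (intro nn_integral_cong)
    fix u :: real
    show "(\<integral>\<^sup>+\<omega>. indicator {0<..} u * ennreal (u powr (- q - 1) * (1 - exp (- u * X \<omega>))) \<partial>M) =
        indicator {0<..} u * ennreal (u powr (- q - 1) * (1 - expectation (\<lambda>\<omega>. exp (- u * X \<omega>))))"
    proof (cases "0 < u")
      case True
      have int: "integrable M (\<lambda>\<omega>. exp (- u * X \<omega>))"
        by (rule integrable_exp_neg) (use pos True in auto)
      have "(\<integral>\<^sup>+\<omega>. ennreal (u powr (- q - 1) * (1 - exp (- u * X \<omega>))) \<partial>M) =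
          ennreal (expectation (\<lambda>\<omega>. u powr (- q - 1) * (1 - exp (- u * X \<omega>))))"
        by (rule nn_integral_eq_integral)
           (use int pos True in \<open>auto elim!: eventually_mono intro!: mult_nonneg_nonneg\<close>)
      also have "expectation (\<lambda>\<omega>. u powr (- q - 1) * (1 - exp (- u * X \<omega>))) =
          u powr (- q - 1) * (1 - expectation (\<lambda>\<omega>. exp (- u * X \<omega>)))"
        using int by (simp add: prob_space)
      finally show ?thesis using True by simp
    qed simp
  qed
  finally show ?thesis .
qed

context prob_space
begin

context
  fixes X :: "real \<Rightarrow> 'a \<Rightarrow> real" and \<alpha> \<rho> \<mu> :: real
  assumes ml: "ml_subordinator M \<alpha> \<rho> \<mu> X" and par: "0 < \<alpha>" "\<alpha> < 1" "0 < \<rho>" "0 < \<mu>"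
begin

lemma ml_sub: "subordinator M X"
  using ml unfolding ml_subordinator_def by simp

lemma ml_laplace:
  "0 \<le> t \<Longrightarrow> 0 \<le> u \<Longrightarrow> expectation (\<lambda>\<omega>. exp (- u * X t \<omega>)) = (\<mu> / (\<mu> + u powr \<alpha>)) powr (\<rho> * t)"
  using ml unfolding ml_subordinator_def by simp

lemmas ml_measurable = sub_measurable[OF ml_sub]

lemmas ml_nonneg = subordinator_nonneg[OF ml_sub]

lemma ml_top: "AE \<omega> in M. filterlim (\<lambda>t. X t \<omega>) at_top at_top"
proof (rule AE_tends_to_infinity[OF sub_mono[OF ml_sub]])
  let ?r = "(\<mu> / (\<mu> + 1)) powr \<rho>"
  show "(\<lambda>n. expectation (\<lambda>\<omega>. exp (- X (real n) \<omega>))) \<longlonglongrightarrow> 0"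
  proof -
    have "?r < 1 powr \<rho>" using par by (intro powr_less_mono2) auto
    then have "(\<lambda>n. ?r ^ n) \<longlonglongrightarrow> 0"
      by (intro LIMSEQ_power_zero) simp
    moreover have "expectation (\<lambda>\<omega>. exp (- X (real n) \<omega>)) = ?r ^ n" for n
      using ml_laplace[of "real n" 1] par by (simp add: powr_powr powr_realpow[symmetric])
    ultimately show ?thesis by simp
  qed
  show "integrable M (\<lambda>\<omega>. exp (- X (real n) \<omega>))" for n
    using integrable_exp_neg[OF ml_measurable ml_nonneg, of "real n" 1] by simp
qed (use ml_measurable in auto)

text \<open>
  The integrand of \<open>frac_moment_laplace\<close> for the Mittag-Leffler law at time \<open>t\<close> after the substitution
  \<open>u = w / t powr (1 / \<alpha>)\<close>, which brings the Laplace transform into the form of the exponential limit.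
\<close>

definition ml_kernel :: "real \<Rightarrow> real \<Rightarrow> real \<Rightarrow> real" where
  "ml_kernel q t w = w powr (- q - 1) * (1 - (1 + w powr \<alpha> / \<mu> / t) powr (- \<rho> * t))"

lemma ml_moment_scaled:
  assumes t: "0 < t" and q: "0 < q"
  shows "(\<integral>\<^sup>+\<omega>. ennreal (X t \<omega> powr q) \<partial>M) * frac_const q =
    ennreal (t powr (q / \<alpha>)) * (\<integral>\<^sup>+w. indicator {0<..} w * ennreal (ml_kernel q t w) \<partial>lborel)"
proof -
  define c where "c = t powr (- 1 / \<alpha>)"
  have c: "0 < c" using t unfolding c_def by simp
  have c\<alpha>: "c powr \<alpha> = 1 / t"
  proof -
    have "c powr \<alpha> = t powr (- 1)" unfolding c_def powr_powr using par by simp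
    then show ?thesis using t by (simp add: powr_minus_divide)
  qed
  have cq: "c * c powr (- q - 1) = t powr (q / \<alpha>)"
  proof -
    have "c * c powr (- q - 1) = c powr (- q)"
      using c by (simp add: powr_mult_base)
    then show ?thesis unfolding c_def by (simp add: powr_powr)
  qed
  have "(\<integral>\<^sup>+\<omega>. ennreal (X t \<omega> powr q) \<partial>M) * frac_const q =
      (\<integral>\<^sup>+u. indicator {0<..} u *
        ennreal (u powr (- q - 1) * (1 - expectation (\<lambda>\<omega>. exp (- u * X t \<omega>)))) \<partial>lborel)"
    using t by (intro frac_moment_laplace ml_measurable ml_nonneg q) auto
  also have "\<dots> = (\<integral>\<^sup>+u. indicator {0<..} u *
        ennreal (u powr (- q - 1) * (1 - (\<mu> / (\<mu> + u powr \<alpha>)) powr (\<rho> * t))) \<partial>lborel)"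
  proof (intro nn_integral_cong)
    fix u :: real
    show "indicator {0<..} u * ennreal (u powr (- q - 1) * (1 - expectation (\<lambda>\<omega>. exp (- u * X t \<omega>)))) =
        indicator {0<..} u * ennreal (u powr (- q - 1) * (1 - (\<mu> / (\<mu> + u powr \<alpha>)) powr (\<rho> * t)))"
      using ml_laplace[of t u] t by (cases "0 < u") simp_all
  qed
  also have "\<dots> = ennreal c * (\<integral>\<^sup>+w. indicator {0<..} (c * w) *
        ennreal ((c * w) powr (- q - 1) * (1 - (\<mu> / (\<mu> + (c * w) powr \<alpha>)) powr (\<rho> * t))) \<partial>lborel)"
    by (rule nn_integral_lborel_scale) (use c in auto)
  also have "\<dots> = ennreal c * (\<integral>\<^sup>+w. ennreal (c powr (- q - 1)) *
        (indicator {0<..} w * ennreal (ml_kernel q t w)) \<partial>lborel)"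
  proof (rule arg_cong[where f = "(*) (ennreal c)"], rule nn_integral_cong)
    fix w :: real
    show "indicator {0<..} (c * w) *
        ennreal ((c * w) powr (- q - 1) * (1 - (\<mu> / (\<mu> + (c * w) powr \<alpha>)) powr (\<rho> * t))) =
      ennreal (c powr (- q - 1)) * (indicator {0<..} w * ennreal (ml_kernel q t w))"
    proof (cases "0 < w")
      case True
      have pos: "0 < 1 + w powr \<alpha> / \<mu> / t" using t par by (intro add_pos_nonneg) auto
      have "\<mu> / (\<mu> + (c * w) powr \<alpha>) = inverse (1 + w powr \<alpha> / \<mu> / t)"
        using par t by (simp add: powr_mult c\<alpha> field_simps)
      then have "(\<mu> / (\<mu> + (c * w) powr \<alpha>)) powr (\<rho> * t) = (1 + w powr \<alpha> / \<mu> / t) powr (- \<rho> * t)"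
        using pos by (simp add: powr_minus inverse_powr)
      then show ?thesis using True c
        by (simp add: ml_kernel_def powr_mult ennreal_mult' mult.assoc)
    qed (use c in \<open>auto simp: indicator_def zero_less_mult_iff\<close>)
  qed
  also have "\<dots> = ennreal c * (ennreal (c powr (- q - 1)) *
        (\<integral>\<^sup>+w. indicator {0<..} w * ennreal (ml_kernel q t w) \<partial>lborel))"
    unfolding ml_kernel_def by (subst nn_integral_cmult) auto
  also have "\<dots> = ennreal (t powr (q / \<alpha>)) * (\<integral>\<^sup>+w. indicator {0<..} w * ennreal (ml_kernel q t w) \<partial>lborel)"
    using c by (simp add: mult.assoc[symmetric] ennreal_mult[symmetric] cq)
  finally show ?thesis .
qed

lemma ml_kernel_bounds:
  assumes t: "0 < t" and w: "0 < w"
  shows "0 \<le> ml_kernel q t w" "ml_kernel q t w \<le> w powr (- q - 1) * min 1 (\<rho> / \<mu> * w powr \<alpha>)"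
proof -
  let ?x = "w powr \<alpha> / \<mu>"
  have x: "0 \<le> ?x" using par by simp
  have "0 \<le> ?x / t" by (rule divide_nonneg_pos[OF x t])
  then have ge1: "1 \<le> 1 + ?x / t" by linarith
  have "(1 + ?x / t) powr (- \<rho> * t) \<le> (1 + ?x / t) powr 0"
    using ge1 par t by (intro powr_mono) auto
  then show "0 \<le> ml_kernel q t w"
    unfolding ml_kernel_def using ge1 by (intro mult_nonneg_nonneg) auto
  have "ln (1 + ?x / t) \<le> ?x / t" by (rule ln_add_one_self_le_self) fact
  then have "\<rho> * t * ln (1 + ?x / t) \<le> \<rho> * t * (?x / t)"
    using par t by (intro mult_left_mono) auto
  then have "\<rho> * t * ln (1 + ?x / t) \<le> \<rho> * ?x" using t by simp
  then have "1 - exp (- (\<rho> * t * ln (1 + ?x / t))) \<le> \<rho> * ?x"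
    using exp_ge_add_one_self[of "- (\<rho> * t * ln (1 + ?x / t))"] by linarith
  moreover have "(1 + ?x / t) powr (- \<rho> * t) = exp (- (\<rho> * t * ln (1 + ?x / t)))"
    using ge1 by (simp add: powr_def)
  ultimately have "1 - (1 + ?x / t) powr (- \<rho> * t) \<le> min 1 (\<rho> / \<mu> * w powr \<alpha>)" by simp
  then show "ml_kernel q t w \<le> w powr (- q - 1) * min 1 (\<rho> / \<mu> * w powr \<alpha>)"
    unfolding ml_kernel_def by (intro mult_left_mono) auto
qed

lemma ml_kernel_measurable [measurable]: "ml_kernel q t \<in> borel_measurable borel"
  unfolding ml_kernel_def by measurable

text \<open>
  The limit belongs to a stable law of index \<open>\<alpha>\<close>: \<open>X t / t powr (1 / \<alpha>)\<close> converges to one in distribution.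
\<close>

lemma ml_kernel_limit:
  assumes "0 < w"
  shows "((\<lambda>t. ml_kernel q t w) \<longlongrightarrow> w powr (- q - 1) * (1 - exp (w powr \<alpha> / \<mu>) powr (- \<rho>))) at_top"
proof -
  let ?x = "w powr \<alpha> / \<mu>"
  have "((\<lambda>t. ((1 + ?x / t) powr t) powr (- \<rho>)) \<longlongrightarrow> exp ?x powr (- \<rho>)) at_top"
    by (intro tendsto_powr tendsto_exp_limit_at_top tendsto_const) auto
  moreover have "((1 + ?x / t) powr t) powr (- \<rho>) = (1 + ?x / t) powr (- \<rho> * t)" for t
    by (simp add: powr_powr mult.commute)
  ultimately have "((\<lambda>t. (1 + ?x / t) powr (- \<rho> * t)) \<longlongrightarrow> exp ?x powr (- \<rho>)) at_top"
    by simp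
  then show ?thesis
    unfolding ml_kernel_def by (intro tendsto_mult tendsto_diff tendsto_const)
qed

text \<open>
  Dominated convergence in the rescaled integral; the limit is positive since the limiting integrand is.
\<close>

lemma ml_moment_asymptotics:
  assumes q: "0 < q" "q < \<alpha>"
  obtains m where "0 < m"
    and "((\<lambda>t. expectation (\<lambda>\<omega>. X t \<omega> powr q) / t powr (q / \<alpha>)) \<longlongrightarrow> m) at_top"
proof -
  define C where "C = enn2real (frac_const q)"
  have C: "frac_const q = ennreal C" "0 < C"
    using frac_const_bounds[of q] q par unfolding C_def by (auto simp: enn2real_positive_iff)
  define w where "w u = indicator {0<..} u * (u powr (- q - 1) * min 1 (\<rho> / \<mu> * u powr \<alpha>))" for u :: real
  define k where "k t u = indicator {0<..} u * ml_kernel q t u" for t u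
  define kinf where "kinf u = indicator {0<..} u * (u powr (- q - 1) * (1 - exp (u powr \<alpha> / \<mu>) powr (- \<rho>)))" for u :: real
  have [measurable]: "w \<in> borel_measurable borel" "k t \<in> borel_measurable borel" "kinf \<in> borel_measurable borel" for t
    unfolding w_def k_def kinf_def by measurable
  have w_int: "integrable lborel w"
  proof (rule integrableI_nonneg)
    show "(\<integral>\<^sup>+x. ennreal (w x) \<partial>lborel) < \<infinity>"
      using nn_integral_powr_min_finite[of q \<alpha> "\<rho> / \<mu>"] q par
      unfolding w_def by (simp add: ennreal_mult' ennreal_indicator)
  qed (use par in \<open>auto simp: w_def\<close>)
  have bound: "norm (k t u) \<le> w u" if "0 < t" for t u
    using ml_kernel_bounds[OF that, of u q] by (auto simp: k_def w_def indicator_def)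
  have k_lim: "((\<lambda>t. k t u) \<longlongrightarrow> kinf u) at_top" for u
    using ml_kernel_limit[of u q] by (auto simp: k_def kinf_def indicator_def)
  have lim: "((\<lambda>t. integral\<^sup>L lborel (k t)) \<longlongrightarrow> integral\<^sup>L lborel kinf) at_top"
    by (rule integral_dominated_convergence_at_top[where w = w])
       (use bound k_lim w_int in \<open>auto intro!: eventually_mono[OF eventually_gt_at_top[of 0]]\<close>)
  have kinf_bound: "norm (kinf u) \<le> w u" for u
  proof (rule tendsto_upperbound[OF tendsto_norm[OF k_lim]])
    show "\<forall>\<^sub>F t in at_top. norm (k t u) \<le> w u"
      using bound by (intro eventually_mono[OF eventually_gt_at_top[of 0]]) auto
  qed simp
  have kinf_pos: "0 < u powr (- q - 1) * (1 - exp (u powr \<alpha> / \<mu>) powr (- \<rho>))" if "0 < u" for u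
    using that par by (intro mult_pos_pos) (auto simp: powr_def)
  have kinf_int: "integrable lborel kinf"
    by (rule Bochner_Integration.integrable_bound[OF w_int])
       (use kinf_bound in \<open>auto intro!: always_eventually order_trans[OF _ abs_ge_self]\<close>)
  have "0 < (\<integral>\<^sup>+u. indicator {0<..} u * ennreal (u powr (- q - 1) * (1 - exp (u powr \<alpha> / \<mu>) powr (- \<rho>))) \<partial>lborel)"
    by (rule nn_integral_Ioi_pos) (use kinf_pos in auto)
  also have "\<dots> = (\<integral>\<^sup>+u. ennreal (kinf u) \<partial>lborel)"
    by (intro nn_integral_cong) (auto simp: kinf_def indicator_def)
  also have "\<dots> = ennreal (integral\<^sup>L lborel kinf)"
    by (rule nn_integral_eq_integral[OF kinf_int])
       (use kinf_pos in \<open>auto simp: kinf_def indicator_def less_imp_le intro!: always_eventually\<close>)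
  finally have pos: "0 < integral\<^sup>L lborel kinf" by simp
  have eq: "expectation (\<lambda>\<omega>. X t \<omega> powr q) / t powr (q / \<alpha>) = integral\<^sup>L lborel (k t) / C" if t: "0 < t" for t
  proof -
    have [measurable]: "X t \<in> borel_measurable M" using t by (intro ml_measurable) simp
    have k_int: "integrable lborel (k t)"
      by (rule Bochner_Integration.integrable_bound[OF w_int])
         (use bound[OF t] in \<open>auto intro!: always_eventually order_trans[OF _ abs_ge_self]\<close>)
    have k_nonneg: "0 \<le> k t u" for u
      using ml_kernel_bounds(1)[OF t, of u q] by (auto simp: k_def indicator_def)
    have "(\<integral>\<^sup>+w. indicator {0<..} w * ennreal (ml_kernel q t w) \<partial>lborel) = (\<integral>\<^sup>+u. ennreal (k t u) \<partial>lborel)"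
      by (intro nn_integral_cong) (auto simp: k_def indicator_def)
    also have "\<dots> = ennreal (integral\<^sup>L lborel (k t))"
      by (rule nn_integral_eq_integral[OF k_int]) (use k_nonneg in auto)
    finally have "(\<integral>\<^sup>+\<omega>. ennreal (X t \<omega> powr q) \<partial>M) * ennreal C =
        ennreal (t powr (q / \<alpha>) * integral\<^sup>L lborel (k t))"
      using ml_moment_scaled[OF t q(1)] k_nonneg by (simp add: C ennreal_mult Bochner_Integration.integral_nonneg)
    then have "enn2real ((\<integral>\<^sup>+\<omega>. ennreal (X t \<omega> powr q) \<partial>M) * ennreal C) = t powr (q / \<alpha>) * integral\<^sup>L lborel (k t)"
      using k_nonneg by (simp add: Bochner_Integration.integral_nonneg)
    then have "expectation (\<lambda>\<omega>. X t \<omega> powr q) * C = t powr (q / \<alpha>) * integral\<^sup>L lborel (k t)"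
      using C by (simp add: enn2real_mult integral_eq_nn_integral)
    then show ?thesis using C t by (simp add: field_simps)
  qed
  have "((\<lambda>t. expectation (\<lambda>\<omega>. X t \<omega> powr q) / t powr (q / \<alpha>)) \<longlongrightarrow> integral\<^sup>L lborel kinf / C) at_top"
  proof (rule Lim_transform_eventually)
    show "((\<lambda>t. integral\<^sup>L lborel (k t) / C) \<longlongrightarrow> integral\<^sup>L lborel kinf / C) at_top"
      using lim C by (intro tendsto_intros) auto
    show "\<forall>\<^sub>F t in at_top. integral\<^sup>L lborel (k t) / C = expectation (\<lambda>\<omega>. X t \<omega> powr q) / t powr (q / \<alpha>)"
      using eventually_gt_at_top[of 0] by eventually_elim (simp add: eq)
  qed
  then show thesis using that[of "integral\<^sup>L lborel kinf / C"] pos C by simp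
qed

text \<open>
  At the critical order the kernel is bounded below by a multiple of \<open>1 / w\<close> near zero, because
  \<open>1 - expectation (exp (- u * X t))\<close> is of order \<open>u powr \<alpha>\<close> there; its integral diverges logarithmically.
\<close>

lemma ml_moment_infinite:
  assumes t: "0 < t"
  shows "(\<integral>\<^sup>+\<omega>. ennreal (X t \<omega> powr \<alpha>) \<partial>M) = \<infinity>"
proof -
  define p Y where "p = \<rho> * t" and "Y = 1 / \<mu> / t"
  define K where "K = p * Y / (1 + Y) / (1 + p * Y)"
  have pY: "0 < p" "0 < Y" using par t by (auto simp: p_def Y_def)
  then have K: "0 < K" unfolding K_def by (intro divide_pos_pos mult_pos_pos add_pos_pos) auto
  have kernel: "K / w \<le> ml_kernel \<alpha> t w" if w: "0 < w" "w \<le> 1" for w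
  proof -
    define y where "y = w powr \<alpha> * Y"
    define z where "z = p * ln (1 + y)"
    have "w powr \<alpha> \<le> 1 powr \<alpha>" using w par by (intro powr_mono2) auto
    then have y: "0 < y" "y \<le> Y"
      using w pY by (auto simp: y_def mult_le_cancel_right1)
    have "ln (1 / (1 + y)) \<le> 1 / (1 + y) - 1" by (rule ln_le_minus_one) (use y in simp)
    then have "y / (1 + y) \<le> ln (1 + y)" using y by (simp add: ln_div field_simps)
    moreover have "y / (1 + Y) \<le> y / (1 + y)" using y by (intro divide_left_mono) auto
    ultimately have "y / (1 + Y) \<le> ln (1 + y)" by linarith
    then have z_low: "p * (y / (1 + Y)) \<le> z" unfolding z_def using pY by (intro mult_left_mono) auto
    have z_pos: "0 < z" unfolding z_def using pY y by (intro mult_pos_pos) auto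
    have "z \<le> p * y" unfolding z_def using pY y by (intro mult_left_mono ln_add_one_self_le_self) auto
    also have "\<dots> \<le> p * Y" using pY y by (intro mult_left_mono) auto
    finally have z_up: "z \<le> p * Y" .
    \<comment> \<open>1 - exp (- z) \<ge> z / (1 + z), with z bounded below and above by multiples of y\<close>
    have "K * w powr \<alpha> = p * (y / (1 + Y)) / (1 + p * Y)" by (simp add: K_def y_def)
    also have "\<dots> \<le> z / (1 + z)"
      using z_low z_up z_pos pY by (intro frac_le) auto
    also have "\<dots> = 1 - 1 / (1 + z)" using z_pos by (simp add: field_simps)
    also have "\<dots> \<le> 1 - 1 / exp z"
      using exp_ge_add_one_self[of z] z_pos by (intro diff_left_mono divide_left_mono) auto
    also have "\<dots> = 1 - (1 + w powr \<alpha> / \<mu> / t) powr (- \<rho> * t)"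
      using y by (simp add: powr_def z_def y_def p_def Y_def exp_minus divide_inverse)
    finally have "w powr (- \<alpha> - 1) * (K * w powr \<alpha>) \<le> ml_kernel \<alpha> t w"
      unfolding ml_kernel_def by (rule mult_left_mono) simp
    moreover have "w powr (- \<alpha> - 1) * (K * w powr \<alpha>) = K / w"
      using w by (simp add: powr_diff powr_minus field_simps)
    ultimately show ?thesis by simp
  qed
  define I where "I = (\<integral>\<^sup>+w. indicator {0<..} w * ennreal (ml_kernel \<alpha> t w) \<partial>lborel)"
  have lower: "ennreal (K * real n) \<le> I" for n
  proof -
    have pos: "0 < w" if "exp (- real n) \<le> w" for w
      using that exp_gt_zero[of "- real n"] by linarith
    have "(\<integral>\<^sup>+w. ennreal (K / w) * indicator {exp (- real n)..1} w \<partial>lborel) =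
        ennreal (K * ln 1 - K * ln (exp (- real n)))"
      by (rule nn_integral_FTC_Icc) (use K pos in \<open>auto intro!: derivative_eq_intros divide_nonneg_pos\<close>)
    then have "ennreal (K * real n) = (\<integral>\<^sup>+w. ennreal (K / w) * indicator {exp (- real n)..1} w \<partial>lborel)"
      by simp
    also have "\<dots> \<le> I" unfolding I_def
    proof (intro nn_integral_mono)
      fix w
      show "ennreal (K / w) * indicator {exp (- real n)..1} w \<le> indicator {0<..} w * ennreal (ml_kernel \<alpha> t w)"
        by (auto simp: indicator_def intro!: ennreal_leI kernel pos)
    qed
    finally show ?thesis .
  qed
  have "I = \<infinity>"
  proof (rule ccontr)
    assume "I \<noteq> \<infinity>"
    then obtain r where r: "I = ennreal r" "0 \<le> r" by (cases I) auto
    obtain n :: nat where "r < real n * K" using ex_less_of_nat_mult[OF K] by blast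
    then show False using lower[of n] r by (simp add: mult.commute)
  qed
  then have "(\<integral>\<^sup>+\<omega>. ennreal (X t \<omega> powr \<alpha>) \<partial>M) * frac_const \<alpha> = \<infinity>"
    using ml_moment_scaled[OF t par(1)] t unfolding I_def by (simp add: ennreal_mult_eq_top_iff)
  then show ?thesis
    using frac_const_bounds[OF par(1,2)] by (auto simp: ennreal_mult_eq_top_iff)
qed

end

end

section \<open>Second moments of the fractional Poisson process and of its time change\<close>

lemma (in prob_space) poisson_process_right_continuous:
  assumes "poisson_process M lam N"
  shows "AE \<omega> in M. \<forall>x\<ge>0. ((\<lambda>t. real (N t \<omega>)) \<longlongrightarrow> real (N x \<omega>)) (at_right x)"
proof -
  have "AE \<omega> in M. cadlag (\<lambda>t. real (N t \<omega>))"
    using assms unfolding poisson_process_def levy_process_def by simp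
  then show ?thesis by eventually_elim (simp add: cadlag_def)
qed

lemma (in prob_space) indep_processes_measurable:
  assumes "indep_processes M X Y" "0 \<le> t"
  shows "X t \<in> borel_measurable M" "Y t \<in> borel_measurable M"
proof -
  have "(\<lambda>\<omega>. \<lambda>t\<in>{0..}. X t \<omega>) \<in> measurable M (PiM {0..} (\<lambda>_. borel))"
    "(\<lambda>\<omega>. \<lambda>t\<in>{0..}. Y t \<omega>) \<in> measurable M (PiM {0..} (\<lambda>_. borel))"
    using assms(1) unfolding indep_processes_def indep_var_distribution_eq by auto
  then have "(\<lambda>\<omega>. (\<lambda>t\<in>{0..}. X t \<omega>) t) \<in> borel_measurable M"
    "(\<lambda>\<omega>. (\<lambda>t\<in>{0..}. Y t \<omega>) t) \<in> borel_measurable M"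
    using assms(2) by (auto intro!: measurable_compose[OF _ measurable_component_singleton] simp del: restrict_apply)
  then show "X t \<in> borel_measurable M" "Y t \<in> borel_measurable M"
    using assms(2) by simp_all
qed

context prob_space
begin

context
  fixes S :: "real \<Rightarrow> 'a \<Rightarrow> real" and N :: "real \<Rightarrow> 'a \<Rightarrow> nat" and \<beta> lam :: real
  assumes stable: "stable_subordinator M \<beta> S" and \<beta>: "0 < \<beta>" "\<beta> < 1"
    and pois: "poisson_process M lam N" and lam: "0 < lam"
    and indep: "indep_processes M (\<lambda>t \<omega>. real (N t \<omega>)) (inverse_subordinator S)"
begin

lemma fpp_right_continuous:
  "AE \<omega> in M. \<forall>x\<ge>0. ((\<lambda>t. real (fpp N S t \<omega>)) \<longlongrightarrow> real (fpp N S x \<omega>)) (at_right x)"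
  using AE_path[OF stable_sub[OF stable \<beta>] stable_top[OF stable \<beta>]]
    poisson_process_right_continuous[OF pois]
proof eventually_elim
  case (elim \<omega>)
  then show ?case
    using time_change_right_continuous[of S \<omega> "\<lambda>t. real (N t \<omega>)"] unfolding fpp_def by auto
qed

text \<open>
  The fractional Poisson process is the Poisson process evaluated at the independent clock \<open>E\<close>.
\<close>

lemma fpp_product_moment:
  assumes ab: "0 \<le> a" "a \<le> b"
  shows "(\<integral>\<^sup>+\<omega>. ennreal (real (fpp N S a \<omega>) * real (fpp N S b \<omega>)) \<partial>M) =
    ennreal lam * (\<integral>\<^sup>+\<omega>. ennreal (inverse_subordinator S a \<omega>) \<partial>M) +
    ennreal (lam\<^sup>2) * (\<integral>\<^sup>+\<omega>. ennreal (inverse_subordinator S a \<omega> * inverse_subordinator S b \<omega>) \<partial>M)"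
    and "(\<integral>\<^sup>+\<omega>. ennreal (real (fpp N S a \<omega>)) \<partial>M) =
    ennreal lam * (\<integral>\<^sup>+\<omega>. ennreal (inverse_subordinator S a \<omega>) \<partial>M)"
proof -
  let ?E = "inverse_subordinator S"
  have b: "0 \<le> b" using ab by simp
  have [measurable]: "?E a \<in> borel_measurable M" "?E b \<in> borel_measurable M"
    using indep_processes_measurable(2)[OF indep] ab by auto
  have path: "AE \<omega> in M. mono_on {0..} (\<lambda>t. S t \<omega>) \<and> filterlim (\<lambda>t. S t \<omega>) at_top at_top"
    using AE_path[OF stable_sub[OF stable \<beta>] stable_top[OF stable \<beta>]] .
  have E: "AE \<omega> in M. 0 \<le> ?E a \<omega> \<and> ?E a \<omega> \<le> ?E b \<omega>"
    using path by eventually_elim (use ab in \<open>auto intro: inverse_nonneg inverse_mono\<close>)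
  then have E': "AE \<omega> in M. 0 \<le> ?E a \<omega> \<and> 0 \<le> ?E b \<omega>" by eventually_elim auto
  note mixture = nn_integral_at_independent_times
    [OF indep_processes_sym[OF indep] _ poisson_process_right_continuous[OF pois] ab(1) b E']
  have "(\<integral>\<^sup>+\<omega>. ennreal (real (fpp N S a \<omega>) * real (fpp N S b \<omega>)) \<partial>M) =
      (\<integral>\<^sup>+\<omega>. (\<integral>\<^sup>+\<omega>'. ennreal (real (N (?E a \<omega>) \<omega>') * real (N (?E b \<omega>) \<omega>')) \<partial>M) \<partial>M)"
    unfolding fpp_def by (rule mixture[where g = "\<lambda>x y. ennreal (x * y)"]) measurable
  also have "\<dots> = (\<integral>\<^sup>+\<omega>. ennreal lam * ennreal (?E a \<omega>) + ennreal (lam\<^sup>2) * ennreal (?E a \<omega> * ?E b \<omega>) \<partial>M)"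
    using E
  proof (intro nn_integral_cong_AE, eventually_elim)
    case (elim \<omega>)
    then have "(\<integral>\<^sup>+\<omega>'. ennreal (real (N (?E a \<omega>) \<omega>') * real (N (?E b \<omega>) \<omega>')) \<partial>M) =
        ennreal (lam * ?E a \<omega> + lam\<^sup>2 * ?E a \<omega> * ?E b \<omega>)"
      by (intro poisson_process_moments[OF pois lam]) auto
    then show ?case
      using elim lam by (simp add: ennreal_mult[symmetric] mult.assoc)
  qed
  also have "\<dots> = ennreal lam * (\<integral>\<^sup>+\<omega>. ennreal (?E a \<omega>) \<partial>M) +
      ennreal (lam\<^sup>2) * (\<integral>\<^sup>+\<omega>. ennreal (?E a \<omega> * ?E b \<omega>) \<partial>M)"
    by (simp add: nn_integral_add nn_integral_cmult)
  finally show "(\<integral>\<^sup>+\<omega>. ennreal (real (fpp N S a \<omega>) * real (fpp N S b \<omega>)) \<partial>M) = \<dots>" .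
  have "(\<integral>\<^sup>+\<omega>. ennreal (real (fpp N S a \<omega>)) \<partial>M) =
      (\<integral>\<^sup>+\<omega>. (\<integral>\<^sup>+\<omega>'. ennreal (real (N (?E a \<omega>) \<omega>')) \<partial>M) \<partial>M)"
    unfolding fpp_def by (rule mixture[where g = "\<lambda>x y. ennreal x"]) measurable
  also have "\<dots> = (\<integral>\<^sup>+\<omega>. ennreal lam * ennreal (?E a \<omega>) \<partial>M)"
    using E
  proof (intro nn_integral_cong_AE, eventually_elim)
    case (elim \<omega>)
    then have "(\<integral>\<^sup>+\<omega>'. ennreal (real (N (?E a \<omega>) \<omega>')) \<partial>M) = ennreal (lam * ?E a \<omega>)"
      by (intro poisson_process_moments(1)[OF pois lam]) auto
    then show ?case using elim lam by (simp add: ennreal_mult)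
  qed
  also have "\<dots> = ennreal lam * (\<integral>\<^sup>+\<omega>. ennreal (?E a \<omega>) \<partial>M)"
    by (simp add: nn_integral_cmult)
  finally show "(\<integral>\<^sup>+\<omega>. ennreal (real (fpp N S a \<omega>)) \<partial>M) = ennreal lam * (\<integral>\<^sup>+\<omega>. ennreal (?E a \<omega>) \<partial>M)" .
qed

text \<open>
  With \<open>c\<close> and \<open>d\<close> the constants of the inverse stable subordinator, \<open>k = lam * c\<close> and \<open>l = lam\<^sup>2 * d\<close>.
\<close>

lemma fpp_moments:
  obtains k l where "0 < k" "k\<^sup>2 < 2 * l"
    and "\<And>a. 0 \<le> a \<Longrightarrow> (\<integral>\<^sup>+\<omega>. ennreal (real (fpp N S a \<omega>)) \<partial>M) = ennreal (k * a powr \<beta>)"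
    and "\<And>a. 0 \<le> a \<Longrightarrow> (\<integral>\<^sup>+\<omega>. ennreal ((real (fpp N S a \<omega>))\<^sup>2) \<partial>M) =
      ennreal (k * a powr \<beta> + 2 * l * a powr (2 * \<beta>))"
    and "\<And>a b. 0 \<le> a \<Longrightarrow> a \<le> b \<Longrightarrow>
      (\<integral>\<^sup>+\<omega>. ennreal (real (fpp N S a \<omega>) * real (fpp N S b \<omega>)) \<partial>M) \<le>
      ennreal (k * a powr \<beta> + l * a powr (2 * \<beta>) + k\<^sup>2 * (a powr \<beta> * b powr \<beta>))"
    and "\<And>a b. 0 \<le> a \<Longrightarrow> a \<le> b \<Longrightarrow>
      ennreal (k * a powr \<beta> + l * a powr (2 * \<beta>) + k\<^sup>2 * (a powr \<beta> * (b - a) powr \<beta>)) \<le>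
      (\<integral>\<^sup>+\<omega>. ennreal (real (fpp N S a \<omega>) * real (fpp N S b \<omega>)) \<partial>M)"
proof -
  let ?E = "inverse_subordinator S"
  obtain c d where c: "0 < c" "c\<^sup>2 < 2 * d"
    and first: "\<And>t. 0 \<le> t \<Longrightarrow> (\<integral>\<^sup>+\<omega>. ennreal (?E t \<omega>) \<partial>M) = ennreal (c * t powr \<beta>)"
    and second: "\<And>t. 0 \<le> t \<Longrightarrow> (\<integral>\<^sup>+\<omega>. ennreal ((?E t \<omega>)\<^sup>2) \<partial>M) = ennreal (2 * d * t powr (2 * \<beta>))"
    and up: "\<And>s t. 0 \<le> s \<Longrightarrow> s \<le> t \<Longrightarrow> (\<integral>\<^sup>+\<omega>. ennreal (?E s \<omega> * ?E t \<omega>) \<partial>M) \<le>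
        ennreal (d * s powr (2 * \<beta>) + c\<^sup>2 * s powr \<beta> * t powr \<beta>)"
    and low: "\<And>s t. 0 \<le> s \<Longrightarrow> s \<le> t \<Longrightarrow>
      ennreal (d * s powr (2 * \<beta>) + c\<^sup>2 * s powr \<beta> * (t - s) powr \<beta>) \<le>
        (\<integral>\<^sup>+\<omega>. ennreal (?E s \<omega> * ?E t \<omega>) \<partial>M)"
    using inverse_stable_moments[OF stable \<beta> indep_processes_measurable(2)[OF indep]] by blast
  have d: "0 < d" using c zero_le_power2[of c] by linarith
  have combine: "ennreal lam * ennreal (c * a powr \<beta>) + ennreal (lam\<^sup>2) * ennreal z =
      ennreal (lam * c * a powr \<beta> + lam\<^sup>2 * z)" if "0 \<le> z" for a z
    using that c lam by (simp add: ennreal_mult[symmetric] mult.assoc)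
  have sq: "(\<integral>\<^sup>+\<omega>. ennreal ((real (fpp N S a \<omega>))\<^sup>2) \<partial>M) =
      ennreal (lam * c * a powr \<beta> + 2 * (lam\<^sup>2 * d) * a powr (2 * \<beta>))" if a: "0 \<le> a" for a
  proof -
    have "(\<integral>\<^sup>+\<omega>. ennreal ((real (fpp N S a \<omega>))\<^sup>2) \<partial>M) =
        ennreal lam * ennreal (c * a powr \<beta>) + ennreal (lam\<^sup>2) * ennreal (2 * d * a powr (2 * \<beta>))"
      using fpp_product_moment(1)[OF a order_refl] first[OF a] second[OF a] by (simp add: power2_eq_square)
    also have "\<dots> = ennreal (lam * c * a powr \<beta> + lam\<^sup>2 * (2 * d * a powr (2 * \<beta>)))"
      using d by (intro combine) simp
    finally show ?thesis by (simp add: mult_ac)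
  qed
  have bounds: "(\<integral>\<^sup>+\<omega>. ennreal (real (fpp N S a \<omega>) * real (fpp N S b \<omega>)) \<partial>M) \<le>
      ennreal (lam * c * a powr \<beta> + lam\<^sup>2 * d * a powr (2 * \<beta>) + (lam * c)\<^sup>2 * (a powr \<beta> * b powr \<beta>))"
    "ennreal (lam * c * a powr \<beta> + lam\<^sup>2 * d * a powr (2 * \<beta>) + (lam * c)\<^sup>2 * (a powr \<beta> * (b - a) powr \<beta>)) \<le>
      (\<integral>\<^sup>+\<omega>. ennreal (real (fpp N S a \<omega>) * real (fpp N S b \<omega>)) \<partial>M)"
    if ab: "0 \<le> a" "a \<le> b" for a b
  proof -
    have eq: "ennreal (lam * c * a powr \<beta> + lam\<^sup>2 * d * a powr (2 * \<beta>) + (lam * c)\<^sup>2 * (a powr \<beta> * v)) =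
        ennreal lam * ennreal (c * a powr \<beta>) +
        ennreal (lam\<^sup>2) * ennreal (d * a powr (2 * \<beta>) + c\<^sup>2 * a powr \<beta> * v)" if "0 \<le> v" for v
      using that d by (subst combine) (auto simp: algebra_simps power_mult_distrib)
    show "(\<integral>\<^sup>+\<omega>. ennreal (real (fpp N S a \<omega>) * real (fpp N S b \<omega>)) \<partial>M) \<le>
      ennreal (lam * c * a powr \<beta> + lam\<^sup>2 * d * a powr (2 * \<beta>) + (lam * c)\<^sup>2 * (a powr \<beta> * b powr \<beta>))"
      unfolding eq[OF powr_ge_zero] fpp_product_moment(1)[OF ab] first[OF ab(1)]
      by (intro add_left_mono mult_left_mono up[OF ab]) simp
    show "ennreal (lam * c * a powr \<beta> + lam\<^sup>2 * d * a powr (2 * \<beta>) + (lam * c)\<^sup>2 * (a powr \<beta> * (b - a) powr \<beta>)) \<le>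
      (\<integral>\<^sup>+\<omega>. ennreal (real (fpp N S a \<omega>) * real (fpp N S b \<omega>)) \<partial>M)"
      unfolding eq[OF powr_ge_zero] fpp_product_moment(1)[OF ab] first[OF ab(1)]
      by (intro add_left_mono mult_left_mono low[OF ab]) simp
  qed
  have mean: "(\<integral>\<^sup>+\<omega>. ennreal (real (fpp N S a \<omega>)) \<partial>M) = ennreal (lam * c * a powr \<beta>)" if "0 \<le> a" for a
    using fpp_product_moment(2)[OF that order_refl] first[OF that] c lam
    by (simp add: ennreal_mult[symmetric] mult.assoc)
  show thesis
  proof (rule that[of "lam * c" "lam\<^sup>2 * d"])
    show "(lam * c)\<^sup>2 < 2 * (lam\<^sup>2 * d)"
      using c lam by (simp add: power_mult_distrib)
  qed (use c lam mean sq bounds in auto)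
qed

context
  fixes X :: "real \<Rightarrow> 'a \<Rightarrow> real"
  assumes X_sub: "subordinator M X"
    and X_indep: "indep_processes M X (\<lambda>t \<omega>. real (fpp N S t \<omega>))"
begin

text \<open>
  A second conditioning, this time on the subordinator \<open>X\<close>.  The integrals may be infinite, so they are
  kept in the extended nonnegative reals.
\<close>

lemma gfnbp_moments:
  obtains k l where "0 < k" "k\<^sup>2 < 2 * l"
    and "\<And>t. 0 \<le> t \<Longrightarrow> (\<integral>\<^sup>+\<omega>. ennreal (real (gfnbp N S X t \<omega>)) \<partial>M) = (\<integral>\<^sup>+\<omega>. ennreal (k * X t \<omega> powr \<beta>) \<partial>M)"
    and "\<And>t. 0 \<le> t \<Longrightarrow> (\<integral>\<^sup>+\<omega>. ennreal ((real (gfnbp N S X t \<omega>))\<^sup>2) \<partial>M) =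
      (\<integral>\<^sup>+\<omega>. ennreal (k * X t \<omega> powr \<beta> + 2 * l * X t \<omega> powr (2 * \<beta>)) \<partial>M)"
    and "\<And>s t. 0 \<le> s \<Longrightarrow> s \<le> t \<Longrightarrow>
      (\<integral>\<^sup>+\<omega>. ennreal (real (gfnbp N S X s \<omega>) * real (gfnbp N S X t \<omega>)) \<partial>M) \<le>
      (\<integral>\<^sup>+\<omega>. ennreal (k * X s \<omega> powr \<beta> + l * X s \<omega> powr (2 * \<beta>) + k\<^sup>2 * (X s \<omega> powr \<beta> * X t \<omega> powr \<beta>)) \<partial>M)"
    and "\<And>s t. 0 \<le> s \<Longrightarrow> s \<le> t \<Longrightarrow>
      (\<integral>\<^sup>+\<omega>. ennreal (k * X s \<omega> powr \<beta> + l * X s \<omega> powr (2 * \<beta>) +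
        k\<^sup>2 * (X s \<omega> powr \<beta> * (X t \<omega> - X s \<omega>) powr \<beta>)) \<partial>M) \<le>
      (\<integral>\<^sup>+\<omega>. ennreal (real (gfnbp N S X s \<omega>) * real (gfnbp N S X t \<omega>)) \<partial>M)"
proof -
  obtain k l where kl: "0 < k" "k\<^sup>2 < 2 * l"
    and first: "\<And>a. 0 \<le> a \<Longrightarrow> (\<integral>\<^sup>+\<omega>. ennreal (real (fpp N S a \<omega>)) \<partial>M) = ennreal (k * a powr \<beta>)"
    and second: "\<And>a. 0 \<le> a \<Longrightarrow> (\<integral>\<^sup>+\<omega>. ennreal ((real (fpp N S a \<omega>))\<^sup>2) \<partial>M) =
      ennreal (k * a powr \<beta> + 2 * l * a powr (2 * \<beta>))"
    and up: "\<And>a b. 0 \<le> a \<Longrightarrow> a \<le> b \<Longrightarrow>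
      (\<integral>\<^sup>+\<omega>. ennreal (real (fpp N S a \<omega>) * real (fpp N S b \<omega>)) \<partial>M) \<le>
      ennreal (k * a powr \<beta> + l * a powr (2 * \<beta>) + k\<^sup>2 * (a powr \<beta> * b powr \<beta>))"
    and low: "\<And>a b. 0 \<le> a \<Longrightarrow> a \<le> b \<Longrightarrow>
      ennreal (k * a powr \<beta> + l * a powr (2 * \<beta>) + k\<^sup>2 * (a powr \<beta> * (b - a) powr \<beta>)) \<le>
      (\<integral>\<^sup>+\<omega>. ennreal (real (fpp N S a \<omega>) * real (fpp N S b \<omega>)) \<partial>M)"
    using fpp_moments by blast
  have ord: "AE \<omega> in M. 0 \<le> X s \<omega> \<and> X s \<omega> \<le> X t \<omega>" if "0 \<le> s" "s \<le> t" for s t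
    using subordinator_nonneg[OF X_sub that(1)] sub_mono[OF X_sub]
    by eventually_elim (use that in \<open>auto dest: mono_onD[of _ _ s t]\<close>)
  have mixture: "(\<integral>\<^sup>+\<omega>. g (real (gfnbp N S X s \<omega>)) (real (gfnbp N S X t \<omega>)) \<partial>M) =
      (\<integral>\<^sup>+\<omega>. (\<integral>\<^sup>+\<omega>'. g (real (fpp N S (X s \<omega>) \<omega>')) (real (fpp N S (X t \<omega>) \<omega>')) \<partial>M) \<partial>M)"
    if "(\<lambda>(a, b). g a b) \<in> borel_measurable (borel \<Otimes>\<^sub>M borel)" "0 \<le> s" "s \<le> t" for g :: "real \<Rightarrow> real \<Rightarrow> ennreal" and s t
    unfolding gfnbp_def
  proof (rule nn_integral_at_independent_times[OF X_indep that(1) fpp_right_continuous])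
    show "AE \<omega> in M. 0 \<le> X s \<omega> \<and> 0 \<le> X t \<omega>"
      using ord[OF that(2,3)] by eventually_elim auto
  qed (use that in auto)
  show thesis
  proof (rule that[OF kl])
    fix t :: real assume t: "0 \<le> t"
    have "(\<integral>\<^sup>+\<omega>. ennreal (real (gfnbp N S X t \<omega>)) \<partial>M) =
        (\<integral>\<^sup>+\<omega>. (\<integral>\<^sup>+\<omega>'. ennreal (real (fpp N S (X t \<omega>) \<omega>')) \<partial>M) \<partial>M)"
      by (rule mixture[of "\<lambda>a b. ennreal a"]) (use t in auto)
    also have "\<dots> = (\<integral>\<^sup>+\<omega>. ennreal (k * X t \<omega> powr \<beta>) \<partial>M)"
      using ord[OF t order_refl] by (intro nn_integral_cong_AE, eventually_elim) (simp add: first)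
    finally show "(\<integral>\<^sup>+\<omega>. ennreal (real (gfnbp N S X t \<omega>)) \<partial>M) = \<dots>" .
    have "(\<integral>\<^sup>+\<omega>. ennreal ((real (gfnbp N S X t \<omega>))\<^sup>2) \<partial>M) =
        (\<integral>\<^sup>+\<omega>. (\<integral>\<^sup>+\<omega>'. ennreal ((real (fpp N S (X t \<omega>) \<omega>'))\<^sup>2) \<partial>M) \<partial>M)"
      by (rule mixture[of "\<lambda>a b. ennreal (a\<^sup>2)"]) (use t in auto)
    also have "\<dots> = (\<integral>\<^sup>+\<omega>. ennreal (k * X t \<omega> powr \<beta> + 2 * l * X t \<omega> powr (2 * \<beta>)) \<partial>M)"
      using ord[OF t order_refl] by (intro nn_integral_cong_AE, eventually_elim) (simp add: second)
    finally show "(\<integral>\<^sup>+\<omega>. ennreal ((real (gfnbp N S X t \<omega>))\<^sup>2) \<partial>M) = \<dots>" .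
  next
    fix s t :: real assume st: "0 \<le> s" "s \<le> t"
    have eq: "(\<integral>\<^sup>+\<omega>. ennreal (real (gfnbp N S X s \<omega>) * real (gfnbp N S X t \<omega>)) \<partial>M) =
        (\<integral>\<^sup>+\<omega>. (\<integral>\<^sup>+\<omega>'. ennreal (real (fpp N S (X s \<omega>) \<omega>') * real (fpp N S (X t \<omega>) \<omega>')) \<partial>M) \<partial>M)"
      by (rule mixture[of "\<lambda>a b. ennreal (a * b)"]) (use st in auto)
    show "(\<integral>\<^sup>+\<omega>. ennreal (real (gfnbp N S X s \<omega>) * real (gfnbp N S X t \<omega>)) \<partial>M) \<le>
      (\<integral>\<^sup>+\<omega>. ennreal (k * X s \<omega> powr \<beta> + l * X s \<omega> powr (2 * \<beta>) + k\<^sup>2 * (X s \<omega> powr \<beta> * X t \<omega> powr \<beta>)) \<partial>M)"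
      unfolding eq using ord[OF st] by (intro nn_integral_mono_AE, eventually_elim) (simp add: up)
    show "(\<integral>\<^sup>+\<omega>. ennreal (k * X s \<omega> powr \<beta> + l * X s \<omega> powr (2 * \<beta>) +
        k\<^sup>2 * (X s \<omega> powr \<beta> * (X t \<omega> - X s \<omega>) powr \<beta>)) \<partial>M) \<le>
      (\<integral>\<^sup>+\<omega>. ennreal (real (gfnbp N S X s \<omega>) * real (gfnbp N S X t \<omega>)) \<partial>M)"
      unfolding eq using ord[OF st] by (intro nn_integral_mono_AE, eventually_elim) (simp add: low)
  qed
qed

end

end

end

section \<open>Asymptotics of the correlation\<close>

text \<open>
  Divide by \<open>(x + y) powr p\<close>: a number in the unit interval is at most its \<open>p\<close>-th power.
\<close>

lemma powr_add_le_add_powr: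
  fixes x y p :: real
  assumes "0 \<le> x" "0 \<le> y" "0 < p" "p \<le> 1"
  shows "(x + y) powr p \<le> x powr p + y powr p"
proof (cases "x + y = 0")
  case False
  with assms have pos: "0 < x + y" by simp
  have ge: "z / (x + y) \<le> (z / (x + y)) powr p" if "0 \<le> z" "z \<le> x + y" for z
  proof (cases "z = 0")
    case False
    with that pos have "(z / (x + y)) powr 1 \<le> (z / (x + y)) powr p"
      using assms by (intro powr_mono') auto
    then show ?thesis using that pos by simp
  qed simp
  have "1 = x / (x + y) + y / (x + y)" using pos by (simp add: add_divide_distrib[symmetric])
  also have "\<dots> \<le> (x / (x + y)) powr p + (y / (x + y)) powr p"
    using assms by (intro add_mono ge) auto
  also have "\<dots> = (x powr p + y powr p) / (x + y) powr p"
    using assms by (simp add: powr_divide add_divide_distrib)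
  finally show ?thesis using pos by (simp add: le_divide_eq)
qed (use assms in simp)

text \<open>
  With \<open>z = a / x\<close>, the bound \<open>1 - z \<le> (1 - z) powr p\<close> shows that the difference is at most
  \<open>a * x powr (p - 1)\<close>.
\<close>

lemma powr_increment_tendsto_0:
  fixes a p :: real
  assumes a: "0 \<le> a" and p: "0 < p" "p < 1"
  shows "((\<lambda>x. x powr p - (x - a) powr p) \<longlongrightarrow> 0) at_top"
proof (rule tendsto_sandwich[of "\<lambda>_. 0"])
  show "\<forall>\<^sub>F x in at_top. 0 \<le> x powr p - (x - a) powr p"
    using eventually_ge_at_top[of a] by eventually_elim (use a p in \<open>auto intro!: powr_mono2\<close>)
  show "\<forall>\<^sub>F x in at_top. x powr p - (x - a) powr p \<le> a * x powr (p - 1)"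
    using eventually_gt_at_top[of a]
  proof eventually_elim
    case (elim x)
    have x: "0 < x" using elim a by simp
    have "(1 - a / x) powr 1 \<le> (1 - a / x) powr p"
      using elim x a p by (intro powr_mono') auto
    then have "x powr p * (1 - a / x) \<le> x powr p * (1 - a / x) powr p"
      using elim x a by (intro mult_left_mono) auto
    also have "\<dots> = (x * (1 - a / x)) powr p" by (simp add: powr_mult)
    also have "x * (1 - a / x) = x - a" using x by (simp add: field_simps)
    finally show ?case using x by (simp add: powr_diff field_simps)
  qed
  show "((\<lambda>x. a * x powr (p - 1)) \<longlongrightarrow> 0) at_top"
    using p by (intro tendsto_mult_right_zero tendsto_neg_powr filterlim_ident) auto
qed auto

lemma (in prob_space) covariance_eq:
  fixes Y Z :: "'a \<Rightarrow> real"
  assumes [measurable]: "Y \<in> borel_measurable M" "Z \<in> borel_measurable M"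
    and sq: "integrable M (\<lambda>\<omega>. (Y \<omega>)\<^sup>2)" "integrable M (\<lambda>\<omega>. (Z \<omega>)\<^sup>2)"
  shows "integrable M (\<lambda>\<omega>. Y \<omega> * Z \<omega>)"
    and "covariance M Y Z = expectation (\<lambda>\<omega>. Y \<omega> * Z \<omega>) - expectation Y * expectation Z"
proof -
  have Y: "integrable M Y" and Z: "integrable M Z"
    using sq by (auto intro: square_integrable_imp_integrable)
  show YZ: "integrable M (\<lambda>\<omega>. Y \<omega> * Z \<omega>)"
  proof (rule Bochner_Integration.integrable_bound[of M "\<lambda>\<omega>. (Y \<omega>)\<^sup>2 + (Z \<omega>)\<^sup>2"])
    show "AE \<omega> in M. norm (Y \<omega> * Z \<omega>) \<le> norm ((Y \<omega>)\<^sup>2 + (Z \<omega>)\<^sup>2)"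
    proof (rule AE_I2)
      fix \<omega>
      have "0 \<le> (\<bar>Y \<omega>\<bar> - \<bar>Z \<omega>\<bar>)\<^sup>2" by simp
      then have "2 * (\<bar>Y \<omega>\<bar> * \<bar>Z \<omega>\<bar>) \<le> (Y \<omega>)\<^sup>2 + (Z \<omega>)\<^sup>2" by (simp add: power2_diff)
      moreover have "0 \<le> \<bar>Y \<omega>\<bar> * \<bar>Z \<omega>\<bar>" by simp
      ultimately have "\<bar>Y \<omega>\<bar> * \<bar>Z \<omega>\<bar> \<le> (Y \<omega>)\<^sup>2 + (Z \<omega>)\<^sup>2" by linarith
      then show "norm (Y \<omega> * Z \<omega>) \<le> norm ((Y \<omega>)\<^sup>2 + (Z \<omega>)\<^sup>2)"
        by (simp add: abs_mult)
    qed
  qed (use sq in auto)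
  have "(\<lambda>\<omega>. (Y \<omega> - expectation Y) * (Z \<omega> - expectation Z)) =
      (\<lambda>\<omega>. Y \<omega> * Z \<omega> - expectation Z * Y \<omega> - expectation Y * Z \<omega> + expectation Y * expectation Z)"
    by (simp add: fun_eq_iff algebra_simps)
  then show "covariance M Y Z = expectation (\<lambda>\<omega>. Y \<omega> * Z \<omega>) - expectation Y * expectation Z"
    unfolding covariance_def using Y Z YZ by (simp add: prob_space mult.commute)
qed

context prob_space
begin

text \<open>
  From here on only the moments of the time-changed process enter, so \<open>G\<close> stands for any nonnegative
  second-order process whose moments are tied to those of \<open>X\<close> in the way found above.
\<close>

context
  fixes X G :: "real \<Rightarrow> 'a \<Rightarrow> real" and \<alpha> \<beta> \<rho> \<mu> k l :: real
  assumes ml: "ml_subordinator M \<alpha> \<rho> \<mu> X" and par: "0 < \<alpha>" "\<alpha> < 1" "0 < \<rho>" "0 < \<mu>"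
    and \<beta>: "0 < \<beta>" "\<beta> < \<alpha>"
    and second_order: "second_order_process M G" and G_nonneg: "\<And>t \<omega>. 0 \<le> G t \<omega>"
    and kl: "0 < k" "k\<^sup>2 < 2 * l"
    and nn_first: "\<And>t. 0 \<le> t \<Longrightarrow> (\<integral>\<^sup>+\<omega>. ennreal (G t \<omega>) \<partial>M) = (\<integral>\<^sup>+\<omega>. ennreal (k * X t \<omega> powr \<beta>) \<partial>M)"
    and nn_second: "\<And>t. 0 \<le> t \<Longrightarrow> (\<integral>\<^sup>+\<omega>. ennreal ((G t \<omega>)\<^sup>2) \<partial>M) =
      (\<integral>\<^sup>+\<omega>. ennreal (k * X t \<omega> powr \<beta> + 2 * l * X t \<omega> powr (2 * \<beta>)) \<partial>M)"
    and nn_up: "\<And>s t. 0 \<le> s \<Longrightarrow> s \<le> t \<Longrightarrow> (\<integral>\<^sup>+\<omega>. ennreal (G s \<omega> * G t \<omega>) \<partial>M) \<le>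
      (\<integral>\<^sup>+\<omega>. ennreal (k * X s \<omega> powr \<beta> + l * X s \<omega> powr (2 * \<beta>) + k\<^sup>2 * (X s \<omega> powr \<beta> * X t \<omega> powr \<beta>)) \<partial>M)"
    and nn_low: "\<And>s t. 0 \<le> s \<Longrightarrow> s \<le> t \<Longrightarrow>
      (\<integral>\<^sup>+\<omega>. ennreal (k * X s \<omega> powr \<beta> + l * X s \<omega> powr (2 * \<beta>) +
        k\<^sup>2 * (X s \<omega> powr \<beta> * (X t \<omega> - X s \<omega>) powr \<beta>)) \<partial>M) \<le> (\<integral>\<^sup>+\<omega>. ennreal (G s \<omega> * G t \<omega>) \<partial>M)"
begin

lemma l_pos: "0 < l"
  using kl zero_le_power2[of k] by linarith

lemma G_measurable: "0 \<le> t \<Longrightarrow> G t \<in> borel_measurable M"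
  and G_square_integrable: "0 \<le> t \<Longrightarrow> integrable M (\<lambda>\<omega>. (G t \<omega>)\<^sup>2)"
  using second_order unfolding second_order_process_def by auto

lemmas X_measurable = ml_measurable[OF ml par]

text \<open>
  Both powers are dominated by a multiple of the integrand that represents the finite second moment of \<open>G\<close>.
\<close>

lemma X_powr_integrable:
  assumes t: "0 \<le> t"
  shows "integrable M (\<lambda>\<omega>. X t \<omega> powr \<beta>)" "integrable M (\<lambda>\<omega>. X t \<omega> powr (2 * \<beta>))"
proof -
  note [measurable] = X_measurable[OF t]
  have "(\<integral>\<^sup>+\<omega>. ennreal (k * X t \<omega> powr \<beta> + 2 * l * X t \<omega> powr (2 * \<beta>)) \<partial>M) < \<infinity>"
    using G_square_integrable[OF t] unfolding nn_second[OF t, symmetric]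
    by (simp add: integrable_iff_bounded)
  then have int: "integrable M (\<lambda>\<omega>. k * X t \<omega> powr \<beta> + 2 * l * X t \<omega> powr (2 * \<beta>))"
    using kl l_pos by (intro integrableI_nonneg) auto
  have "integrable M (\<lambda>\<omega>. k * X t \<omega> powr \<beta>)"
    by (rule Bochner_Integration.integrable_bound[OF int]) (use kl l_pos in auto)
  then show "integrable M (\<lambda>\<omega>. X t \<omega> powr \<beta>)" using kl by simp
  have "integrable M (\<lambda>\<omega>. 2 * l * X t \<omega> powr (2 * \<beta>))"
    by (rule Bochner_Integration.integrable_bound[OF int]) (use kl l_pos in auto)
  then show "integrable M (\<lambda>\<omega>. X t \<omega> powr (2 * \<beta>))" using l_pos by simp
qed

text \<open>
  Otherwise the moment of order \<open>\<alpha>\<close>, which is infinite, would be bounded by 1 plus the finite moment of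
  order \<open>2 * \<beta>\<close>.
\<close>

lemma two_beta_less_alpha: "2 * \<beta> < \<alpha>"
proof (rule ccontr)
  assume "\<not> 2 * \<beta> < \<alpha>"
  then have le: "\<alpha> \<le> 2 * \<beta>" by simp
  have bound: "x powr \<alpha> \<le> 1 + x powr (2 * \<beta>)" if "0 \<le> x" for x :: real
  proof (cases "x \<le> 1")
    case True
    then have "x powr \<alpha> \<le> 1 powr \<alpha>" using that par by (intro powr_mono2) auto
    then show ?thesis by (simp add: add_increasing2)
  next
    case False
    then have "x powr \<alpha> \<le> x powr (2 * \<beta>)" using le by (intro powr_mono) auto
    then show ?thesis by simp
  qed
  have "(\<integral>\<^sup>+\<omega>. ennreal (X 1 \<omega> powr \<alpha>) \<partial>M) \<le> (\<integral>\<^sup>+\<omega>. ennreal (1 + X 1 \<omega> powr (2 * \<beta>)) \<partial>M)"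
  proof (rule nn_integral_mono_AE)
    have "AE \<omega> in M. 0 \<le> X 1 \<omega>" by (rule ml_nonneg[OF ml par]) simp
    then show "AE \<omega> in M. ennreal (X 1 \<omega> powr \<alpha>) \<le> ennreal (1 + X 1 \<omega> powr (2 * \<beta>))"
      by eventually_elim (rule ennreal_leI[OF bound])
  qed
  also have "\<dots> = ennreal (expectation (\<lambda>\<omega>. 1 + X 1 \<omega> powr (2 * \<beta>)))"
    by (rule nn_integral_eq_integral) (use X_powr_integrable[of 1] in auto)
  also have "\<dots> < \<infinity>" by simp
  finally show False using ml_moment_infinite[OF ml par, of 1] by simp
qed

lemma G_mean:
  assumes t: "0 \<le> t"
  shows "expectation (G t) = k * expectation (\<lambda>\<omega>. X t \<omega> powr \<beta>)"
proof -
  have "expectation (G t) = enn2real (\<integral>\<^sup>+\<omega>. ennreal (G t \<omega>) \<partial>M)"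
    using G_measurable[OF t] G_nonneg by (intro integral_eq_nn_integral) auto
  also have "\<dots> = expectation (\<lambda>\<omega>. k * X t \<omega> powr \<beta>)"
    unfolding nn_first[OF t] using X_measurable[OF t] kl
    by (intro integral_eq_nn_integral[symmetric]) auto
  finally show ?thesis by simp
qed

lemma G_variance:
  assumes t: "0 \<le> t"
  shows "variance (G t) = k * expectation (\<lambda>\<omega>. X t \<omega> powr \<beta>) +
    2 * l * expectation (\<lambda>\<omega>. X t \<omega> powr (2 * \<beta>)) - k\<^sup>2 * (expectation (\<lambda>\<omega>. X t \<omega> powr \<beta>))\<^sup>2"
proof -
  note [measurable] = G_measurable[OF t] X_measurable[OF t]
  have "expectation (\<lambda>\<omega>. (G t \<omega>)\<^sup>2) = enn2real (\<integral>\<^sup>+\<omega>. ennreal ((G t \<omega>)\<^sup>2) \<partial>M)"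
    by (intro integral_eq_nn_integral) auto
  also have "\<dots> = expectation (\<lambda>\<omega>. k * X t \<omega> powr \<beta> + 2 * l * X t \<omega> powr (2 * \<beta>))"
    unfolding nn_second[OF t] using kl l_pos by (intro integral_eq_nn_integral[symmetric]) auto
  also have "\<dots> = k * expectation (\<lambda>\<omega>. X t \<omega> powr \<beta>) + 2 * l * expectation (\<lambda>\<omega>. X t \<omega> powr (2 * \<beta>))"
    using X_powr_integrable[OF t] by simp
  finally have sq: "expectation (\<lambda>\<omega>. (G t \<omega>)\<^sup>2) = \<dots>" .
  have int: "integrable M (G t)"
    using G_square_integrable[OF t] by (rule square_integrable_imp_integrable[rotated]) measurable
  have "variance (G t) = expectation (\<lambda>\<omega>. (G t \<omega>)\<^sup>2) - (expectation (G t))\<^sup>2"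
    by (rule variance_eq[OF int G_square_integrable[OF t]])
  then show ?thesis
    unfolding sq G_mean[OF t] by (simp add: power_mult_distrib)
qed

lemma X_moment_square_le:
  assumes t: "0 \<le> t"
  shows "(expectation (\<lambda>\<omega>. X t \<omega> powr \<beta>))\<^sup>2 \<le> expectation (\<lambda>\<omega>. X t \<omega> powr (2 * \<beta>))"
proof -
  have sq: "(\<lambda>\<omega>. (X t \<omega> powr \<beta>)\<^sup>2) = (\<lambda>\<omega>. X t \<omega> powr (2 * \<beta>))"
    by (simp add: fun_eq_iff power2_eq_square powr_add[symmetric])
  have "variance (\<lambda>\<omega>. X t \<omega> powr \<beta>) =
      expectation (\<lambda>\<omega>. (X t \<omega> powr \<beta>)\<^sup>2) - (expectation (\<lambda>\<omega>. X t \<omega> powr \<beta>))\<^sup>2"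
    by (rule variance_eq) (use X_powr_integrable[OF t] in \<open>auto simp: sq\<close>)
  moreover have "0 \<le> variance (\<lambda>\<omega>. X t \<omega> powr \<beta>)" by (rule variance_positive)
  ultimately show ?thesis unfolding sq by linarith
qed

lemma X_moment_pos:
  assumes t: "0 < t"
  shows "0 < expectation (\<lambda>\<omega>. X t \<omega> powr \<beta>)"
proof (rule ccontr)
  have t': "0 \<le> t" using t by simp
  assume "\<not> ?thesis"
  moreover have "0 \<le> expectation (\<lambda>\<omega>. X t \<omega> powr \<beta>)" by simp
  ultimately have "expectation (\<lambda>\<omega>. X t \<omega> powr \<beta>) = 0" by linarith
  then have "AE \<omega> in M. X t \<omega> powr \<beta> = 0"
    using X_powr_integrable(1)[OF t'] by (subst (asm) integral_nonneg_eq_0_iff_AE) auto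
  then have "AE \<omega> in M. exp (- 1 * X t \<omega>) = 1" by eventually_elim simp
  then have "expectation (\<lambda>\<omega>. exp (- 1 * X t \<omega>)) = expectation (\<lambda>\<omega>. 1)"
    using X_measurable[OF t'] by (intro integral_cong_AE) auto
  then have "(\<mu> / (\<mu> + 1)) powr (\<rho> * t) = 1"
    using ml_laplace[OF ml par t', of 1] by (simp add: prob_space)
  moreover have "(\<mu> / (\<mu> + 1)) powr (\<rho> * t) < 1 powr (\<rho> * t)"
    using par t by (intro powr_less_mono2) auto
  ultimately show False by simp
qed

lemma G_variance_pos:
  assumes t: "0 < t"
  shows "0 < variance (G t)"
proof -
  have t': "0 \<le> t" using t by simp
  have "k\<^sup>2 * (expectation (\<lambda>\<omega>. X t \<omega> powr \<beta>))\<^sup>2 \<le> 2 * l * expectation (\<lambda>\<omega>. X t \<omega> powr (2 * \<beta>))"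
    using kl l_pos X_moment_square_le[OF t'] by (intro mult_mono) auto
  moreover have "0 < k * expectation (\<lambda>\<omega>. X t \<omega> powr \<beta>)"
    using kl X_moment_pos[OF t] by simp
  ultimately show ?thesis unfolding G_variance[OF t'] by linarith
qed

text \<open>
  The two quadratic terms are of the order \<open>(t powr (\<beta> / \<alpha>))\<^sup>2\<close> and the linear one is negligible.  If
  \<open>m1\<close> and \<open>m2\<close> denote the limits of the rescaled moments, then the limit is \<open>2 * l * m2 - k\<^sup>2 * m1\<^sup>2\<close>, which
  is positive as \<open>m1\<^sup>2 \<le> m2\<close> and \<open>k\<^sup>2 < 2 * l\<close>.
\<close>

lemma G_variance_asymptotics:
  obtains v where "0 < v" and "((\<lambda>t. variance (G t) / (t powr (\<beta> / \<alpha>))\<^sup>2) \<longlongrightarrow> v) at_top"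
proof -
  let ?m1 = "\<lambda>t. expectation (\<lambda>\<omega>. X t \<omega> powr \<beta>)" and ?m2 = "\<lambda>t. expectation (\<lambda>\<omega>. X t \<omega> powr (2 * \<beta>))"
  let ?r = "\<lambda>t::real. t powr (\<beta> / \<alpha>)"
  obtain m1 where m1: "0 < m1" "((\<lambda>t. ?m1 t / ?r t) \<longlongrightarrow> m1) at_top"
    by (rule ml_moment_asymptotics[OF ml par \<beta>])
  obtain m2 where m2: "0 < m2" "((\<lambda>t. ?m2 t / t powr (2 * \<beta> / \<alpha>)) \<longlongrightarrow> m2) at_top"
    using ml_moment_asymptotics[OF ml par _ two_beta_less_alpha] \<beta> by auto
  have r2: "t powr (2 * \<beta> / \<alpha>) = (?r t)\<^sup>2" for t :: real
    by (simp add: power2_eq_square powr_add[symmetric] add_divide_distrib[symmetric])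
  have decay: "((\<lambda>t. t powr (- (\<beta> / \<alpha>))) \<longlongrightarrow> 0) at_top"
    using par \<beta> by (intro tendsto_neg_powr filterlim_ident) auto
  have "((\<lambda>t. k * (?m1 t / ?r t) * t powr (- (\<beta> / \<alpha>)) + 2 * l * (?m2 t / (?r t)\<^sup>2) - k\<^sup>2 * (?m1 t / ?r t)\<^sup>2)
      \<longlongrightarrow> k * m1 * 0 + 2 * l * m2 - k\<^sup>2 * m1\<^sup>2) at_top"
    using m1(2) m2(2) decay unfolding r2 by (intro tendsto_intros)
  then have "((\<lambda>t. variance (G t) / (?r t)\<^sup>2) \<longlongrightarrow> k * m1 * 0 + 2 * l * m2 - k\<^sup>2 * m1\<^sup>2) at_top"
  proof (rule Lim_transform_eventually)
    show "\<forall>\<^sub>F t in at_top. k * (?m1 t / ?r t) * t powr (- (\<beta> / \<alpha>)) + 2 * l * (?m2 t / (?r t)\<^sup>2) -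
        k\<^sup>2 * (?m1 t / ?r t)\<^sup>2 = variance (G t) / (?r t)\<^sup>2"
      using eventually_gt_at_top[of 0]
    proof eventually_elim
      case (elim t)
      then show ?case unfolding G_variance[OF less_imp_le[OF elim]]
        by (simp add: powr_minus power2_eq_square divide_inverse algebra_simps)
    qed
  qed
  moreover have "0 < k * m1 * 0 + 2 * l * m2 - k\<^sup>2 * m1\<^sup>2"
  proof -
    have "m1\<^sup>2 \<le> m2"
    proof (rule tendsto_le[OF _ m2(2)[unfolded r2] tendsto_power[OF m1(2)]])
      show "\<forall>\<^sub>F t in at_top. (?m1 t / ?r t)\<^sup>2 \<le> ?m2 t / (?r t)\<^sup>2"
        using eventually_ge_at_top[of 0]
        by eventually_elim (auto simp: power_divide intro!: divide_right_mono X_moment_square_le)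
    qed simp
    then have "k\<^sup>2 * m1\<^sup>2 \<le> k\<^sup>2 * m2" by (intro mult_left_mono) auto
    also have "\<dots> < 2 * l * m2" using kl m2 by (intro mult_strict_right_mono) auto
    finally show ?thesis by simp
  qed
  ultimately show thesis using that by blast
qed

text \<open>
  Put \<open>A = X s powr \<beta>\<close>, \<open>D = (X t - X s) powr \<beta>\<close> and \<open>W = X t powr \<beta> - D\<close>.  As \<open>A\<close> and \<open>D\<close> are independent,
  the leading terms of \<open>E[G(s) G(t)]\<close> and \<open>E[G(s)] E[G(t)]\<close> cancel and leave only \<open>E[A W]\<close> and
  \<open>E[A] E[W]\<close>, which vanish by dominated convergence because \<open>0 \<le> W \<le> A\<close> and \<open>W\<close> tends to zero.
\<close>

lemma G_covariance_limit:
  assumes s: "0 < s"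
  obtains c where "0 < c" and "((\<lambda>t. covariance M (G s) (G t)) \<longlongrightarrow> c) at_top"
proof -
  have s': "0 \<le> s" using s by simp
  define A where "A \<omega> = X s \<omega> powr \<beta>" for \<omega>
  \<comment> \<open>max s t instead of t, so that measurability and the bounds hold for every real t\<close>
  define D where "D t \<omega> = (X (max s t) \<omega> - X s \<omega>) powr \<beta>" for t \<omega>
  define W where "W t \<omega> = X (max s t) \<omega> powr \<beta> - D t \<omega>" for t \<omega>
  define c where "c = k * expectation A + l * expectation (\<lambda>\<omega>. X s \<omega> powr (2 * \<beta>))"
  have [measurable]: "X s \<in> borel_measurable M" "X (max s t) \<in> borel_measurable M" for t
    using s' by (auto intro: X_measurable)
  have [measurable]: "A \<in> borel_measurable M" "D t \<in> borel_measurable M" "W t \<in> borel_measurable M" for t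
    unfolding A_def D_def W_def by measurable
  have A2: "(\<lambda>\<omega>. A \<omega> * A \<omega>) = (\<lambda>\<omega>. X s \<omega> powr (2 * \<beta>))"
    by (simp add: fun_eq_iff A_def powr_add[symmetric])
  have A_int: "integrable M A" "integrable M (\<lambda>\<omega>. A \<omega> * A \<omega>)"
    unfolding A2 unfolding A_def using X_powr_integrable[OF s'] by auto
  have A_nonneg: "0 \<le> A \<omega>" for \<omega> by (simp add: A_def)
  have ord: "AE \<omega> in M. 0 \<le> X s \<omega> \<and> (\<forall>t. X s \<omega> \<le> X (max s t) \<omega>)"
    using ml_nonneg[OF ml par s'] sub_mono[OF ml_sub[OF ml par]]
  proof eventually_elim
    case (elim \<omega>)
    have "X s \<omega> \<le> X (max s t) \<omega>" for t
      using mono_onD[OF elim(2), of s "max s t"] s' by auto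
    then show ?case using elim(1) by simp
  qed
  have W_bounds: "AE \<omega> in M. \<forall>t. 0 \<le> W t \<omega> \<and> W t \<omega> \<le> A \<omega>"
    using ord
  proof eventually_elim
    case (elim \<omega>)
    show ?case
    proof
      fix t
      have le: "X s \<omega> \<le> X (max s t) \<omega>" and nonneg: "0 \<le> X s \<omega>" using elim by auto
      have "(X (max s t) \<omega> - X s \<omega>) powr \<beta> \<le> X (max s t) \<omega> powr \<beta>"
        using le nonneg \<beta> by (intro powr_mono2) auto
      moreover have "(X s \<omega> + (X (max s t) \<omega> - X s \<omega>)) powr \<beta> \<le> X s \<omega> powr \<beta> + (X (max s t) \<omega> - X s \<omega>) powr \<beta>"
        using le nonneg \<beta> par by (intro powr_add_le_add_powr) auto
      ultimately show "0 \<le> W t \<omega> \<and> W t \<omega> \<le> A \<omega>" by (simp add: W_def D_def A_def)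
    qed
  qed
  have W_abs: "AE \<omega> in M. norm (W t \<omega>) \<le> A \<omega>" for t
    using W_bounds by eventually_elim auto
  have AW_abs: "AE \<omega> in M. norm (A \<omega> * W t \<omega>) \<le> A \<omega> * A \<omega>" for t
    using W_bounds by eventually_elim (auto simp: abs_mult A_nonneg intro!: mult_left_mono)
  have W_lim: "AE \<omega> in M. ((\<lambda>t. W t \<omega>) \<longlongrightarrow> 0) at_top"
    using ord ml_top[OF ml par]
  proof eventually_elim
    case (elim \<omega>)
    have "filterlim (\<lambda>t. X (max s t) \<omega>) at_top at_top"
      using elim(2)
    proof (rule filterlim_mono_eventually[OF _ order_refl order_refl])
      show "\<forall>\<^sub>F t in at_top. X t \<omega> = X (max s t) \<omega>"
        using eventually_ge_at_top[of s] by eventually_elim (simp add: max_def)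
    qed
    from filterlim_compose[OF powr_increment_tendsto_0 this, of "X s \<omega>" \<beta>]
    show ?case using elim \<beta> par by (simp add: W_def D_def)
  qed
  have EW: "((\<lambda>t. expectation (W t)) \<longlongrightarrow> expectation (\<lambda>\<omega>. 0)) at_top"
    by (rule integral_dominated_convergence_at_top[OF _ _ A_int(1) W_lim])
       (use W_abs in auto)
  have EAW: "((\<lambda>t. expectation (\<lambda>\<omega>. A \<omega> * W t \<omega>)) \<longlongrightarrow> expectation (\<lambda>\<omega>. 0)) at_top"
  proof (rule integral_dominated_convergence_at_top[OF _ _ A_int(2)])
    show "AE \<omega> in M. ((\<lambda>t. A \<omega> * W t \<omega>) \<longlongrightarrow> 0) at_top"
      using W_lim by eventually_elim (rule tendsto_mult_right_zero)
    show "\<forall>\<^sub>F t in at_top. AE \<omega> in M. norm (A \<omega> * W t \<omega>) \<le> A \<omega> * A \<omega>"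
      by (rule always_eventually) (rule allI, rule AW_abs)
  qed measurable
  have cov: "c - k\<^sup>2 * (expectation A * expectation (W t)) \<le> covariance M (G s) (G t) \<and>
      covariance M (G s) (G t) \<le> c + k\<^sup>2 * (expectation (\<lambda>\<omega>. A \<omega> * W t \<omega>) - expectation A * expectation (W t))"
    if t: "s \<le> t" for t
  proof -
    have t': "0 \<le> t" "max s t = t" using s t by auto
    note [measurable] = X_measurable[OF t'(1)] G_measurable[OF t'(1)] G_measurable[OF s']
    have B_int: "integrable M (\<lambda>\<omega>. X t \<omega> powr \<beta>)" using X_powr_integrable[OF t'(1)] by simp
    have W_int: "integrable M (W t)"
      by (rule Bochner_Integration.integrable_bound[OF A_int(1)])
         (use W_abs A_nonneg in \<open>auto simp: abs_of_nonneg\<close>)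
    have D_int: "integrable M (D t)"
    proof -
      have "integrable M (\<lambda>\<omega>. X t \<omega> powr \<beta> - W t \<omega>)" using B_int W_int by simp
      then show ?thesis by (simp add: W_def t')
    qed
    have EB: "expectation (\<lambda>\<omega>. X t \<omega> powr \<beta>) = expectation (W t) + expectation (D t)"
      using W_int D_int by (subst Bochner_Integration.integral_add[symmetric]) (auto simp: W_def t')
    have AW_int: "integrable M (\<lambda>\<omega>. A \<omega> * W t \<omega>)"
      by (rule Bochner_Integration.integrable_bound[OF A_int(2)])
         (use AW_abs A_nonneg in \<open>auto simp: abs_of_nonneg\<close>)
    have ind: "indep_var borel A borel (D t)"
    proof -
      have "indep_var borel (X s) borel (\<lambda>\<omega>. X t \<omega> - X s \<omega>)"
        by (rule levy_process_indep_increment[OF sub_levy[OF ml_sub[OF ml par]] s' t])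
      then have "indep_var borel ((\<lambda>x. x powr \<beta>) \<circ> X s) borel ((\<lambda>x. x powr \<beta>) \<circ> (\<lambda>\<omega>. X t \<omega> - X s \<omega>))"
        by (rule indep_var_compose) auto
      then show ?thesis by (simp add: comp_def A_def[abs_def] D_def[abs_def] t')
    qed
    have AD: "integrable M (\<lambda>\<omega>. A \<omega> * D t \<omega>)" "expectation (\<lambda>\<omega>. A \<omega> * D t \<omega>) = expectation A * expectation (D t)"
      using indep_var_integrable[OF ind A_int(1) D_int] indep_var_lebesgue_integral[OF ind A_int(1) D_int] by auto
    have AB: "(\<lambda>\<omega>. A \<omega> * X t \<omega> powr \<beta>) = (\<lambda>\<omega>. A \<omega> * W t \<omega> + A \<omega> * D t \<omega>)"
      by (simp add: fun_eq_iff W_def t' algebra_simps)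
    have real_expectation: "enn2real (\<integral>\<^sup>+\<omega>. ennreal (k * X s \<omega> powr \<beta> + l * X s \<omega> powr (2 * \<beta>) + k\<^sup>2 * Z \<omega>) \<partial>M) =
        c + k\<^sup>2 * expectation Z"
      "(\<integral>\<^sup>+\<omega>. ennreal (k * X s \<omega> powr \<beta> + l * X s \<omega> powr (2 * \<beta>) + k\<^sup>2 * Z \<omega>) \<partial>M) < \<infinity>"
      if Z: "integrable M Z" "\<And>\<omega>. 0 \<le> Z \<omega>" for Z
    proof -
      have nonneg: "0 \<le> k * X s \<omega> powr \<beta> + l * X s \<omega> powr (2 * \<beta>) + k\<^sup>2 * Z \<omega>" for \<omega>
        using kl l_pos Z by (intro add_nonneg_nonneg mult_nonneg_nonneg) auto
      have "(\<integral>\<^sup>+\<omega>. ennreal (k * X s \<omega> powr \<beta> + l * X s \<omega> powr (2 * \<beta>) + k\<^sup>2 * Z \<omega>) \<partial>M) =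
          ennreal (expectation (\<lambda>\<omega>. k * X s \<omega> powr \<beta> + l * X s \<omega> powr (2 * \<beta>) + k\<^sup>2 * Z \<omega>))"
        by (rule nn_integral_eq_integral) (use X_powr_integrable[OF s'] Z nonneg in auto)
      moreover have "0 \<le> expectation (\<lambda>\<omega>. k * X s \<omega> powr \<beta> + l * X s \<omega> powr (2 * \<beta>) + k\<^sup>2 * Z \<omega>)"
        using nonneg by simp
      moreover have "expectation (\<lambda>\<omega>. k * X s \<omega> powr \<beta> + l * X s \<omega> powr (2 * \<beta>) + k\<^sup>2 * Z \<omega>) = c + k\<^sup>2 * expectation Z"
        using X_powr_integrable[OF s'] Z by (simp add: c_def A_def[abs_def])
      ultimately show "enn2real (\<integral>\<^sup>+\<omega>. ennreal (k * X s \<omega> powr \<beta> + l * X s \<omega> powr (2 * \<beta>) + k\<^sup>2 * Z \<omega>) \<partial>M) =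
          c + k\<^sup>2 * expectation Z"
        "(\<integral>\<^sup>+\<omega>. ennreal (k * X s \<omega> powr \<beta> + l * X s \<omega> powr (2 * \<beta>) + k\<^sup>2 * Z \<omega>) \<partial>M) < \<infinity>" by auto
    qed
    note GG = covariance_eq[OF G_measurable[OF s'] G_measurable[OF t'(1)]
        G_square_integrable[OF s'] G_square_integrable[OF t'(1)]]
    have EGG: "expectation (\<lambda>\<omega>. G s \<omega> * G t \<omega>) = enn2real (\<integral>\<^sup>+\<omega>. ennreal (G s \<omega> * G t \<omega>) \<partial>M)"
      using G_nonneg by (intro integral_eq_nn_integral) auto
    have GG_fin: "(\<integral>\<^sup>+\<omega>. ennreal (G s \<omega> * G t \<omega>) \<partial>M) < \<infinity>"
      using GG(1) G_nonneg by (subst nn_integral_eq_integral) auto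
    have AB_int: "integrable M (\<lambda>\<omega>. A \<omega> * X t \<omega> powr \<beta>)"
      unfolding AB using AW_int AD by simp
    have up: "expectation (\<lambda>\<omega>. G s \<omega> * G t \<omega>) \<le> c + k\<^sup>2 * expectation (\<lambda>\<omega>. A \<omega> * X t \<omega> powr \<beta>)"
      unfolding EGG real_expectation(1)[OF AB_int mult_nonneg_nonneg[OF A_nonneg powr_ge_zero], symmetric]
      using nn_up[OF s' t] real_expectation(2)[OF AB_int mult_nonneg_nonneg[OF A_nonneg powr_ge_zero]]
      by (intro enn2real_mono) (auto simp: A_def)
    have D_nonneg: "0 \<le> D t \<omega>" for \<omega> by (simp add: D_def)
    have low: "c + k\<^sup>2 * expectation (\<lambda>\<omega>. A \<omega> * D t \<omega>) \<le> expectation (\<lambda>\<omega>. G s \<omega> * G t \<omega>)"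
      unfolding EGG real_expectation(1)[OF AD(1) mult_nonneg_nonneg[OF A_nonneg D_nonneg], symmetric]
      using nn_low[OF s' t] GG_fin
      by (intro enn2real_mono) (auto simp: A_def D_def t')
    have "expectation (\<lambda>\<omega>. A \<omega> * X t \<omega> powr \<beta>) = expectation (\<lambda>\<omega>. A \<omega> * W t \<omega>) + expectation A * expectation (D t)"
      unfolding AB using AW_int AD by simp
    moreover have "expectation (G s) * expectation (G t) = k\<^sup>2 * (expectation A * (expectation (W t) + expectation (D t)))"
      unfolding G_mean[OF s'] G_mean[OF t'(1)] EB by (simp add: A_def[abs_def] power2_eq_square)
    ultimately show ?thesis
      using up low AD(2) unfolding GG(2) by (simp add: algebra_simps)
  qed
  have "((\<lambda>t. covariance M (G s) (G t)) \<longlongrightarrow> c) at_top"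
  proof (rule tendsto_sandwich)
    show "\<forall>\<^sub>F t in at_top. c - k\<^sup>2 * (expectation A * expectation (W t)) \<le> covariance M (G s) (G t)"
      using eventually_ge_at_top[of s] by eventually_elim (use cov in blast)
    show "\<forall>\<^sub>F t in at_top. covariance M (G s) (G t) \<le>
        c + k\<^sup>2 * (expectation (\<lambda>\<omega>. A \<omega> * W t \<omega>) - expectation A * expectation (W t))"
      using eventually_ge_at_top[of s] by eventually_elim (use cov in blast)
    have "((\<lambda>t. c - k\<^sup>2 * (expectation A * expectation (W t))) \<longlongrightarrow> c - k\<^sup>2 * (expectation A * 0)) at_top"
      using EW by (intro tendsto_intros) simp
    then show "((\<lambda>t. c - k\<^sup>2 * (expectation A * expectation (W t))) \<longlongrightarrow> c) at_top" by simp
    have "((\<lambda>t. c + k\<^sup>2 * (expectation (\<lambda>\<omega>. A \<omega> * W t \<omega>) - expectation A * expectation (W t))) \<longlongrightarrow>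
        c + k\<^sup>2 * (0 - expectation A * 0)) at_top"
      using EW EAW by (intro tendsto_intros) simp_all
    then show "((\<lambda>t. c + k\<^sup>2 * (expectation (\<lambda>\<omega>. A \<omega> * W t \<omega>) - expectation A * expectation (W t))) \<longlongrightarrow> c) at_top"
      by simp
  qed
  moreover have "0 < c"
    unfolding c_def A_def[abs_def] using kl l_pos X_moment_pos[OF s]
    by (intro add_pos_nonneg mult_pos_pos mult_nonneg_nonneg) auto
  ultimately show thesis using that by blast
qed

text \<open>
  Dividing the correlation by \<open>t powr (- (\<beta> / \<alpha>))\<close> normalises the standard deviation of \<open>G t\<close>, and both the
  covariance and the normalised standard deviation converge.
\<close>

lemma G_lrd: "lrd_property M G"
  unfolding lrd_property_def
proof (rule exI[of _ "\<beta> / \<alpha>"], intro conjI allI impI)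
  show "0 < \<beta> / \<alpha>" "\<beta> / \<alpha> < 1" using par \<beta> by auto
  fix s :: real assume s: "0 < s"
  obtain c where c: "0 < c" "((\<lambda>t. covariance M (G s) (G t)) \<longlongrightarrow> c) at_top"
    using G_covariance_limit[OF s] .
  obtain v where v: "0 < v" "((\<lambda>t. variance (G t) / (t powr (\<beta> / \<alpha>))\<^sup>2) \<longlongrightarrow> v) at_top"
    using G_variance_asymptotics .
  let ?vs = "sqrt (variance (G s))"
  have vs: "0 < ?vs" using G_variance_pos[OF s] by simp
  have "((\<lambda>t. covariance M (G s) (G t) / ?vs / sqrt (variance (G t) / (t powr (\<beta> / \<alpha>))\<^sup>2)) \<longlongrightarrow>
      c / ?vs / sqrt v) at_top"
    using c v vs by (intro tendsto_intros) auto
  then have "((\<lambda>t. correlation M (G s) (G t) / t powr (- (\<beta> / \<alpha>))) \<longlongrightarrow> c / ?vs / sqrt v) at_top"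
  proof (rule Lim_transform_eventually)
    show "\<forall>\<^sub>F t in at_top. covariance M (G s) (G t) / ?vs / sqrt (variance (G t) / (t powr (\<beta> / \<alpha>))\<^sup>2) =
        correlation M (G s) (G t) / t powr (- (\<beta> / \<alpha>))"
      using eventually_gt_at_top[of 0]
    proof eventually_elim
      case (elim t)
      have "sqrt (variance (G t) / (t powr (\<beta> / \<alpha>))\<^sup>2) = sqrt (variance (G t)) / t powr (\<beta> / \<alpha>)"
        by (simp add: real_sqrt_divide)
      show ?case
        unfolding correlation_def \<open>sqrt (variance (G t) / (t powr (\<beta> / \<alpha>))\<^sup>2) = _\<close>
        using elim by (simp add: powr_minus divide_inverse)
    qed
  qed
  moreover have "0 < c / ?vs / sqrt v" using c v vs by simp
  ultimately show "\<exists>c>0. ((\<lambda>t. correlation M (G s) (G t) / t powr (- (\<beta> / \<alpha>))) \<longlongrightarrow> c) at_top" by blast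
qed

end

end

theorem theorem3p3:
  fixes P :: "'a measure"
    and \<alpha> \<beta> \<rho> \<mu> lam :: real
    and S M :: "real \<Rightarrow> 'a \<Rightarrow> real"
    and N :: "real \<Rightarrow> 'a \<Rightarrow> nat"
  assumes "prob_space P"
    and "0 < \<alpha>" "\<alpha> < 1" "0 < \<rho>" "0 < \<mu>" "0 < lam" "0 < \<beta>" "\<beta> < \<alpha>"
    and "stable_subordinator P \<beta> S"
    and "poisson_process P lam N"
    and "ml_subordinator P \<alpha> \<rho> \<mu> M"
    and "indep_processes P (\<lambda>t \<omega>. real (N t \<omega>)) (inverse_subordinator S)"
    and "indep_processes P M (\<lambda>t \<omega>. real (fpp N S t \<omega>))"
    and "second_order_process P (\<lambda>t \<omega>. real (gfnbp N S M t \<omega>))"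
  shows "lrd_property P (\<lambda>t \<omega>. real (gfnbp N S M t \<omega>))"
proof -
  interpret prob_space P by fact
  have \<beta>1: "\<beta> < 1" using assms by simp
  note sub = ml_sub[OF assms(11) assms(2-5)]
  show ?thesis
    by (rule gfnbp_moments[OF assms(9) assms(7) \<beta>1 assms(10) assms(6) assms(12) sub assms(13)])
       (rule G_lrd[OF assms(11) assms(2-5) assms(7,8) assms(14) of_nat_0_le_iff], assumption+)
qed

end
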